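(* Let $\Omega\subset\mathbb{R}^d$ be a Lipschitz bounded domain, let $R$ be a kernel, not identically zero, satisfying (K1)-(K3), and let $\{\delta_n\},\{c_n\},\{C_n\}$ be sequences of positive constants tending to $0$ as $n\to\infty$. For each $n$ and $x\in\partial\Omega$ let $\rho_{\delta_n,x}(y,z)$ be a kernel, symmetric with respect to $y$ and $z$, and set $$E_n(u,a)=\int_{\partial\Omega}\int_\Omega\int_\Omega\rho_{\delta_n,x}(y,z)(u(y)-a(x))(u(z)-a(x))\,dy\,dz\,dx .$$ Assume: (compact support) $\rho_{\delta_n,x}(y,z)$ is only nonzero when $|x-y|\le c_n$ and $|x-z|\le c_n$; (coercivity) for some kernel $\hat K$, not identically zero, satisfying (K1)-(K3), one has $C_nE_n(u_n,0)\ge\|\tilde u_n\|_{L^2(\partial\Omega)}^2$ for every $n$ and every $u_n\in L^2(\Omega)$, where $$\tilde u_n(x)=\frac{1}{\omega_{\delta_n}(x)}\int_\Omega\hat K_{\delta_n}(|x-y|)u_n(y)\,dy,\qquad \omega_{\delta_n}(x)=\int_\Omega\hat K_{\delta_n}(|x-y|)\,dy.$$ For $u\in L^2(\Omega)$ define $$F_n(u)=\frac{1}{\delta_n^2}\int_\Omega\int_\Omega R_{\delta_n}(|x-y|)|u(x)-u(y)|^2dx\,dy+E_n(u,0),$$ $$F(u)=\begin{cases}\int_\Omega|\nabla u(x)|^2dx&\text{if }u\in H^1_0(\Omega),\\ \infty&\text{otherwise.}\end{cases}$$ Then any sequence $\{u_n\}\subset L^2(\Omega)$ such that $$\lim_{n\to\infty}\Big(F_n(u_n)-\inf_{u\in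 L^2(\Omega)}F_n(u)\Big)=0$$ is relatively compact in $L^2(\Omega)$, and $$\lim_{n\to\infty}F_n(u_n)=\min_{u\in L^2(\Omega)}\sigma_RF(u).$$ Furthermore, every cluster point of $\{u_n\}$ is a minimizer of $F$.
   Context: Kernel conditions for $R$ and $\hat K$: (K1) the kernel is a $C^1$ function $[0,\infty)\to[0,\infty)$; (K2) it is monotonically decreasing (non-increasing); (K3) it has compact support in $[0,r^2]$ for some $r>0$. Scaled kernels: $R_\delta(s)=\frac{1}{\delta^d}R\left(\frac{s^2}{\delta^2}\right)$, $\hat K_\delta(s)=\frac{1}{\delta^d}\hat K\left(\frac{s^2}{\delta^2}\right)$ for $\delta>0$. Constant: $\sigma_R=\int_{\mathbb{R}^d}R(|z|^2)|z\cdot e_1|^2\,dz$, with $e_1=(1,0,\dots,0)$. Integrals over $\partial\Omega$ are with respect to surface measure. *)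

theory Defs
  imports "HOL-Analysis.Analysis"
begin

section \<open>Hausdorff measure and surface measure\<close>

text \<open>
  The summand is \<open>0\<close> on the empty set also for \<open>m = 0\<close>, where \<open>0 ^ 0 = 1\<close>, so that the
  \<open>0\<close>-dimensional measure counts points. The factor \<open>unit_ball_vol m / 2 ^ m\<close> is the normalization
  for which the \<open>m\<close>-dimensional Hausdorff measure of a \<open>C\<^sup>1\<close> surface is its area.
\<close>

definition hausdorff_gauge :: "nat \<Rightarrow> 'a::metric_space set \<Rightarrow> ennreal" where
  "hausdorff_gauge m C =
    (if C = {} then 0 else ennreal (unit_ball_vol (real m) * (diameter C / 2) ^ m))"

definition hausdorff_pre :: "nat \<Rightarrow> real \<Rightarrow> 'a::metric_space set \<Rightarrow> ennreal" where
  "hausdorff_pre m \<epsilon> A =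
    (INF C\<in>{C :: nat \<Rightarrow> 'a set. A \<subseteq> (\<Union>j. C j) \<and> (\<forall>j. bounded (C j) \<and> diameter (C j) \<le> \<epsilon>)}.
      \<Sum>j. hausdorff_gauge m (C j))"

definition hausdorff_outer :: "nat \<Rightarrow> 'a::metric_space set \<Rightarrow> ennreal" where
  "hausdorff_outer m A = (SUP \<epsilon>\<in>{0<..}. hausdorff_pre m \<epsilon> A)"

definition hausdorff_measure :: "nat \<Rightarrow> 'a::metric_space measure" where
  "hausdorff_measure m = measure_of UNIV (sets borel) (hausdorff_outer m)"

text \<open>
  \<open>measure_of\<close> would silently yield the zero measure if \<open>hausdorff_outer\<close> were not countably additive
  on the Borel sets. That it is follows from Caratheodory's criterion for metric outer measures.
\<close>

lemma hausdorff_pre_le: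
  assumes "A \<subseteq> (\<Union>j. C j)" "\<And>j. bounded (C j)" "\<And>j. diameter (C j) \<le> \<epsilon>"
  shows "hausdorff_pre m \<epsilon> A \<le> (\<Sum>j. hausdorff_gauge m (C j))"
  unfolding hausdorff_pre_def using assms by (intro INF_lower) auto

lemma hausdorff_pre_mono: "A \<subseteq> B \<Longrightarrow> hausdorff_pre m \<epsilon> A \<le> hausdorff_pre m \<epsilon> B"
  unfolding hausdorff_pre_def by (intro INF_superset_mono) auto

lemma hausdorff_pre_antimono: "\<epsilon> \<le> \<epsilon>' \<Longrightarrow> hausdorff_pre m \<epsilon>' A \<le> hausdorff_pre m \<epsilon> A"
  unfolding hausdorff_pre_def by (intro INF_superset_mono) (auto intro: order_trans)

lemma hausdorff_pre_empty: "\<epsilon> > 0 \<Longrightarrow> hausdorff_pre m \<epsilon> {} = 0"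
  using hausdorff_pre_le[of "{}" "\<lambda>_. {}" \<epsilon> m] by (simp add: hausdorff_gauge_def)

lemma hausdorff_pre_subadditive:
  assumes "\<epsilon> > 0"
  shows "hausdorff_pre m \<epsilon> (\<Union>i::nat. A i) \<le> (\<Sum>i. hausdorff_pre m \<epsilon> (A i))"
proof (cases "\<exists>i. hausdorff_pre m \<epsilon> (A i) = top")
  case True
  then obtain i where "hausdorff_pre m \<epsilon> (A i) = top" by blast
  then have "(\<Sum>i. hausdorff_pre m \<epsilon> (A i)) = top"
    using sum_le_suminf[of "\<lambda>i. hausdorff_pre m \<epsilon> (A i)" "{i}"] by (auto simp: top_unique)
  then show ?thesis by simp
next
  case False
  show ?thesis
  proof (rule ennreal_le_epsilon)
    fix e :: real assume e: "0 < e"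
    let ?P = "\<lambda>i C. A i \<subseteq> (\<Union>j. C j) \<and> (\<forall>j. bounded (C j) \<and> diameter (C j) \<le> \<epsilon>) \<and>
        (\<Sum>j. hausdorff_gauge m (C j)) \<le> hausdorff_pre m \<epsilon> (A i) + ennreal e * ennreal ((1/2)^Suc i)"
    have "\<exists>C::nat \<Rightarrow> 'a set. ?P i C" for i
    proof -
      have "ennreal e * ennreal ((1/2)^Suc i) > 0"
        using e by (simp add: ennreal_zero_less_mult_iff)
      then have "hausdorff_pre m \<epsilon> (A i) < hausdorff_pre m \<epsilon> (A i) + ennreal e * ennreal ((1/2)^Suc i)"
        using False ennreal_add_left_cancel_less[of "hausdorff_pre m \<epsilon> (A i)" 0] by (simp add: less_top)
      then show ?thesis
        unfolding hausdorff_pre_def INF_less_iff by (force intro: less_imp_le)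
    qed
    then obtain C :: "nat \<Rightarrow> nat \<Rightarrow> 'a set" where C: "\<And>i. ?P i (C i)" by metis
    define D where "D k = (case prod_decode k of (i, j) \<Rightarrow> C i j)" for k
    have "hausdorff_pre m \<epsilon> (\<Union>i. A i) \<le> (\<Sum>k. hausdorff_gauge m (D k))"
    proof (rule hausdorff_pre_le)
      show "(\<Union>i. A i) \<subseteq> (\<Union>k. D k)"
      proof
        fix x assume "x \<in> (\<Union>i. A i)"
        then obtain i j where "x \<in> C i j" using C by blast
        then have "x \<in> D (prod_encode (i, j))" by (simp add: D_def)
        then show "x \<in> (\<Union>k. D k)" by blast
      qed
    qed (use C in \<open>auto simp: D_def split: prod.split\<close>)
    also have "\<dots> = (\<Sum>i. \<Sum>j. hausdorff_gauge m (C i j))"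
      using suminf_ennreal_2dimen[of "\<lambda>i. \<Sum>j. hausdorff_gauge m (C i j)"
          "\<lambda>(i,j). hausdorff_gauge m (C i j)"]
      by (simp add: D_def split_def)
    also have "\<dots> \<le> (\<Sum>i. hausdorff_pre m \<epsilon> (A i) + ennreal e * ennreal ((1/2)^Suc i))"
      using C by (intro suminf_le) auto
    also have "\<dots> = (\<Sum>i. hausdorff_pre m \<epsilon> (A i)) + ennreal e * (\<Sum>i. ennreal ((1/2)^Suc i))"
      by (simp add: suminf_add[symmetric])
    also have "(\<Sum>i. ennreal ((1/2)^Suc i)) = 1"
      using power_half_series sums_unique by (subst suminf_ennreal_eq[where x=1]) auto
    finally show "hausdorff_pre m \<epsilon> (\<Union>i. A i) \<le> (\<Sum>i. hausdorff_pre m \<epsilon> (A i)) + ennreal e"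
      by simp
  qed
qed

lemma hausdorff_outer_subadditive:
  "hausdorff_outer m (\<Union>i::nat. A i) \<le> (\<Sum>i. hausdorff_outer m (A i))"
  unfolding hausdorff_outer_def[of m "\<Union>i. A i"]
proof (rule SUP_least)
  fix \<epsilon> :: real assume "\<epsilon> \<in> {0<..}"
  then have "hausdorff_pre m \<epsilon> (\<Union>i. A i) \<le> (\<Sum>i. hausdorff_pre m \<epsilon> (A i))"
    by (intro hausdorff_pre_subadditive) auto
  also have "\<dots> \<le> (\<Sum>i. hausdorff_outer m (A i))"
    using \<open>\<epsilon> \<in> {0<..}\<close> by (intro suminf_le) (auto simp: hausdorff_outer_def intro: SUP_upper)
  finally show "hausdorff_pre m \<epsilon> (\<Union>i. A i) \<le> (\<Sum>i. hausdorff_outer m (A i))" .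
qed

lemma outer_measure_space_hausdorff:
  "outer_measure_space UNIV (hausdorff_outer m :: 'a::metric_space set \<Rightarrow> ennreal)"
  unfolding outer_measure_space_def
proof (intro conjI)
  show "positive UNIV (hausdorff_outer m :: 'a set \<Rightarrow> ennreal)"
    by (auto simp: positive_def hausdorff_outer_def hausdorff_pre_empty)
  show "increasing UNIV (hausdorff_outer m :: 'a set \<Rightarrow> ennreal)"
    by (auto simp: increasing_def hausdorff_outer_def intro!: SUP_mono' hausdorff_pre_mono)
  show "countably_subadditive UNIV (hausdorff_outer m :: 'a set \<Rightarrow> ennreal)"
    by (auto simp: countably_subadditive_def intro: hausdorff_outer_subadditive)
qed

lemma hausdorff_outer_separated:
  fixes A B :: "'a::metric_space set"
  assumes "\<eta> > 0" and sep: "\<And>a b. a \<in> A \<Longrightarrow> b \<in> B \<Longrightarrow> \<eta> \<le> dist a b"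
  shows "hausdorff_outer m A + hausdorff_outer m B \<le> hausdorff_outer m (A \<union> B)"
proof -
  have small: "hausdorff_pre m \<epsilon> A + hausdorff_pre m \<epsilon> B \<le> hausdorff_pre m \<epsilon> (A \<union> B)"
    if "0 < \<epsilon>" "\<epsilon> < \<eta>" for \<epsilon>
    unfolding hausdorff_pre_def[of m \<epsilon> "A \<union> B"]
  proof (rule INF_greatest)
    fix C :: "nat \<Rightarrow> 'a set"
    assume "C \<in> {C. A \<union> B \<subseteq> (\<Union>j. C j) \<and> (\<forall>j. bounded (C j) \<and> diameter (C j) \<le> \<epsilon>)}"
    then have C: "A \<union> B \<subseteq> (\<Union>j. C j)" "\<And>j. bounded (C j)" "\<And>j. diameter (C j) \<le> \<epsilon>" by auto
    define CA where "CA j = (if C j \<inter> A = {} then {} else C j)" for j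
    define CB where "CB j = (if C j \<inter> B = {} then {} else C j)" for j
    have "hausdorff_pre m \<epsilon> A \<le> (\<Sum>j. hausdorff_gauge m (CA j))"
    proof (rule hausdorff_pre_le)
      show "A \<subseteq> (\<Union>j. CA j)" using C(1) by (fastforce simp: CA_def)
    qed (use C that in \<open>auto simp: CA_def\<close>)
    moreover have "hausdorff_pre m \<epsilon> B \<le> (\<Sum>j. hausdorff_gauge m (CB j))"
    proof (rule hausdorff_pre_le)
      show "B \<subseteq> (\<Union>j. CB j)" using C(1) by (fastforce simp: CB_def)
    qed (use C that in \<open>auto simp: CB_def\<close>)
    moreover have "(\<Sum>j. hausdorff_gauge m (CA j)) + (\<Sum>j. hausdorff_gauge m (CB j)) =
        (\<Sum>j. hausdorff_gauge m (CA j) + hausdorff_gauge m (CB j))"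
      by (intro suminf_add) auto
    moreover have "\<dots> \<le> (\<Sum>j. hausdorff_gauge m (C j))"
    proof (rule suminf_le)
      fix j
      have "C j \<inter> A = {} \<or> C j \<inter> B = {}"
      proof (rule ccontr)
        assume "\<not> ?thesis"
        then obtain a b where ab: "a \<in> C j" "a \<in> A" "b \<in> C j" "b \<in> B" by blast
        have "dist a b \<le> diameter (C j)" using diameter_bounded_bound[OF C(2)] ab by blast
        then show False using C(3)[of j] sep[OF ab(2,4)] that by linarith
      qed
      then show "hausdorff_gauge m (CA j) + hausdorff_gauge m (CB j) \<le> hausdorff_gauge m (C j)"
        by (auto simp: CA_def CB_def hausdorff_gauge_def)
    qed auto
    ultimately show "hausdorff_pre m \<epsilon> A + hausdorff_pre m \<epsilon> B \<le> (\<Sum>j. hausdorff_gauge m (C j))"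
      by (metis add_mono order_trans)
  qed
  have "hausdorff_outer m A + hausdorff_outer m B =
      (SUP \<epsilon>\<in>{0<..}. hausdorff_pre m \<epsilon> A + hausdorff_pre m \<epsilon> B)"
    unfolding hausdorff_outer_def
  proof (rule SUP_add_directed_ennreal[symmetric])
    fix i j :: real assume "i \<in> {0<..}" "j \<in> {0<..}"
    then show "\<exists>k\<in>{0<..}. hausdorff_pre m i A + hausdorff_pre m j B \<le>
        hausdorff_pre m k A + hausdorff_pre m k B"
      by (intro bexI[of _ "min i j"] add_mono hausdorff_pre_antimono) auto
  qed
  also have "\<dots> \<le> hausdorff_outer m (A \<union> B)"
  proof (rule SUP_least)
    fix \<epsilon> :: real assume \<epsilon>: "\<epsilon> \<in> {0<..}"
    let ?e = "min \<epsilon> (\<eta> / 2)"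
    have "hausdorff_pre m \<epsilon> A + hausdorff_pre m \<epsilon> B \<le> hausdorff_pre m ?e A + hausdorff_pre m ?e B"
      by (intro add_mono hausdorff_pre_antimono) auto
    also have "\<dots> \<le> hausdorff_pre m ?e (A \<union> B)" using \<epsilon> \<open>\<eta> > 0\<close> by (intro small) auto
    also have "\<dots> \<le> hausdorff_outer m (A \<union> B)"
      unfolding hausdorff_outer_def using \<epsilon> \<open>\<eta> > 0\<close> by (intro SUP_upper) auto
    finally show "hausdorff_pre m \<epsilon> A + hausdorff_pre m \<epsilon> B \<le> hausdorff_outer m (A \<union> B)" .
  qed
  finally show ?thesis .
qed

lemma metric_outer_measure_closed:
  fixes f :: "'a::metric_space set \<Rightarrow> ennreal"
  assumes oms: "outer_measure_space UNIV f"
    and csub: "\<And>A. f (\<Union>i::nat. A i) \<le> (\<Sum>i. f (A i))"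
    and sep: "\<And>A B \<eta>. \<eta> > 0 \<Longrightarrow> (\<And>a b. a \<in> A \<Longrightarrow> b \<in> B \<Longrightarrow> \<eta> \<le> dist a b) \<Longrightarrow> f A + f B \<le> f (A \<union> B)"
    and C: "closed C"
  shows "f (T \<inter> C) + f (T - C) \<le> f T"
proof (cases "C = {} \<or> f T = top")
  case True
  moreover have "f {} = 0" using oms by (auto simp: outer_measure_space_def positive_def)
  ultimately show ?thesis by auto
next
  case False
  then have Cne: "C \<noteq> {}" and fT: "f T < top" by (auto simp: less_top)
  have f0: "f {} = 0" using oms by (auto simp: outer_measure_space_def positive_def)
  have mono: "\<And>A B. A \<subseteq> B \<Longrightarrow> f A \<le> f B"
    using oms by (auto simp: outer_measure_space_def increasing_def)
  have sub2: "f (X \<union> Y) \<le> f X + f Y" for X Y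
  proof -
    have "f (\<Union>i::nat. if i = 0 then X else if i = 1 then Y else {}) \<le>
        (\<Sum>i::nat. f (if i = 0 then X else if i = 1 then Y else {}))" by (rule csub)
    also have "\<dots> = (\<Sum>i\<in>{0,1::nat}. f (if i = 0 then X else if i = 1 then Y else {}))"
      by (intro suminf_finite) (auto simp: f0)
    also have "\<dots> = f X + f Y" by simp
    finally show ?thesis
      by (rule order_trans[rotated]) (auto intro!: mono split: if_splits)
  qed
  define g where "g x = infdist x C" for x
  have g: "\<bar>g x - g y\<bar> \<le> dist x y" for x y
    using infdist_triangle_abs[of x C y] by (simp add: g_def)
  have gC: "g x = 0 \<longleftrightarrow> x \<in> C" for x
    using C Cne by (simp add: g_def in_closed_iff_infdist_zero)
  have g0: "0 \<le> g x" for x by (simp add: g_def infdist_nonneg)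
  define A where "A k = {x\<in>T. 1 / real (Suc k) \<le> g x}" for k
  define B where "B k = {x\<in>T. 1 / real (Suc (Suc k)) \<le> g x \<and> g x < 1 / real (Suc k)}" for k
  have fin: "(\<Sum>i<n. f (B (2*i + p))) \<le> f T" for n p
  proof -
    have "(\<Sum>i<n. f (B (2*i + p))) \<le> f (\<Union>i<n. B (2*i + p))"
    proof (induction n)
      case (Suc n)
      have "f (\<Union>i<n. B (2*i + p)) + f (B (2*n + p)) \<le> f ((\<Union>i<n. B (2*i + p)) \<union> B (2*n + p))"
      proof (rule sep)
        define \<eta> where "\<eta> = 1 / real (2*n + p) - 1 / real (Suc (2*n + p))"
        show "0 < (if n = 0 then 1 else \<eta>)"
        proof (cases "n = 0")
          case False
          then have "1 / real (Suc (2*n + p)) < 1 / real (2*n + p)"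
            by (intro divide_strict_left_mono) auto
          then show ?thesis using False by (simp only: \<eta>_def) auto
        qed simp
        fix a b assume "a \<in> (\<Union>i<n. B (2*i + p))" "b \<in> B (2*n + p)"
        then obtain i where i: "i < n" and a: "1 / real (Suc (Suc (2*i + p))) \<le> g a"
          and b: "g b < 1 / real (Suc (2*n + p))" by (auto simp: B_def)
        have "1 / real (2*n + p) \<le> 1 / real (Suc (Suc (2*i + p)))"
          using i by (intro divide_left_mono) auto
        then have "\<eta> \<le> g a - g b" using a b by (simp add: \<eta>_def)
        then show "(if n = 0 then 1 else \<eta>) \<le> dist a b" using g[of a b] i by auto
      qed
      moreover have "(\<Union>i<n. B (2*i + p)) \<union> B (2*n + p) = (\<Union>i<Suc n. B (2*i + p))"
        by (auto simp: lessThan_Suc)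
      ultimately have "f (\<Union>i<n. B (2*i + p)) + f (B (2*n + p)) \<le> f (\<Union>i<Suc n. B (2*i + p))"
        by simp
      then show ?case
        unfolding sum.lessThan_Suc by (rule order_trans[OF add_right_mono[OF Suc.IH]])
    qed (simp add: f0)
    also have "\<dots> \<le> f T" by (intro mono) (auto simp: B_def)
    finally show ?thesis .
  qed
  have sumB: "(\<Sum>i. f (B i)) \<le> f T + f T"
  proof -
    have "(\<Sum>i<n. f (B i)) \<le> f T + f T" for n
    proof -
      have "(\<Sum>i<n. f (B i)) \<le> (\<Sum>i<2*n. f (B i))" by (intro sum_mono2) auto
      also have "\<dots> = (\<Sum>i<n. f (B (2*i + 0))) + (\<Sum>i<n. f (B (2*i + 1)))"
        by (induction n) (auto simp: ac_simps)
      also have "\<dots> \<le> f T + f T" by (intro add_mono fin)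
      finally show ?thesis .
    qed
    then show ?thesis by (intro suminf_le_const) auto
  qed
  have main: "f (T \<inter> C) + f (A k) \<le> f T" for k
  proof -
    have "f (T \<inter> C) + f (A k) \<le> f ((T \<inter> C) \<union> A k)"
    proof (rule sep[of "1 / real (Suc k)"])
      fix a b assume "a \<in> T \<inter> C" "b \<in> A k"
      then have "g a = 0" "1 / real (Suc k) \<le> g b" using gC by (auto simp: A_def)
      then show "1 / real (Suc k) \<le> dist a b" using g[of a b] by auto
    qed simp
    also have "\<dots> \<le> f T" by (intro mono) (auto simp: A_def)
    finally show ?thesis .
  qed
  have cover: "f (T - C) \<le> f (A k) + (\<Sum>i. f (B (i + k)))" for k
  proof -
    have "T - C \<subseteq> A k \<union> (\<Union>i. B (i + k))"
    proof
      fix x assume x: "x \<in> T - C"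
      then have pos: "0 < g x" using gC[of x] g0[of x] by auto
      show "x \<in> A k \<union> (\<Union>i. B (i + k))"
      proof (cases "x \<in> A k")
        case False
        then have lt: "g x < 1 / real (Suc k)" using x by (auto simp: A_def)
        define j where "j = (LEAST j. 1 / real (Suc j) \<le> g x)"
        obtain n where "1 / real (Suc n) < g x"
          using reals_Archimedean[OF pos] by (auto simp: inverse_eq_divide)
        then have j: "1 / real (Suc j) \<le> g x"
          using LeastI[of "\<lambda>j. 1 / real (Suc j) \<le> g x" n] by (simp add: j_def)
        have "k < j"
        proof (rule ccontr)
          assume "\<not> k < j"
          then have "1 / real (Suc k) \<le> 1 / real (Suc j)" by (intro divide_left_mono) auto
          then show False using j lt by linarith
        qed
        then obtain i where i: "j = Suc (i + k)" using less_iff_Suc_add[of k j] by (auto simp: add.commute)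
        then have "\<not> 1 / real (Suc (i + k)) \<le> g x"
          using not_less_Least[of "i + k" "\<lambda>j. 1 / real (Suc j) \<le> g x"] by (simp add: j_def)
        then have "x \<in> B (i + k)" using j i x by (auto simp: B_def)
        then show ?thesis by blast
      qed simp
    qed
    then have "f (T - C) \<le> f (A k \<union> (\<Union>i. B (i + k)))" by (rule mono)
    also have "\<dots> \<le> f (A k) + f (\<Union>i. B (i + k))" by (rule sub2)
    also have "\<dots> \<le> f (A k) + (\<Sum>i. f (B (i + k)))" by (intro add_left_mono csub)
    finally show ?thesis .
  qed
  have sumfin: "(\<Sum>i. f (B i)) < top" using sumB fT by (auto intro: le_less_trans)
  have tail: "(\<lambda>k. \<Sum>i. f (B (i + k))) \<longlonglongrightarrow> 0"
  proof -
    have fB: "f (B i) < top" for i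
      by (rule le_less_trans[OF mono fT]) (auto simp: B_def)
    define b where "b i = enn2real (f (B i))" for i
    have b: "f (B i) = ennreal (b i)" "0 \<le> b i" for i using fB by (auto simp: b_def)
    have sb: "summable b"
      using sumfin b by (intro summable_suminf_not_top) auto
    have "(\<lambda>k. \<Sum>i. b (i + k)) \<longlonglongrightarrow> 0" by (rule suminf_exist_split2[OF sb])
    then have "(\<lambda>k. ennreal (\<Sum>i. b (i + k))) \<longlonglongrightarrow> ennreal 0" by (rule tendsto_ennrealI)
    moreover have "ennreal (\<Sum>i. b (i + k)) = (\<Sum>i. f (B (i + k)))" for k
      using sb b by (simp add: suminf_ennreal2 summable_iff_shift)
    ultimately show ?thesis by simp
  qed
  have "f (T \<inter> C) + f (T - C) \<le> f T + (\<Sum>i. f (B (i + k)))" for k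
  proof -
    have "f (T \<inter> C) + f (T - C) \<le> f (T \<inter> C) + (f (A k) + (\<Sum>i. f (B (i + k))))"
      by (rule add_left_mono[OF cover])
    also have "\<dots> \<le> f T + (\<Sum>i. f (B (i + k)))"
      unfolding add.assoc[symmetric] by (rule add_right_mono[OF main])
    finally show ?thesis .
  qed
  moreover have "(\<lambda>k. f T + (\<Sum>i. f (B (i + k)))) \<longlonglongrightarrow> f T + 0"
    by (intro tendsto_add tendsto_const tail)
  ultimately show ?thesis by (auto intro: LIMSEQ_le_const)
qed

lemma borel_subset_lambda_system_hausdorff:
  "sets (borel :: 'a::metric_space measure) \<subseteq> lambda_system UNIV UNIV (hausdorff_outer m)"
  and measure_space_lambda_system_hausdorff:
  "measure_space (UNIV :: 'a set) (lambda_system UNIV UNIV (hausdorff_outer m)) (hausdorff_outer m)"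
proof -
  let ?L = "lambda_system UNIV UNIV (hausdorff_outer m) :: 'a set set"
  have U: "sigma_algebra (UNIV :: 'a set) UNIV" by (metis Pow_UNIV sigma_algebra_Pow)
  then have alg: "algebra (UNIV :: 'a set) UNIV" by (rule sigma_algebra.axioms(1))
  show ms: "measure_space UNIV ?L (hausdorff_outer m)"
    by (rule sigma_algebra.caratheodory_lemma[OF U outer_measure_space_hausdorff])
  then have L: "sigma_algebra UNIV ?L" by (simp add: measure_space_def)
  have "S \<in> ?L" if "closed S" for S :: "'a set"
  proof -
    have "hausdorff_outer m (T \<inter> S) + hausdorff_outer m (T - S) = hausdorff_outer m T" for T
    proof (rule antisym)
      show "hausdorff_outer m (T \<inter> S) + hausdorff_outer m (T - S) \<le> hausdorff_outer m T"
        using outer_measure_space_hausdorff hausdorff_outer_subadditive hausdorff_outer_separated that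
        by (rule metric_outer_measure_closed)
      have "subadditive UNIV (hausdorff_outer m :: 'a set \<Rightarrow> ennreal)"
        using outer_measure_space_hausdorff[of m] U
        by (intro ring_of_sets.countably_subadditive_subadditive)
          (auto simp: outer_measure_space_def sigma_algebra_def algebra_def)
      then have "hausdorff_outer m ((T \<inter> S) \<union> (T - S)) \<le> hausdorff_outer m (T \<inter> S) + hausdorff_outer m (T - S)"
        by (rule subadditiveD) auto
      then show "hausdorff_outer m T \<le> hausdorff_outer m (T \<inter> S) + hausdorff_outer m (T - S)"
        by (simp add: Int_Diff_Un)
    qed
    then show ?thesis by (simp add: algebra.lambda_system_eq[OF alg])
  qed
  then have "sigma_sets UNIV (Collect closed) \<subseteq> ?L"
    by (intro sigma_algebra.sigma_sets_subset[OF L]) auto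
  moreover have "sets (borel :: 'a measure) = sigma_sets UNIV (Collect closed)"
    by (subst borel_eq_closed) (rule sets_measure_of, simp)
  ultimately show "sets (borel :: 'a measure) \<subseteq> ?L" by simp
qed

lemma space_hausdorff_measure [simp]: "space (hausdorff_measure m :: 'a::metric_space measure) = UNIV"
  and sets_hausdorff_measure [simp, measurable_cong]:
    "sets (hausdorff_measure m :: 'a::metric_space measure) = sets borel"
  using sets.sigma_sets_eq[of "borel :: 'a::metric_space measure"]
  by (simp_all add: hausdorff_measure_def space_measure_of_conv)

lemma emeasure_hausdorff_measure:
  fixes A :: "'a::metric_space set"
  assumes "A \<in> sets borel"
  shows "emeasure (hausdorff_measure m) A = hausdorff_outer m A"
proof (rule emeasure_measure_of[OF hausdorff_measure_def])
  let ?L = "lambda_system UNIV UNIV (hausdorff_outer m) :: 'a set set"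
  have L: "positive ?L (hausdorff_outer m)" "countably_additive ?L (hausdorff_outer m)"
    using measure_space_lambda_system_hausdorff by (auto simp: measure_space_def)
  have sub: "sets (borel :: 'a measure) \<subseteq> ?L"
    by (rule borel_subset_lambda_system_hausdorff)
  show "positive (sets (hausdorff_measure m :: 'a measure)) (hausdorff_outer m)"
    using L(1) by (simp add: positive_def)
  show "countably_additive (sets (hausdorff_measure m :: 'a measure)) (hausdorff_outer m)"
    unfolding countably_additive_def sets_hausdorff_measure
  proof (intro allI impI)
    fix A :: "nat \<Rightarrow> 'a set"
    assume "range A \<subseteq> sets borel" "disjoint_family A" "\<Union> (range A) \<in> sets borel"
    then have "range A \<subseteq> ?L" "disjoint_family A" "\<Union> (range A) \<in> ?L"
      using sub by auto
    then show "(\<Sum>i. hausdorff_outer m (A i)) = hausdorff_outer m (\<Union> (range A))"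
      using L(2)[unfolded countably_additive_def, rule_format, of A] by simp
  qed
qed (use assms in simp_all)

text \<open>
  The completion makes every function that is measurable for the Hausdorff measure on the boundary,
  and not only the Borel functions, measurable (as \<open>lebesgue\<close> does for \<open>lborel\<close>).
\<close>

definition surface_measure :: "'a::euclidean_space set \<Rightarrow> 'a measure" where
  "surface_measure \<Omega> =
    completion (restrict_space (hausdorff_measure (DIM('a) - 1)) (frontier \<Omega>))"


section \<open>Bounded Lipschitz domains\<close>

text \<open>
  Locally, after a rotation taking the last coordinate direction to the unit vector \<open>\<nu>\<close>, the set is
  the part of a ball that lies above the graph of a Lipschitz function; \<open>x - (x \<bullet> \<nu>) *\<^sub>R \<nu>\<close> is the
  orthogonal projection of \<open>x\<close> to the hyperplane that plays the role of \<open>d - 1\<close> coordinates.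
\<close>

definition lipschitz_boundary :: "'a::euclidean_space set \<Rightarrow> bool" where
  "lipschitz_boundary \<Omega> \<longleftrightarrow>
    (\<forall>p\<in>frontier \<Omega>. \<exists>r>0. \<exists>\<nu> L. \<exists>\<gamma> :: 'a \<Rightarrow> real.
      norm \<nu> = 1 \<and> L-lipschitz_on {w. w \<bullet> \<nu> = 0} \<gamma> \<and>
      \<Omega> \<inter> ball p r = {x \<in> ball p r. \<gamma> (x - (x \<bullet> \<nu>) *\<^sub>R \<nu>) < x \<bullet> \<nu>})"

definition bounded_lipschitz_domain :: "'a::euclidean_space set \<Rightarrow> bool" where
  "bounded_lipschitz_domain \<Omega> \<longleftrightarrow>
    \<Omega> \<noteq> {} \<and> open \<Omega> \<and> connected \<Omega> \<and> bounded \<Omega> \<and> lipschitz_boundary \<Omega>"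


section \<open>The spaces \<open>L\<^sup>2\<close> and \<open>H\<^sub>0\<^sup>1\<close>\<close>

text \<open>
  Elements of \<open>L\<^sup>2(\<Omega>)\<close> are represented by functions on the whole space whose values outside \<open>\<Omega>\<close> are
  irrelevant. Functions that agree almost everywhere on \<open>\<Omega>\<close> are not identified, so the
  topology of \<open>L\<^sup>2(\<Omega>)\<close> is the one of a pseudometric.
\<close>

definition L2 :: "'a::euclidean_space set \<Rightarrow> ('a \<Rightarrow> 'b::euclidean_space) set" where
  "L2 \<Omega> = {u. u \<in> borel_measurable (lebesgue_on \<Omega>) \<and>
              integrable (lebesgue_on \<Omega>) (\<lambda>x. (norm (u x))\<^sup>2)}"

definition L2_norm :: "'a::euclidean_space set \<Rightarrow> ('a \<Rightarrow> 'b::euclidean_space) \<Rightarrow> real" where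
  "L2_norm \<Omega> u = sqrt (\<integral>x. (norm (u x))\<^sup>2 \<partial>lebesgue_on \<Omega>)"

definition L2_topology :: "'a::euclidean_space set \<Rightarrow> ('a \<Rightarrow> real) topology" where
  "L2_topology \<Omega> = topology (\<lambda>U. U \<subseteq> L2 \<Omega> \<and>
    (\<forall>u\<in>U. \<exists>\<epsilon>>0. \<forall>v\<in>L2 \<Omega>. L2_norm \<Omega> (\<lambda>x. v x - u x) < \<epsilon> \<longrightarrow> v \<in> U))"

lemma openin_L2_topology:
  fixes \<Omega> :: "'a::euclidean_space set"
  shows "openin (L2_topology \<Omega>) U \<longleftrightarrow> U \<subseteq> L2 \<Omega> \<and>
    (\<forall>u\<in>U. \<exists>\<epsilon>>0. \<forall>v\<in>L2 \<Omega>. L2_norm \<Omega> (\<lambda>x. v x - u x) < \<epsilon> \<longrightarrow> v \<in> U)"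
proof -
  let ?O = "\<lambda>U :: ('a \<Rightarrow> real) set. U \<subseteq> L2 \<Omega> \<and>
    (\<forall>u\<in>U. \<exists>\<epsilon>>0. \<forall>v\<in>L2 \<Omega>. L2_norm \<Omega> (\<lambda>x. v x - u x) < \<epsilon> \<longrightarrow> v \<in> U)"
  have "istopology ?O"
    unfolding istopology_def
  proof (intro conjI allI impI)
    fix S T :: "('a \<Rightarrow> real) set" assume S: "?O S" and T: "?O T"
    show "S \<inter> T \<subseteq> L2 \<Omega>" using S by blast
    show "\<forall>u\<in>S \<inter> T. \<exists>\<epsilon>>0. \<forall>v\<in>L2 \<Omega>. L2_norm \<Omega> (\<lambda>x. v x - u x) < \<epsilon> \<longrightarrow> v \<in> S \<inter> T"
    proof
      fix u assume u: "u \<in> S \<inter> T"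
      obtain e where "e > 0" "\<forall>v\<in>L2 \<Omega>. L2_norm \<Omega> (\<lambda>x. v x - u x) < e \<longrightarrow> v \<in> S" using S u by blast
      moreover obtain e' where "e' > 0" "\<forall>v\<in>L2 \<Omega>. L2_norm \<Omega> (\<lambda>x. v x - u x) < e' \<longrightarrow> v \<in> T"
        using T u by blast
      ultimately show "\<exists>\<epsilon>>0. \<forall>v\<in>L2 \<Omega>. L2_norm \<Omega> (\<lambda>x. v x - u x) < \<epsilon> \<longrightarrow> v \<in> S \<inter> T"
        by (intro exI[of _ "min e e'"]) auto
    qed
  next
    fix \<U> :: "('a \<Rightarrow> real) set set" assume U: "\<forall>S\<in>\<U>. ?O S"
    show "\<Union>\<U> \<subseteq> L2 \<Omega>" using U by blast
    show "\<forall>u\<in>\<Union>\<U>. \<exists>\<epsilon>>0. \<forall>v\<in>L2 \<Omega>. L2_norm \<Omega> (\<lambda>x. v x - u x) < \<epsilon> \<longrightarrow> v \<in> \<Union>\<U>"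
    proof
      fix u assume "u \<in> \<Union>\<U>"
      then obtain S where S: "S \<in> \<U>" "u \<in> S" by blast
      then obtain e where "e > 0" "\<forall>v\<in>L2 \<Omega>. L2_norm \<Omega> (\<lambda>x. v x - u x) < e \<longrightarrow> v \<in> S" using U by blast
      with S show "\<exists>\<epsilon>>0. \<forall>v\<in>L2 \<Omega>. L2_norm \<Omega> (\<lambda>x. v x - u x) < \<epsilon> \<longrightarrow> v \<in> \<Union>\<U>" by blast
    qed
  qed
  then show ?thesis by (simp add: L2_topology_def)
qed

lemma topspace_L2_topology [simp]: "topspace (L2_topology \<Omega>) = L2 \<Omega>"
proof (rule antisym)
  show "topspace (L2_topology \<Omega>) \<subseteq> L2 \<Omega>"
    using openin_topspace[of "L2_topology \<Omega>"] unfolding openin_L2_topology by (rule conjunct1)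
  have "openin (L2_topology \<Omega>) (L2 \<Omega>)"
    unfolding openin_L2_topology by (auto intro: zero_less_one)
  then show "L2 \<Omega> \<subseteq> topspace (L2_topology \<Omega>)" by (rule openin_subset)
qed

definition relatively_compact_in :: "'a topology \<Rightarrow> 'a set \<Rightarrow> bool" where
  "relatively_compact_in X S \<longleftrightarrow> S \<subseteq> topspace X \<and> compactin X (X closure_of S)"

text \<open>Cluster points of a sequence are the limits of its subsequences.\<close>

definition cluster_point_in :: "'a topology \<Rightarrow> (nat \<Rightarrow> 'a) \<Rightarrow> 'a \<Rightarrow> bool" where
  "cluster_point_in X f l \<longleftrightarrow> (\<exists>s :: nat \<Rightarrow> nat. strict_mono s \<and> limitin X (f \<circ> s) l sequentially)"

primrec Ck_fun :: "nat \<Rightarrow> ('a::euclidean_space \<Rightarrow> real) \<Rightarrow> bool" where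
  "Ck_fun 0 f \<longleftrightarrow> continuous_on UNIV f"
| "Ck_fun (Suc k) f \<longleftrightarrow>
    (\<forall>x. f differentiable (at x)) \<and> (\<forall>v. Ck_fun k (\<lambda>x. frechet_derivative f (at x) v))"

definition test_functions :: "'a::euclidean_space set \<Rightarrow> ('a \<Rightarrow> real) set" where
  "test_functions \<Omega> =
    {\<phi>. (\<forall>k. Ck_fun k \<phi>) \<and> compact (closure {x. \<phi> x \<noteq> 0}) \<and> closure {x. \<phi> x \<noteq> 0} \<subseteq> \<Omega>}"

definition is_weak_gradient ::
    "'a::euclidean_space set \<Rightarrow> ('a \<Rightarrow> real) \<Rightarrow> ('a \<Rightarrow> 'a) \<Rightarrow> bool" where
  "is_weak_gradient \<Omega> u g \<longleftrightarrow> g \<in> L2 \<Omega> \<and>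
    (\<forall>\<phi>\<in>test_functions \<Omega>. \<forall>b\<in>Basis.
      (\<integral>x. u x * frechet_derivative \<phi> (at x) b \<partial>lebesgue_on \<Omega>) =
      - (\<integral>x. (g x \<bullet> b) * \<phi> x \<partial>lebesgue_on \<Omega>))"

text \<open>A weak gradient is determined almost everywhere, so that integrals do not see the choice.\<close>

definition weak_gradient :: "'a::euclidean_space set \<Rightarrow> ('a \<Rightarrow> real) \<Rightarrow> 'a \<Rightarrow> 'a" where
  "weak_gradient \<Omega> u = (SOME g. is_weak_gradient \<Omega> u g)"

definition H1 :: "'a::euclidean_space set \<Rightarrow> ('a \<Rightarrow> real) set" where
  "H1 \<Omega> = {u \<in> L2 \<Omega>. \<exists>g. is_weak_gradient \<Omega> u g}"

definition H1_norm :: "'a::euclidean_space set \<Rightarrow> ('a \<Rightarrow> real) \<Rightarrow> real" where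
  "H1_norm \<Omega> u = sqrt ((L2_norm \<Omega> u)\<^sup>2 + (L2_norm \<Omega> (weak_gradient \<Omega> u))\<^sup>2)"

definition H10 :: "'a::euclidean_space set \<Rightarrow> ('a \<Rightarrow> real) set" where
  "H10 \<Omega> = {u \<in> H1 \<Omega>. \<exists>\<phi> :: nat \<Rightarrow> 'a \<Rightarrow> real.
    (\<forall>k. \<phi> k \<in> test_functions \<Omega>) \<and> (\<lambda>k. H1_norm \<Omega> (\<lambda>x. u x - \<phi> k x)) \<longlonglongrightarrow> 0}"


section \<open>Kernels and energies\<close>

definition admissible_kernel :: "(real \<Rightarrow> real) \<Rightarrow> bool" where
  "admissible_kernel K \<longleftrightarrow>
    (\<forall>s\<ge>0. 0 \<le> K s) \<and>
    (\<exists>K'. (\<forall>s\<ge>0. (K has_real_derivative K' s) (at s within {0..})) \<and> continuous_on {0..} K') \<and>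
    antimono_on {0..} K \<and>
    (\<exists>r>0. \<forall>s\<ge>0. K s \<noteq> 0 \<longrightarrow> s \<le> r\<^sup>2)"

definition scaled_kernel :: "nat \<Rightarrow> (real \<Rightarrow> real) \<Rightarrow> real \<Rightarrow> real \<Rightarrow> real" where
  "scaled_kernel d K \<delta> s = 1 / \<delta> ^ d * K (s\<^sup>2 / \<delta>\<^sup>2)"

definition sigma_const :: "(real \<Rightarrow> real) \<Rightarrow> 'a::euclidean_space \<Rightarrow> real" where
  "sigma_const R e1 = (\<integral>z. R ((norm z)\<^sup>2) * \<bar>z \<bullet> e1\<bar>\<^sup>2 \<partial>lebesgue)"

definition kernel_mass :: "'a::euclidean_space set \<Rightarrow> (real \<Rightarrow> real) \<Rightarrow> real \<Rightarrow> 'a \<Rightarrow> real" where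
  "kernel_mass \<Omega> K \<delta> x = (\<integral>y. scaled_kernel DIM('a) K \<delta> (norm (x - y)) \<partial>lebesgue_on \<Omega>)"

definition kernel_average ::
    "'a::euclidean_space set \<Rightarrow> (real \<Rightarrow> real) \<Rightarrow> real \<Rightarrow> ('a \<Rightarrow> real) \<Rightarrow> 'a \<Rightarrow> real" where
  "kernel_average \<Omega> K \<delta> u x =
    1 / kernel_mass \<Omega> K \<delta> x * (\<integral>y. scaled_kernel DIM('a) K \<delta> (norm (x - y)) * u y \<partial>lebesgue_on \<Omega>)"

definition boundary_energy ::
    "'a::euclidean_space set \<Rightarrow> ('a \<Rightarrow> 'a \<Rightarrow> 'a \<Rightarrow> real) \<Rightarrow> ('a \<Rightarrow> real) \<Rightarrow> ('a \<Rightarrow> real) \<Rightarrow> real" where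
  "boundary_energy \<Omega> \<rho> u a =
    (\<integral>x. (\<integral>z. (\<integral>y. \<rho> x y z * (u y - a x) * (u z - a x) \<partial>lebesgue_on \<Omega>) \<partial>lebesgue_on \<Omega>)
      \<partial>surface_measure \<Omega>)"

definition nonlocal_energy ::
    "'a::euclidean_space set \<Rightarrow> (real \<Rightarrow> real) \<Rightarrow> ('a \<Rightarrow> 'a \<Rightarrow> 'a \<Rightarrow> real) \<Rightarrow> real \<Rightarrow> ('a \<Rightarrow> real) \<Rightarrow> real"
where
  "nonlocal_energy \<Omega> R \<rho> \<delta> u =
    1 / \<delta>\<^sup>2 * (\<integral>y. (\<integral>x. scaled_kernel DIM('a) R \<delta> (norm (x - y)) * \<bar>u x - u y\<bar>\<^sup>2
      \<partial>lebesgue_on \<Omega>) \<partial>lebesgue_on \<Omega>)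
    + boundary_energy \<Omega> \<rho> u (\<lambda>_. 0)"

definition dirichlet_energy :: "'a::euclidean_space set \<Rightarrow> ('a \<Rightarrow> real) \<Rightarrow> ereal" where
  "dirichlet_energy \<Omega> u =
    (if u \<in> H10 \<Omega> then ereal (\<integral>x. (norm (weak_gradient \<Omega> u x))\<^sup>2 \<partial>lebesgue_on \<Omega>) else \<infinity>)"

definition is_minimizer_on :: "'b set \<Rightarrow> ('b \<Rightarrow> ereal) \<Rightarrow> 'b \<Rightarrow> bool" where
  "is_minimizer_on S f u \<longleftrightarrow> is_arg_min f (\<lambda>v. v \<in> S) u"

end

theory Submission
  imports Defs
begin

text \<open>
  The limit energy has no source term, so its minimum over \<open>L\<^sup>2(\<Omega>)\<close> is \<open>0\<close>, and a function that
  vanishes almost everywhere attains it. The infimum of every \<open>F\<^sub>n\<close> is \<open>0\<close> as well: coercivity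
  forces \<open>E\<^sub>n(v, 0) \<ge> 0\<close>, and \<open>F\<^sub>n(0) = 0\<close>. An almost minimizing sequence is therefore one with
  \<open>F\<^sub>n(u\<^sub>n) \<rightarrow> 0\<close>, and the theorem follows from \<open>u\<^sub>n \<rightarrow> 0\<close> in \<open>L\<^sup>2(\<Omega>)\<close>, which is
  \<open>L2_norm_tendsto_0\<close>. It is a nonlocal Poincare inequality with a boundary term; both terms of
  \<open>F\<^sub>n(u\<^sub>n)\<close> are needed for it, the second one through \<open>\<parallel>w\<^sub>n\<parallel>\<^sup>2 \<le> C\<^sub>n E\<^sub>n(u\<^sub>n, 0) \<rightarrow> 0\<close> in
  \<open>L\<^sup>2(\<partial>\<Omega>)\<close>, where \<open>w\<^sub>n\<close> are the kernel averages of \<open>u\<^sub>n\<close>.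

  Since the kernel \<open>R\<close> is bounded below near \<open>0\<close>, the first term controls \<open>\<integral>\<integral> (u(x) - u(y))\<^sup>2\<close>
  over pairs at distance at most \<open>\<epsilon> = \<eta>\<delta>\<^sub>n\<close> by \<open>g\<^sub>n \<epsilon>\<^sup>d\<^sup>+\<^sup>2\<close> with \<open>g\<^sub>n \<rightarrow> 0\<close>. Comparing \<open>u(x)\<close> and
  \<open>u(x + h)\<close> with the values of \<open>u\<close> on a ball near both points turns this into
  \<open>\<integral> (u(x + h) - u(x))\<^sup>2 dx \<le> K g\<^sub>n \<epsilon>\<^sup>2\<close> for short shifts \<open>h\<close>; a shift of length of order \<open>1\<close>
  takes \<open>1/\<epsilon>\<close> such steps, and by Cauchy-Schwarz costs \<open>(1/\<epsilon>)\<^sup>2\<close> times as much, so that it is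
  bounded by \<open>K g\<^sub>n\<close> uniformly in \<open>\<epsilon>\<close> (\<open>increment_chain_scaled\<close>). Hence \<open>u\<^sub>n\<close> is close to a
  constant on every ball well inside \<open>\<Omega>\<close> (\<open>ball_poincare\<close>). In a boundary chart the same holds for
  shifts in the direction that points above the graph, and these reach all the way down to the
  boundary (\<open>vertical_increment\<close>).

  The averages \<open>w\<^sub>n\<close> fix the constant. Near a boundary point, let \<open>m\<close> be the constant to which
  \<open>u\<^sub>n\<close> is close on a ball at a fixed height above the point. For a boundary point \<open>x\<close> the
  difference \<open>\<bar>m - w\<^sub>n(x)\<bar>\<close> is at most a constant times the mean of \<open>\<bar>u\<^sub>n - m\<bar>\<close> over a ball of
  radius of order \<open>\<epsilon>\<close>. Integrated over a boundary patch, these means are at most of order \<open>1/\<epsilon>\<close>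
  times the integral of \<open>\<bar>u\<^sub>n - m\<bar>\<close> over a strip of width of order \<open>\<epsilon>\<close>, because a ball of radius
  \<open>s\<close> meets the boundary in surface measure at most \<open>K s\<^sup>d\<^sup>-\<^sup>1\<close> (\<open>hausdorff_graph_upper\<close>). The
  strip is moved up in steps of length \<open>s \<le> \<epsilon>/2\<close>; its translates overlap only boundedly often, so
  all steps together cost no more than a constant times a single one over the whole chart, which
  is of order \<open>\<epsilon>\<close> times the square root of \<open>g\<^sub>n\<close> (\<open>strip_increment\<close>). The factors \<open>\<epsilon>\<close> and \<open>1/\<epsilon>\<close>
  cancel, and as the patch has positive surface measure (\<open>hausdorff_graph_pos\<close>), \<open>m \<rightarrow> 0\<close> and
  \<open>u\<^sub>n \<rightarrow> 0\<close> on one ball (\<open>vanishes_on_ball_of_trace\<close>). The Poincare inequality carries this along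
  chains of balls through the connected set \<open>\<Omega>\<close>, and the vertical shifts carry it to the boundary
  (\<open>vanishes_on_domain\<close>).

  The Dirichlet energy is defined through an arbitrary choice of weak gradient. That the chosen
  gradient of a null function is itself null is the fundamental lemma of the calculus of
  variations (\<open>AE_zero_of_test_functions\<close>).
\<close>

section \<open>Surface measure of Lipschitz graphs\<close>

text \<open>
  Boundary charts are described by the height \<open>\<phi> x\<close> of a point above a Lipschitz graph, measured
  along the unit vector \<open>\<nu>\<close>. In this form the graph is the level set \<open>\<phi> = 0\<close>, vertical translation
  is addition, and no coordinates on the hyperplane orthogonal to \<open>\<nu>\<close> are needed. In dimension one
  the graph is a single point, which the arguments below cover without change.
\<close>

locale height_function =
  fixes \<phi> :: "'a::euclidean_space \<Rightarrow> real" and \<nu> :: 'a and \<Lambda> :: real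
  assumes norm_\<nu> [simp]: "norm \<nu> = 1"
    and lipschitz: "\<bar>\<phi> x - \<phi> y\<bar> \<le> \<Lambda> * norm (x - y)"
    and shift: "\<phi> (x + t *\<^sub>R \<nu>) = \<phi> x + t"
begin

lemma \<Lambda>_ge_1: "1 \<le> \<Lambda>"
  using lipschitz[of "0 + 1 *\<^sub>R \<nu>" 0] unfolding shift by simp

lemma continuous_height: "continuous_on A \<phi>"
proof (rule lipschitz_on_continuous_on)
  show "\<Lambda>-lipschitz_on A \<phi>"
    using lipschitz \<Lambda>_ge_1 by (intro lipschitz_onI) (auto simp: dist_norm)
qed

lemma measurable_height [measurable]: "\<phi> \<in> borel_measurable borel"
  by (rule borel_measurable_continuous_onI[OF continuous_height])

abbreviation graph :: "'a set" where "graph \<equiv> {x. \<phi> x = 0}"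

lemma closed_graph: "closed graph"
  using continuous_closed_vimage[of "{0}" \<phi>] continuous_height[of UNIV]
  by (auto simp: vimage_def continuous_on_eq_continuous_at)

text \<open>
  Stacking balls over the graph replaces a covering argument in \<open>d - 1\<close> dimensions. Around every
  point of \<open>X\<close> and its translates by \<open>0, \<eta>, 2\<eta>, \<dots>\<close> up to height \<open>s\<close> there is a ball of radius
  \<open>\<eta> / (2\<Lambda>)\<close>. Balls of one layer are disjoint by separation, and those of different layers because
  their heights differ. About \<open>card X * s / \<eta>\<close> disjoint balls of volume \<open>\<eta>\<^sup>d\<close> fit into a ball of
  radius \<open>4s\<close> only if \<open>card X\<close> is at most of order \<open>(s / \<eta>)\<^sup>d\<^sup>-\<^sup>1\<close>.
\<close>

lemma card_separated_le:
  assumes \<eta>: "0 < \<eta>" "\<eta> \<le> s" and fin: "finite X" and X: "X \<subseteq> graph \<inter> cball y s"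
    and sep: "\<And>a b. a \<in> X \<Longrightarrow> b \<in> X \<Longrightarrow> a \<noteq> b \<Longrightarrow> \<eta> \<le> dist a b"
  shows "real (card X) * \<eta> ^ (DIM('a) - 1) \<le> (8 * \<Lambda>) ^ DIM('a) * s ^ (DIM('a) - 1)"
proof -
  define J where "J = nat \<lceil>s / \<eta>\<rceil>"
  have J: "s \<le> real J * \<eta>" "real J * \<eta> \<le> s + \<eta>"
  proof -
    have 0: "0 \<le> s / \<eta>" using \<eta> by simp
    have "s / \<eta> \<le> real J" unfolding J_def by (rule real_nat_ceiling_ge)
    then show "s \<le> real J * \<eta>" using \<eta> by (simp add: field_simps)
    have "real J \<le> s / \<eta> + 1" unfolding J_def using 0 by linarith
    then have "real J * \<eta> \<le> (s / \<eta> + 1) * \<eta>" using \<eta> by (intro mult_right_mono) auto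
    also have "\<dots> = s + \<eta>" using \<eta> by (simp add: field_simps)
    finally show "real J * \<eta> \<le> s + \<eta>" .
  qed
  define \<beta> where "\<beta> = \<eta> / (2 * \<Lambda>)"
  have \<beta>: "0 < \<beta>" "\<beta> \<le> \<eta> / 2" "\<Lambda> * \<beta> = \<eta> / 2"
    using \<eta> \<Lambda>_ge_1 by (auto simp: \<beta>_def field_simps)
  define B where "B = (\<lambda>(x, j). ball (x + (real j * \<eta>) *\<^sub>R \<nu>) \<beta>)"
  have height: "\<bar>\<phi> z - real j * \<eta>\<bar> < \<eta> / 2" if "z \<in> B (x, j)" "x \<in> X" for z x j
  proof -
    have "\<bar>\<phi> z - \<phi> (x + (real j * \<eta>) *\<^sub>R \<nu>)\<bar> \<le> \<Lambda> * norm (z - (x + (real j * \<eta>) *\<^sub>R \<nu>))"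
      by (rule lipschitz)
    also have "\<dots> < \<Lambda> * \<beta>"
      using that \<Lambda>_ge_1 by (intro mult_strict_left_mono) (auto simp: B_def dist_norm norm_minus_commute)
    finally show ?thesis using that X \<beta> unfolding shift by auto
  qed
  have disj: "disjoint_family_on B (X \<times> {..<J})"
    unfolding disjoint_family_on_def
  proof (intro ballI impI)
    fix k k' assume k: "k \<in> X \<times> {..<J}" "k' \<in> X \<times> {..<J}" "k \<noteq> k'"
    obtain x j x' j' where kk: "k = (x, j)" "k' = (x', j')" by (cases k, cases k')
    then have x: "x \<in> X" "x' \<in> X" and ne: "x = x' \<longrightarrow> j \<noteq> j'" using k by auto
    show "B k \<inter> B k' = {}"
    proof (rule ccontr)
      assume "B k \<inter> B k' \<noteq> {}"
      then have "B (x, j) \<inter> B (x', j') \<noteq> {}" unfolding kk .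
      then obtain z where z: "z \<in> B (x, j)" "z \<in> B (x', j')" by blast
      have "\<bar>real j * \<eta> - real j' * \<eta>\<bar> < \<eta>"
        using height[OF z(1) x(1)] height[OF z(2) x(2)] by linarith
      then have "\<bar>real j - real j'\<bar> * \<eta> < 1 * \<eta>"
        using \<eta> by (simp add: left_diff_distrib[symmetric] abs_mult)
      then have "\<bar>real j - real j'\<bar> < 1" using \<eta> by (simp add: mult_less_cancel_right)
      then have jj: "j = j'" by linarith
      then have "\<eta> \<le> dist x x'" using ne sep x by blast
      moreover have "dist (x + (real j * \<eta>) *\<^sub>R \<nu>) (x' + (real j * \<eta>) *\<^sub>R \<nu>) < \<beta> + \<beta>"
        using z jj dist_triangle_less_add[of "x + (real j * \<eta>) *\<^sub>R \<nu>" z \<beta> "x' + (real j * \<eta>) *\<^sub>R \<nu>" \<beta>]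
        by (auto simp: B_def dist_commute)
      ultimately show False using \<beta> by simp
    qed
  qed
  have inball: "(\<Union>k\<in>X \<times> {..<J}. B k) \<subseteq> ball y (4 * s)"
  proof
    fix z assume "z \<in> (\<Union>k\<in>X \<times> {..<J}. B k)"
    then obtain x j where x: "x \<in> X" "j < J" "dist (x + (real j * \<eta>) *\<^sub>R \<nu>) z < \<beta>"
      by (auto simp: B_def)
    have "dist y (x + (real j * \<eta>) *\<^sub>R \<nu>) \<le> dist y x + dist x (x + (real j * \<eta>) *\<^sub>R \<nu>)"
      by (rule dist_triangle)
    also have "\<dots> \<le> s + real j * \<eta>"
      using x X \<eta> by (auto simp: dist_norm abs_mult subset_iff)
    finally have 1: "dist y (x + (real j * \<eta>) *\<^sub>R \<nu>) \<le> s + real j * \<eta>" .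
    have "real j + 1 \<le> real J" using x by linarith
    then have "(real j + 1) * \<eta> \<le> real J * \<eta>" using \<eta> by (intro mult_right_mono) auto
    then have "real j * \<eta> + \<eta> \<le> s + \<eta>" using J by (simp add: algebra_simps)
    moreover have "dist y z \<le> dist y (x + (real j * \<eta>) *\<^sub>R \<nu>) + dist (x + (real j * \<eta>) *\<^sub>R \<nu>) z"
      by (rule dist_triangle)
    ultimately show "z \<in> ball y (4 * s)" using 1 x(3) \<beta> \<eta> unfolding mem_ball by linarith
  qed
  let ?\<omega> = "unit_ball_vol (real DIM('a))"
  have "ennreal (real (card X * J) * (?\<omega> * \<beta> ^ DIM('a))) = (\<Sum>k\<in>X \<times> {..<J}. emeasure lborel (B k))"
  proof -
    have "emeasure lborel (B k) = ennreal (?\<omega> * \<beta> ^ DIM('a))" for k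
      using \<beta> by (cases k) (simp add: B_def emeasure_ball)
    then show ?thesis using fin \<beta> by (simp add: card_cartesian_product ennreal_mult' ennreal_of_nat_eq_real_of_nat)
  qed
  also have "\<dots> = emeasure lborel (\<Union>k\<in>X \<times> {..<J}. B k)"
    using fin disj by (intro sum_emeasure) (auto simp: B_def)
  also have "\<dots> \<le> emeasure lborel (ball y (4 * s))"
    using inball by (intro emeasure_mono) auto
  also have "\<dots> = ennreal (?\<omega> * (4 * s) ^ DIM('a))"
    using \<eta> by (simp add: emeasure_ball)
  finally have "real (card X * J) * (?\<omega> * \<beta> ^ DIM('a)) \<le> ?\<omega> * (4 * s) ^ DIM('a)"
    using \<eta> by (subst (asm) ennreal_le_iff) auto
  then have "?\<omega> * (real (card X * J) * \<beta> ^ DIM('a)) \<le> ?\<omega> * (4 * s) ^ DIM('a)"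
    by (simp add: algebra_simps)
  then have "real (card X * J) * \<beta> ^ DIM('a) \<le> (4 * s) ^ DIM('a)"
    by (subst (asm) mult_le_cancel_left_pos) auto
  then have "(2 * \<Lambda>) ^ DIM('a) * (real (card X * J) * \<beta> ^ DIM('a)) \<le> (2 * \<Lambda>) ^ DIM('a) * (4 * s) ^ DIM('a)"
    using \<Lambda>_ge_1 by (intro mult_left_mono) auto
  moreover have "(2 * \<Lambda>) ^ DIM('a) * \<beta> ^ DIM('a) = \<eta> ^ DIM('a)"
    using \<Lambda>_ge_1 unfolding power_mult_distrib[symmetric] by (simp add: \<beta>_def)
  moreover have "(2 * \<Lambda>) ^ DIM('a) * (4 * s) ^ DIM('a) = (8 * \<Lambda>) ^ DIM('a) * s ^ DIM('a)"
    unfolding power_mult_distrib[symmetric] by (simp add: mult_ac)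
  moreover have "(2 * \<Lambda>) ^ DIM('a) * (real (card X * J) * \<beta> ^ DIM('a)) =
      real (card X) * real J * ((2 * \<Lambda>) ^ DIM('a) * \<beta> ^ DIM('a))"
    by (simp only: of_nat_mult mult_ac)
  ultimately have main: "real (card X) * real J * \<eta> ^ DIM('a) \<le> (8 * \<Lambda>) ^ DIM('a) * s ^ DIM('a)"
    by (simp only:)
  obtain d where d: "DIM('a) = Suc d" using DIM_positive by (metis gr0_conv_Suc)
  have "real (card X) * \<eta> ^ d * s \<le> real (card X) * \<eta> ^ d * (real J * \<eta>)"
    using J \<eta> by (intro mult_left_mono) auto
  also have "\<dots> \<le> (8 * \<Lambda>) ^ DIM('a) * s ^ d * s"
    using main by (simp add: d mult_ac)
  finally have "real (card X) * \<eta> ^ d \<le> (8 * \<Lambda>) ^ DIM('a) * s ^ d"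
    using \<eta> by (subst (asm) mult_le_cancel_right_pos) auto
  then show ?thesis by (simp add: d)
qed

text \<open>
  A separated set of maximal cardinality is a net: a point far from all of its members could be
  added.
\<close>

lemma ex_separated_net:
  assumes \<eta>: "0 < \<eta>" "\<eta> \<le> s"
  shows "\<exists>X. finite X \<and> graph \<inter> cball y s \<subseteq> (\<Union>x\<in>X. cball x \<eta>) \<and>
    real (card X) * \<eta> ^ (DIM('a) - 1) \<le> (8 * \<Lambda>) ^ DIM('a) * s ^ (DIM('a) - 1)"
proof -
  let ?P = "\<lambda>X. finite X \<and> X \<subseteq> graph \<inter> cball y s \<and> (\<forall>a\<in>X. \<forall>b\<in>X. a \<noteq> b \<longrightarrow> \<eta> \<le> dist a b)"
  let ?b = "(8 * \<Lambda>) ^ DIM('a) * s ^ (DIM('a) - 1) / \<eta> ^ (DIM('a) - 1)"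
  have b: "card X < Suc (nat \<lceil>?b\<rceil>)" if "?P X" for X
  proof -
    have "real (card X) * \<eta> ^ (DIM('a) - 1) \<le> (8 * \<Lambda>) ^ DIM('a) * s ^ (DIM('a) - 1)"
      using that by (intro card_separated_le[OF \<eta>]) auto
    then have "real (card X) \<le> ?b" using \<eta> by (simp add: field_simps)
    then show ?thesis by linarith
  qed
  have "?P {}" by simp
  then have "\<exists>X. ?P X \<and> (\<forall>Y. ?P Y \<longrightarrow> card Y \<le> card X)"
    using b by (intro ex_has_greatest_nat allI impI) assumption+
  then obtain X where X: "?P X" and "\<forall>Y. ?P Y \<longrightarrow> card Y \<le> card X" by (elim exE conjE) (rule that, intro conjI)
  then have max: "card Y \<le> card X" if "?P Y" for Y using that by simp
  have "graph \<inter> cball y s \<subseteq> (\<Union>x\<in>X. cball x \<eta>)"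
  proof
    fix z assume z: "z \<in> graph \<inter> cball y s"
    show "z \<in> (\<Union>x\<in>X. cball x \<eta>)"
    proof (rule ccontr)
      assume n: "z \<notin> (\<Union>x\<in>X. cball x \<eta>)"
      then have far: "\<And>x. x \<in> X \<Longrightarrow> \<eta> < dist x z" by (auto simp: not_le)
      then have "z \<notin> X" using \<eta> by force
      moreover have "?P (insert z X)"
        using X z far by (auto simp: dist_commute less_imp_le)
      then have "card (insert z X) \<le> card X" by (rule max)
      ultimately show False using X by simp
    qed
  qed
  moreover have "real (card X) * \<eta> ^ (DIM('a) - 1) \<le> (8 * \<Lambda>) ^ DIM('a) * s ^ (DIM('a) - 1)"
    using X by (intro card_separated_le[OF \<eta>]) auto
  ultimately show ?thesis using X by (intro exI[of _ X]) simp
qed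

text \<open>
  The balls around a net of mesh \<open>\<eta>\<close> cover the graph with a total gauge that is bounded
  independently of \<open>\<eta>\<close>.
\<close>

lemma hausdorff_graph_upper:
  assumes s: "0 < s"
  shows "hausdorff_outer (DIM('a) - 1) (graph \<inter> cball y s)
    \<le> ennreal (unit_ball_vol (real (DIM('a) - 1)) * ((8 * \<Lambda>) ^ DIM('a) * s ^ (DIM('a) - 1)))"
  (is "_ \<le> ennreal ?K")
  unfolding hausdorff_outer_def
proof (rule SUP_least)
  fix e :: real assume "e \<in> {0<..}"
  then have e: "0 < e" by simp
  define \<eta> where "\<eta> = min s (e / 2)"
  have \<eta>: "0 < \<eta>" "\<eta> \<le> s" "2 * \<eta> \<le> e" using s e by (auto simp: \<eta>_def)
  let ?m = "DIM('a) - 1"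
  let ?\<omega> = "unit_ball_vol (real ?m)"
  obtain X where X: "finite X" "graph \<inter> cball y s \<subseteq> (\<Union>x\<in>X. cball x \<eta>)"
    "real (card X) * \<eta> ^ ?m \<le> (8 * \<Lambda>) ^ DIM('a) * s ^ ?m"
    using ex_separated_net[OF \<eta>(1,2)] by blast
  obtain h :: "nat \<Rightarrow> 'a" where h: "bij_betw h {0..<card X} X"
    using ex_bij_betw_nat_finite[OF X(1)] by blast
  define C where "C j = (if j < card X then cball (h j) \<eta> else {})" for j
  have "hausdorff_pre ?m e (graph \<inter> cball y s) \<le> (\<Sum>j. hausdorff_gauge ?m (C j))"
  proof (rule hausdorff_pre_le)
    show "graph \<inter> cball y s \<subseteq> (\<Union>j. C j)"
    proof
      fix z assume "z \<in> graph \<inter> cball y s"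
      then obtain x where x: "x \<in> X" "z \<in> cball x \<eta>" using X(2) by auto
      then have "x \<in> h ` {0..<card X}" using h by (simp add: bij_betw_def)
      then obtain j where "j < card X" "h j = x" by auto
      with x show "z \<in> (\<Union>j. C j)" by (auto simp: C_def intro!: exI[of _ j])
    qed
  qed (use \<eta> e in \<open>auto simp: C_def\<close>)
  also have "\<dots> = (\<Sum>j\<in>{..<card X}. hausdorff_gauge ?m (C j))"
    by (intro suminf_finite) (auto simp: C_def hausdorff_gauge_def)
  also have "\<dots> = (\<Sum>j\<in>{..<card X}. ennreal (?\<omega> * \<eta> ^ ?m))"
    using \<eta> by (intro sum.cong) (auto simp: C_def hausdorff_gauge_def)
  also have "\<dots> = ennreal (?\<omega> * (real (card X) * \<eta> ^ ?m))"
    using \<eta> by (simp add: ennreal_of_nat_eq_real_of_nat mult_ac flip: ennreal_mult)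
  also have "\<dots> \<le> ennreal ?K"
    using X(3) by (intro ennreal_leI mult_left_mono) auto
  finally show "hausdorff_pre ?m e (graph \<inter> cball y s) \<le> ennreal ?K" .
qed

end

text \<open>
  A set of small diameter swept over a fixed length in the direction \<open>\<nu>\<close> fills a volume of at most
  the order of its Hausdorff gauge in dimension \<open>d - 1\<close>. This compares Hausdorff measure with
  Lebesgue measure one dimension higher.
\<close>

lemma emeasure_tube_le:
  fixes \<nu> x0 :: "'a::euclidean_space"
  assumes \<nu>: "norm \<nu> = 1" and t: "0 < t" and D: "0 \<le> D" "D \<le> 1"
  defines "T \<equiv> (\<lambda>(s, y). y + s *\<^sub>R \<nu>) ` ({-t..t} \<times> cball x0 D)"
  shows "T \<in> sets lborel" "emeasure lborel T \<le>
    ennreal (unit_ball_vol (real DIM('a)) * 2 ^ DIM('a) * (2 * t + 4) * D ^ (DIM('a) - 1))"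
proof -
  have "compact T" unfolding T_def
    by (intro compact_continuous_image compact_Times continuous_intros) (auto simp: split_def intro!: continuous_intros)
  then show [measurable]: "T \<in> sets lborel" by (simp add: borel_compact)
  let ?\<omega> = "unit_ball_vol (real DIM('a))"
  have bound: "emeasure lborel T \<le> ennreal (?\<omega> * 2 ^ DIM('a) * (2 * t + 4) * D' ^ (DIM('a) - 1))"
    if D': "D < D'" "D' \<le> 2" for D'
  proof -
    have D'0: "0 < D'" using D D' by simp
    define I where "I = {\<lfloor>- t / D'\<rfloor>..\<lfloor>t / D'\<rfloor>}"
    have "T \<subseteq> (\<Union>k\<in>I. cball (x0 + (of_int k * D') *\<^sub>R \<nu>) (2 * D'))"
    proof
      fix x assume "x \<in> T"
      then obtain s y where s: "-t \<le> s" "s \<le> t" "y \<in> cball x0 D" "x = y + s *\<^sub>R \<nu>"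
        by (auto simp: T_def)
      define k where "k = \<lfloor>s / D'\<rfloor>"
      have "k \<in> I" unfolding I_def k_def atLeastAtMost_iff
        using s D'0 by (intro conjI floor_mono divide_right_mono) auto
      moreover have "x \<in> cball (x0 + (of_int k * D') *\<^sub>R \<nu>) (2 * D')"
      proof -
        have "of_int k \<le> s / D'" "s / D' < of_int k + 1" unfolding k_def by linarith+
        then have "of_int k * D' \<le> s" "s < of_int k * D' + D'" using D'0 by (auto simp: field_simps)
        then have "\<bar>s - of_int k * D'\<bar> \<le> D'" by linarith
        have "x - (x0 + (of_int k * D') *\<^sub>R \<nu>) = (y - x0) + (s - of_int k * D') *\<^sub>R \<nu>"
          using s by (simp add: algebra_simps)
        then have "norm (x - (x0 + (of_int k * D') *\<^sub>R \<nu>)) \<le> norm (y - x0) + \<bar>s - of_int k * D'\<bar>"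
          using norm_triangle_ineq[of "y - x0" "(s - of_int k * D') *\<^sub>R \<nu>"] \<nu>
          by (simp only: norm_scaleR mult_1_right)
        also have "\<dots> \<le> D' + D'"
          using s \<open>\<bar>s - of_int k * D'\<bar> \<le> D'\<close> D'
          by (intro add_mono) (auto simp: dist_norm norm_minus_commute)
        finally show ?thesis by (simp add: dist_norm norm_minus_commute)
      qed
      ultimately show "x \<in> (\<Union>k\<in>I. cball (x0 + (of_int k * D') *\<^sub>R \<nu>) (2 * D'))" by blast
    qed
    then have "emeasure lborel T \<le> emeasure lborel (\<Union>k\<in>I. cball (x0 + (of_int k * D') *\<^sub>R \<nu>) (2 * D'))"
      by (intro emeasure_mono) (auto simp: I_def intro!: sets.finite_UN)
    also have "\<dots> \<le> (\<Sum>k\<in>I. emeasure lborel (cball (x0 + (of_int k * D') *\<^sub>R \<nu>) (2 * D')))"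
      by (intro emeasure_subadditive_finite) (auto simp: I_def)
    also have "\<dots> = ennreal (real (card I) * (?\<omega> * (2 * D') ^ DIM('a)))"
      using D'0 by (simp add: emeasure_cball ennreal_mult' ennreal_of_nat_eq_real_of_nat)
    also have "\<dots> \<le> ennreal ((2 * t / D' + 2) * (?\<omega> * (2 * D') ^ DIM('a)))"
    proof (intro ennreal_leI mult_right_mono)
      have "0 \<le> t / D'" using t D'0 by simp
      then have "real (card I) = of_int (\<lfloor>t / D'\<rfloor> - \<lfloor>- t / D'\<rfloor> + 1)"
        unfolding I_def by (simp add: floor_mono)
      also have "\<dots> \<le> t / D' - (- t / D' - 1) + 1" by linarith
      finally show "real (card I) \<le> 2 * t / D' + 2" by simp
    qed (use D'0 in auto)
    also have "(2 * t / D' + 2) * (?\<omega> * (2 * D') ^ DIM('a))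
        = ?\<omega> * 2 ^ DIM('a) * (2 * t + 2 * D') * D' ^ (DIM('a) - 1)"
    proof -
      obtain d where d: "DIM('a) = Suc d" using DIM_positive by (metis gr0_conv_Suc)
      show ?thesis using D'0 unfolding d power_mult_distrib by (simp add: field_simps)
    qed
    also have "ennreal \<dots> \<le> ennreal (?\<omega> * 2 ^ DIM('a) * (2 * t + 4) * D' ^ (DIM('a) - 1))"
      using D' D'0 t by (intro ennreal_leI mult_right_mono mult_left_mono) auto
    finally show ?thesis .
  qed
  \<comment> \<open>Letting the radius decrease to \<open>D\<close> covers the case \<open>D = 0\<close>, where the tube is a segment.\<close>
  have "((\<lambda>D'. ennreal (?\<omega> * 2 ^ DIM('a) * (2 * t + 4) * D' ^ (DIM('a) - 1))) \<longlongrightarrow>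
      ennreal (?\<omega> * 2 ^ DIM('a) * (2 * t + 4) * D ^ (DIM('a) - 1))) (at_right D)"
    by (intro tendsto_ennrealI tendsto_intros)
  moreover have "\<forall>\<^sub>F D' in at_right D.
      emeasure lborel T \<le> ennreal (?\<omega> * 2 ^ DIM('a) * (2 * t + 4) * D' ^ (DIM('a) - 1))"
    unfolding eventually_at_right_field using bound D by (intro exI[of _ 2]) auto
  ultimately show "emeasure lborel T \<le>
      ennreal (?\<omega> * 2 ^ DIM('a) * (2 * t + 4) * D ^ (DIM('a) - 1))"
    by (rule tendsto_lowerbound) simp
qed

context height_function begin

text \<open>
  The vertical tubes over a cover of the graph cover a ball, so the total gauge of the cover is
  bounded below by the volume of that ball.
\<close>

lemma hausdorff_graph_pos:
  assumes p: "\<phi> p = 0" and \<rho>: "0 < \<rho>"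
  shows "0 < hausdorff_outer (DIM('a) - 1) (graph \<inter> ball p \<rho>)"
proof (rule ccontr)
  let ?m = "DIM('a) - 1"
  assume "\<not> ?thesis"
  then have 0: "hausdorff_outer ?m (graph \<inter> ball p \<rho>) = 0" by simp
  have "hausdorff_pre ?m 1 (graph \<inter> ball p \<rho>) \<le> hausdorff_outer ?m (graph \<inter> ball p \<rho>)"
    unfolding hausdorff_outer_def by (rule SUP_upper) simp
  then have pre0: "hausdorff_pre ?m 1 (graph \<inter> ball p \<rho>) = 0" using 0 by simp
  define \<kappa> where "\<kappa> = unit_ball_vol (real DIM('a)) * 2 ^ DIM('a) * (2 * \<rho> + 4) * 2 ^ ?m / unit_ball_vol (real ?m)"
  have \<kappa>: "0 < \<kappa>" using \<rho> unfolding \<kappa>_def by (intro divide_pos_pos mult_pos_pos) auto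
  \<comment> \<open>Moving vertically to the graph displaces \<open>x\<close> by \<open>\<bar>\<phi> x\<bar> \<le> \<Lambda> * norm (x - p)\<close>, so points of \<open>U\<close> stay within \<open>\<rho>\<close> of \<open>p\<close>.\<close>
  define U where "U = ball p (\<rho> / (1 + \<Lambda>))"
  have v: "0 < measure lborel U" using \<rho> \<Lambda>_ge_1 by (simp add: U_def content_ball_pos)
  have eU: "emeasure lborel U = ennreal (measure lborel U)"
    unfolding U_def by (intro emeasure_eq_ennreal_measure) (use \<rho> \<Lambda>_ge_1 in \<open>simp add: emeasure_ball\<close>)
  \<comment> \<open>The tubes over a cover of total gauge below \<open>e\<close> have at most half the volume of \<open>U\<close>.\<close>
  define e where "e = measure lborel U / (2 * \<kappa>)"
  have "hausdorff_pre ?m 1 (graph \<inter> ball p \<rho>) < ennreal e"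
    unfolding pre0 using v \<kappa> by (simp add: e_def)
  then obtain C where C: "graph \<inter> ball p \<rho> \<subseteq> (\<Union>j::nat. C j)"
    "\<And>j. bounded (C j)" "\<And>j. diameter (C j) \<le> 1" "(\<Sum>j. hausdorff_gauge ?m (C j)) < ennreal e"
    unfolding hausdorff_pre_def INF_less_iff by blast
  define c where "c j = (SOME x. x \<in> C j)" for j
  define T where "T j = (if C j = {} then {} else
    (\<lambda>(s, y). y + s *\<^sub>R \<nu>) ` ({-\<rho>..\<rho>} \<times> cball (c j) (diameter (C j))))" for j
  have D0: "0 \<le> diameter (C j)" for j using C(2) by (rule diameter_ge_0)
  have T [measurable]: "T j \<in> sets lborel" for j
    using emeasure_tube_le(1)[OF norm_\<nu> \<rho> D0 C(3)] by (simp add: T_def)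
  have T_le: "emeasure lborel (T j) \<le> ennreal \<kappa> * hausdorff_gauge ?m (C j)" for j
  proof (cases "C j = {}")
    case False
    then have "emeasure lborel (T j) \<le> ennreal (unit_ball_vol (real DIM('a)) * 2 ^ DIM('a) *
        (2 * \<rho> + 4) * diameter (C j) ^ ?m)"
      using emeasure_tube_le(2)[OF norm_\<nu> \<rho> D0 C(3)] by (simp add: T_def)
    also have "\<dots> = ennreal (\<kappa> * (unit_ball_vol (real ?m) * (diameter (C j) / 2) ^ ?m))"
    proof -
      have cancel: "a / w * w = a" if "0 < w" for a w :: real using that by simp
      have "0 < unit_ball_vol (real ?m)" by simp
      then have "\<kappa> * unit_ball_vol (real ?m) =
          unit_ball_vol (real DIM('a)) * 2 ^ DIM('a) * (2 * \<rho> + 4) * 2 ^ ?m"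
        unfolding \<kappa>_def by (rule cancel)
      then have "\<kappa> * (unit_ball_vol (real ?m) * (diameter (C j) / 2) ^ ?m) =
          unit_ball_vol (real DIM('a)) * 2 ^ DIM('a) * (2 * \<rho> + 4) * 2 ^ ?m * (diameter (C j) / 2) ^ ?m"
        by (simp only: mult.assoc[symmetric])
      also have "\<dots> = unit_ball_vol (real DIM('a)) * 2 ^ DIM('a) * (2 * \<rho> + 4) * diameter (C j) ^ ?m"
        by (simp add: power_divide)
      finally show ?thesis by (simp only:)
    qed
    finally show ?thesis using False \<kappa> D0 by (simp add: hausdorff_gauge_def ennreal_mult)
  qed (simp add: T_def)
  have "U \<subseteq> (\<Union>j. T j)"
  proof
    fix x assume x: "x \<in> U"
    then have nx: "norm (x - p) < \<rho> / (1 + \<Lambda>)" by (simp add: U_def dist_norm norm_minus_commute)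
    have "\<bar>\<phi> x\<bar> \<le> \<Lambda> * norm (x - p)" using lipschitz[of x p] p by simp
    moreover have "(1 + \<Lambda>) * norm (x - p) < \<rho>" using nx \<Lambda>_ge_1 by (simp add: field_simps)
    ultimately have h: "norm (x - p) + \<bar>\<phi> x\<bar> < \<rho>" by (simp add: algebra_simps)
    let ?y = "x - \<phi> x *\<^sub>R \<nu>"
    have "\<phi> ?y = 0" using shift[of x "- \<phi> x"] by simp
    moreover have "norm (?y - p) < \<rho>"
    proof -
      have "norm (?y - p) \<le> norm (x - p) + norm (\<phi> x *\<^sub>R \<nu>)"
        using norm_triangle_ineq4[of "x - p" "\<phi> x *\<^sub>R \<nu>"] by (simp add: algebra_simps)
      then show ?thesis using h by simp
    qed
    ultimately have "?y \<in> graph \<inter> ball p \<rho>" by (simp add: dist_norm norm_minus_commute)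
    then obtain j where j: "?y \<in> C j" using C(1) by auto
    then have "c j \<in> C j" unfolding c_def by (rule someI)
    then have "?y \<in> cball (c j) (diameter (C j))"
      using diameter_bounded_bound[OF C(2)[of j]] j by simp
    moreover have "x = ?y + \<phi> x *\<^sub>R \<nu>" by simp
    moreover have "\<phi> x \<in> {-\<rho>..\<rho>}" using h norm_ge_zero[of "x - p"] unfolding atLeastAtMost_iff by linarith
    ultimately have "x \<in> T j" unfolding T_def using j by (auto intro!: image_eqI[of _ _ "(\<phi> x, ?y)"])
    then show "x \<in> (\<Union>j. T j)" by blast
  qed
  moreover have "(\<Union>j. T j) \<in> sets lborel" 
  proof (rule sets.countable_UN)
    show "range T \<subseteq> sets lborel" using T by blast
  qed
  ultimately have "emeasure lborel U \<le> emeasure lborel (\<Union>j. T j)" by (rule emeasure_mono)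
  also have "\<dots> \<le> (\<Sum>j. emeasure lborel (T j))"
  proof (rule emeasure_subadditive_countably)
    show "range T \<subseteq> sets lborel" using T by blast
  qed
  also have "\<dots> \<le> (\<Sum>j. ennreal \<kappa> * hausdorff_gauge ?m (C j))"
    by (intro suminf_le T_le) auto
  also have "\<dots> = ennreal \<kappa> * (\<Sum>j. hausdorff_gauge ?m (C j))" by simp
  also have "\<dots> \<le> ennreal \<kappa> * ennreal e"
    using C(4) by (intro mult_left_mono) (auto intro: less_imp_le)
  also have "\<dots> = ennreal (measure lborel U / 2)"
    using \<kappa> v by (simp add: e_def flip: ennreal_mult)
  finally show False using v unfolding eU by simp
qed

end

section \<open>Increments of functions over balls\<close>

lemma nn_integral_lborel_shift:
  fixes g :: "'a::euclidean_space \<Rightarrow> ennreal"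
  assumes [measurable]: "g \<in> borel_measurable borel"
  shows "(\<integral>\<^sup>+x. g (x + h) \<partial>lborel) = (\<integral>\<^sup>+x. g x \<partial>lborel)"
proof -
  have "(\<integral>\<^sup>+x. g x \<partial>lborel) = (\<integral>\<^sup>+x. g x \<partial>distr lborel borel (\<lambda>x. h + x))"
    by (simp add: lborel_distr_plus)
  also have "\<dots> = (\<integral>\<^sup>+x. g (h + x) \<partial>lborel)" by (simp add: nn_integral_distr)
  finally show ?thesis by (simp add: add.commute)
qed

abbreviation square_mass :: "'a::euclidean_space set \<Rightarrow> ('a \<Rightarrow> real) \<Rightarrow> ennreal" where
  "square_mass A f \<equiv> (\<integral>\<^sup>+x. indicator A x * ennreal ((f x)\<^sup>2) \<partial>lborel)"

abbreviation abs_mass :: "'a::euclidean_space set \<Rightarrow> ('a \<Rightarrow> real) \<Rightarrow> ennreal" where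
  "abs_mass A f \<equiv> (\<integral>\<^sup>+x. indicator A x * ennreal \<bar>f x\<bar> \<partial>lborel)"

text \<open>
  Up to a factor of order \<open>s\<^sup>-\<^sup>d\<close>, this bounds how far an average of \<open>f\<close> over a neighbourhood of
  \<open>x\<close> of radius \<open>s\<close> is from the constant \<open>m\<close>.
\<close>

abbreviation near_oscillation ::
    "'a::euclidean_space set \<Rightarrow> real \<Rightarrow> ('a \<Rightarrow> real) \<Rightarrow> real \<Rightarrow> 'a \<Rightarrow> ennreal" where
  "near_oscillation \<Omega> s f m x \<equiv>
    (\<integral>\<^sup>+y. indicator \<Omega> y * indicator {..s} (dist x y) * ennreal \<bar>f y - m\<bar> \<partial>lborel)"

abbreviation trace_oscillation ::
    "'a::euclidean_space set \<Rightarrow> 'a set \<Rightarrow> real \<Rightarrow> ('a \<Rightarrow> real) \<Rightarrow> real \<Rightarrow> ennreal" where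
  "trace_oscillation \<Omega> P s f m \<equiv>
    (\<integral>\<^sup>+x. \<integral>\<^sup>+y. indicator P x * indicator \<Omega> y * indicator {..s} (dist x y) *
      ennreal \<bar>f y - m\<bar> \<partial>lborel \<partial>hausdorff_measure (DIM('a) - 1))"

definition increment_energy :: "'a::euclidean_space set \<Rightarrow> real \<Rightarrow> ('a \<Rightarrow> real) \<Rightarrow> ennreal" where
  "increment_energy \<Omega> \<epsilon> f = (\<integral>\<^sup>+x. \<integral>\<^sup>+y. indicator \<Omega> x * indicator \<Omega> y * indicator {..\<epsilon>} (dist x y) *
      ennreal ((f x - f y)\<^sup>2) \<partial>lborel \<partial>lborel)"

text \<open>
  The exponent \<open>d + 2\<close> normalizes the energy: a smooth function has increments of size \<open>\<epsilon>\<close>, and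
  the pairs at distance at most \<open>\<epsilon>\<close> fill a volume of order \<open>\<epsilon>\<^sup>d\<close>, so that \<open>g\<close> has the size of its
  Dirichlet energy.
\<close>

abbreviation increments_le :: "'a::euclidean_space set \<Rightarrow> real \<Rightarrow> real \<Rightarrow> ('a \<Rightarrow> real) \<Rightarrow> bool" where
  "increments_le \<Omega> \<epsilon> g f \<equiv> increment_energy \<Omega> \<epsilon> f \<le> ennreal (g * \<epsilon> ^ (DIM('a) + 2))"

lemma sum_square_le:
  fixes a :: "nat \<Rightarrow> real"
  shows "(\<Sum>i<N. a i)\<^sup>2 \<le> real N * (\<Sum>i<N. (a i)\<^sup>2)"
  using Cauchy_Schwarz_ineq_sum[of "\<lambda>_. 1" a "{..<N}"] by simp

lemma square_diff_le: "((a::real) - b)\<^sup>2 \<le> 2 * (a - c)\<^sup>2 + 2 * (c - b)\<^sup>2"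
proof -
  have "0 \<le> (a - 2 * c + b)\<^sup>2" by simp
  then show ?thesis by (simp add: power2_eq_square algebra_simps)
qed

text \<open>
  A single shift \<open>h\<close> need not be controlled by an energy that averages over all shifts. Every
  point \<open>z\<close> of the ball around \<open>x + v\<close> is within \<open>\<epsilon>\<close> of both \<open>x\<close> and \<open>x + h\<close>, though, and the
  estimate through \<open>f z\<close> can be averaged over that ball. The vector \<open>v\<close> leaves room to keep the
  ball in \<open>\<Omega>\<close> when \<open>x\<close> is close to the boundary.
\<close>

lemma increment_step:
  fixes f :: "'a::euclidean_space \<Rightarrow> real"
  assumes [measurable]: "f \<in> borel_measurable borel" "A \<in> sets borel" "\<Omega> \<in> sets borel"
    and A: "\<And>x. x \<in> A \<Longrightarrow> x \<in> \<Omega> \<and> x + h \<in> \<Omega> \<and> ball (x + v) b \<subseteq> \<Omega>"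
    and b: "norm v + b \<le> \<epsilon>" "norm (v - h) + b \<le> \<epsilon>"
  shows "emeasure lborel (ball (0::'a) b) * square_mass A (\<lambda>x. f (x + h) - f x)
    \<le> 4 * increment_energy \<Omega> \<epsilon> f"
proof -
  define I where "I x z = (indicator A x * indicator {..<b} (norm (z - (x + v))) :: ennreal)" for x z :: 'a
  have [measurable]: "(\<lambda>(x, z). I x z) \<in> borel_measurable (borel \<Otimes>\<^sub>M borel)"
    unfolding I_def by measurable
  define \<Phi> where "\<Phi> x = (\<integral>\<^sup>+y. indicator \<Omega> x * indicator \<Omega> y * indicator {..\<epsilon>} (dist x y) *
      ennreal ((f x - f y)\<^sup>2) \<partial>lborel)" for x
  have [measurable]: "\<Phi> \<in> borel_measurable borel" unfolding \<Phi>_def by measurable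
  have E: "increment_energy \<Omega> \<epsilon> f = (\<integral>\<^sup>+x. \<Phi> x \<partial>lborel)" by (simp add: increment_energy_def \<Phi>_def)
  have ball: "(\<integral>\<^sup>+z. I x z \<partial>lborel) = indicator A x * emeasure lborel (ball (0::'a) b)" for x
  proof -
    have "(\<integral>\<^sup>+z. I x z \<partial>lborel) = indicator A x * (\<integral>\<^sup>+z. indicator (ball 0 b) (z + - (x + v)) \<partial>lborel)"
      by (simp add: I_def nn_integral_cmult[symmetric] indicator_def algebra_simps)
    also have "\<dots> = indicator A x * emeasure lborel (ball (0::'a) b)"
      by (subst nn_integral_lborel_shift) (auto intro!: borel_measurable_indicator)
    finally show ?thesis .
  qed
  have "emeasure lborel (ball (0::'a) b) * square_mass A (\<lambda>x. f (x + h) - f x) =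
      (\<integral>\<^sup>+x. (\<integral>\<^sup>+z. I x z \<partial>lborel) * ennreal ((f (x + h) - f x)\<^sup>2) \<partial>lborel)"
    unfolding ball by (subst nn_integral_cmult[symmetric]) (auto simp: mult_ac)
  also have "\<dots> = (\<integral>\<^sup>+x. \<integral>\<^sup>+z. I x z * ennreal ((f (x + h) - f x)\<^sup>2) \<partial>lborel \<partial>lborel)"
    by (simp add: nn_integral_multc)
  also have "\<dots> \<le> (\<integral>\<^sup>+x. 2 * \<Phi> (x + h) + 2 * \<Phi> x \<partial>lborel)"
  proof (rule nn_integral_mono)
    fix x :: 'a
    have "(\<integral>\<^sup>+z. I x z * ennreal ((f (x + h) - f x)\<^sup>2) \<partial>lborel) \<le>
      (\<integral>\<^sup>+z. 2 * (indicator \<Omega> (x + h) * indicator \<Omega> z * indicator {..\<epsilon>} (dist (x + h) z) *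
          ennreal ((f (x + h) - f z)\<^sup>2)) +
        2 * (indicator \<Omega> x * indicator \<Omega> z * indicator {..\<epsilon>} (dist x z) *
          ennreal ((f x - f z)\<^sup>2)) \<partial>lborel)"
    proof (rule nn_integral_mono)
      fix z :: 'a
      show "I x z * ennreal ((f (x + h) - f x)\<^sup>2) \<le>
        2 * (indicator \<Omega> (x + h) * indicator \<Omega> z * indicator {..\<epsilon>} (dist (x + h) z) *
          ennreal ((f (x + h) - f z)\<^sup>2)) +
        2 * (indicator \<Omega> x * indicator \<Omega> z * indicator {..\<epsilon>} (dist x z) *
          ennreal ((f x - f z)\<^sup>2))"
      proof (cases "x \<in> A \<and> norm (z - (x + v)) < b")
        case True
        then have z: "norm (z - (x + v)) < b" by simp
        then have "z \<in> ball (x + v) b" by (simp add: dist_norm norm_minus_commute)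
        then have in\<Omega>: "x \<in> \<Omega>" "x + h \<in> \<Omega>" "z \<in> \<Omega>" using A[of x] True by (auto simp: subset_iff)
        have "norm (z - x) \<le> norm (z - (x + v)) + norm v"
          using norm_triangle_ineq[of "z - (x + v)" v] by simp
        then have 1: "dist x z \<le> \<epsilon>" using z b by (simp add: dist_norm norm_minus_commute)
        have "norm (z - (x + h)) \<le> norm (z - (x + v)) + norm (v - h)"
          using norm_triangle_ineq[of "z - (x + v)" "v - h"] by (simp add: algebra_simps)
        then have 2: "dist (x + h) z \<le> \<epsilon>" using z b by (simp add: dist_norm norm_minus_commute)
        have "ennreal ((f (x + h) - f x)\<^sup>2) \<le> ennreal (2 * (f (x + h) - f z)\<^sup>2 + 2 * (f z - f x)\<^sup>2)"
          by (intro ennreal_leI square_diff_le)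
        also have "\<dots> = 2 * ennreal ((f (x + h) - f z)\<^sup>2) + 2 * ennreal ((f x - f z)\<^sup>2)"
          by (simp add: ennreal_plus ennreal_mult power2_commute[of "f z"])
        finally show ?thesis using True in\<Omega> 1 2 by (simp add: I_def)
      next
        case False
        then show ?thesis by (auto simp: I_def indicator_def)
      qed
    qed
    also have "\<dots> = 2 * \<Phi> (x + h) + 2 * \<Phi> x"
      unfolding \<Phi>_def by (simp add: nn_integral_add nn_integral_cmult)
    finally show "(\<integral>\<^sup>+z. I x z * ennreal ((f (x + h) - f x)\<^sup>2) \<partial>lborel) \<le> 2 * \<Phi> (x + h) + 2 * \<Phi> x" .
  qed
  also have "\<dots> = 2 * (\<integral>\<^sup>+x. \<Phi> (x + h) \<partial>lborel) + 2 * (\<integral>\<^sup>+x. \<Phi> x \<partial>lborel)"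
    by (simp add: nn_integral_add nn_integral_cmult)
  also have "\<dots> = 4 * increment_energy \<Omega> \<epsilon> f"
    by (subst nn_integral_lborel_shift) (simp_all add: E flip: distrib_right)
  finally show ?thesis .
qed

text \<open>
  Cauchy-Schwarz over the \<open>N\<close> steps gives one factor \<open>N\<close>, adding the steps gives another.
\<close>

lemma increment_chain:
  fixes f :: "'a::euclidean_space \<Rightarrow> real"
  assumes [measurable]: "f \<in> borel_measurable borel" "A \<in> sets borel" "\<Omega> \<in> sets borel"
    and A: "\<And>x i. x \<in> A \<Longrightarrow> i < N \<Longrightarrow> x + real i *\<^sub>R k \<in> \<Omega> \<and> x + real (Suc i) *\<^sub>R k \<in> \<Omega> \<and>
      ball (x + real i *\<^sub>R k + v) b \<subseteq> \<Omega>"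
    and b: "norm v + b \<le> \<epsilon>" "norm (v - k) + b \<le> \<epsilon>"
  shows "emeasure lborel (ball (0::'a) b) *
      square_mass A (\<lambda>x. f (x + real N *\<^sub>R k) - f x)
    \<le> 4 * of_nat (N * N) * increment_energy \<Omega> \<epsilon> f"
proof -
  define S where "S i = square_mass A (\<lambda>x. f (x + real (Suc i) *\<^sub>R k) - f (x + real i *\<^sub>R k))" for i
  let ?V = "emeasure lborel (ball (0::'a) b)"
  have "square_mass A (\<lambda>x. f (x + real N *\<^sub>R k) - f x) \<le>
      (\<integral>\<^sup>+x. of_nat N * (\<Sum>i<N. indicator A x *
        ennreal ((f (x + real (Suc i) *\<^sub>R k) - f (x + real i *\<^sub>R k))\<^sup>2)) \<partial>lborel)"
  proof (rule nn_integral_mono)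
    fix x
    have "f (x + real N *\<^sub>R k) - f x = (\<Sum>i<N. f (x + real (Suc i) *\<^sub>R k) - f (x + real i *\<^sub>R k))"
      by (subst sum_lessThan_telescope) simp
    then have "(f (x + real N *\<^sub>R k) - f x)\<^sup>2 \<le>
        real N * (\<Sum>i<N. (f (x + real (Suc i) *\<^sub>R k) - f (x + real i *\<^sub>R k))\<^sup>2)"
      using sum_square_le by metis
    then have "ennreal ((f (x + real N *\<^sub>R k) - f x)\<^sup>2) \<le>
        of_nat N * (\<Sum>i<N. ennreal ((f (x + real (Suc i) *\<^sub>R k) - f (x + real i *\<^sub>R k))\<^sup>2))"
      by (subst sum_ennreal) (auto simp: ennreal_of_nat_eq_real_of_nat ennreal_leI sum_nonneg simp flip: ennreal_mult)
    then show "indicator A x * ennreal ((f (x + real N *\<^sub>R k) - f x)\<^sup>2) \<le>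
        of_nat N * (\<Sum>i<N. indicator A x * ennreal ((f (x + real (Suc i) *\<^sub>R k) - f (x + real i *\<^sub>R k))\<^sup>2))"
      by (auto simp: indicator_def)
  qed
  also have "\<dots> = of_nat N * (\<Sum>i<N. S i)"
    unfolding S_def by (subst nn_integral_cmult, measurable, subst nn_integral_sum, measurable)
  finally have 1: "square_mass A (\<lambda>x. f (x + real N *\<^sub>R k) - f x)
      \<le> of_nat N * (\<Sum>i<N. S i)" .
  have 2: "?V * S i \<le> 4 * increment_energy \<Omega> \<epsilon> f" if "i < N" for i
  proof -
    let ?A = "{x. x - real i *\<^sub>R k \<in> A}"
    have [measurable]: "?A \<in> sets borel" by measurable
    have "S i = (\<integral>\<^sup>+x. (\<lambda>x. indicator A (x - real i *\<^sub>R k) *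
        ennreal ((f (x + k) - f x)\<^sup>2)) (x + real i *\<^sub>R k) \<partial>lborel)"
      unfolding S_def by (simp add: algebra_simps)
    also have "\<dots> = (\<integral>\<^sup>+x. indicator A (x - real i *\<^sub>R k) * ennreal ((f (x + k) - f x)\<^sup>2) \<partial>lborel)"
      by (rule nn_integral_lborel_shift) measurable
    also have "\<dots> = square_mass ?A (\<lambda>x. f (x + k) - f x)"
      by (simp add: indicator_def)
    finally have "S i = \<dots>" .
    moreover have "?V * square_mass ?A (\<lambda>x. f (x + k) - f x)
        \<le> 4 * increment_energy \<Omega> \<epsilon> f"
    proof (rule increment_step[OF assms(1) _ assms(3) _ b])
      fix x assume "x \<in> ?A"
      then show "x \<in> \<Omega> \<and> x + k \<in> \<Omega> \<and> ball (x + v) b \<subseteq> \<Omega>"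
        using A[of "x - real i *\<^sub>R k" i] that by (simp add: algebra_simps)
    qed measurable
    ultimately show ?thesis by simp
  qed
  have "?V * square_mass A (\<lambda>x. f (x + real N *\<^sub>R k) - f x)
      \<le> ?V * (of_nat N * (\<Sum>i<N. S i))" by (rule mult_left_mono[OF 1]) simp
  also have "\<dots> = of_nat N * (\<Sum>i<N. ?V * S i)" by (simp add: sum_distrib_left mult_ac)
  also have "\<dots> \<le> of_nat N * (\<Sum>i<N. 4 * increment_energy \<Omega> \<epsilon> f)"
    by (intro mult_left_mono sum_mono 2) auto
  also have "\<dots> = 4 * of_nat (N * N) * increment_energy \<Omega> \<epsilon> f" by (simp add: mult_ac)
  finally show ?thesis .
qed

text \<open>
  With balls of radius proportional to \<open>\<epsilon>\<close> the powers of \<open>\<epsilon>\<close> cancel, and only the length scale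
  \<open>N * \<epsilon>\<close> of the whole shift remains.
\<close>

lemma increment_chain_scaled:
  fixes f :: "'a::euclidean_space \<Rightarrow> real"
  assumes f: "f \<in> borel_measurable borel" "A \<in> sets borel" "\<Omega> \<in> sets borel"
    and A: "\<And>x i. x \<in> A \<Longrightarrow> i < N \<Longrightarrow> x + real i *\<^sub>R k \<in> \<Omega> \<and> x + real (Suc i) *\<^sub>R k \<in> \<Omega> \<and>
      ball (x + real i *\<^sub>R k + v) (\<beta> * \<epsilon>) \<subseteq> \<Omega>"
    and b: "norm v + \<beta> * \<epsilon> \<le> \<epsilon>" "norm (v - k) + \<beta> * \<epsilon> \<le> \<epsilon>" and \<beta>: "0 < \<beta>" and \<epsilon>: "0 < \<epsilon>"
    and N: "real N * \<epsilon> \<le> M" and g: "0 \<le> g"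
    and E: "increments_le \<Omega> \<epsilon> g f"
  shows "square_mass A (\<lambda>x. f (x + real N *\<^sub>R k) - f x)
    \<le> ennreal (4 * M\<^sup>2 / (unit_ball_vol (real DIM('a)) * \<beta> ^ DIM('a)) * g)"
    (is "?I \<le> ennreal ?R")
proof -
  let ?v = "unit_ball_vol (real DIM('a)) * (\<beta> * \<epsilon>) ^ DIM('a)"
  have v: "0 < ?v" using \<beta> \<epsilon> by simp
  have "ennreal ?v * ?I = emeasure lborel (ball (0::'a) (\<beta> * \<epsilon>)) * ?I"
    using \<beta> \<epsilon> by (simp add: emeasure_ball)
  also have "\<dots> \<le> 4 * of_nat (N * N) * increment_energy \<Omega> \<epsilon> f"
    by (rule increment_chain[OF f A b])
  also have "\<dots> \<le> 4 * of_nat (N * N) * ennreal (g * \<epsilon> ^ (DIM('a) + 2))"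
    by (intro mult_left_mono E) auto
  also have "\<dots> = ennreal (4 * (real N * \<epsilon>)\<^sup>2 * g * \<epsilon> ^ DIM('a))"
    using g \<epsilon> by (simp add: ennreal_of_nat_eq_real_of_nat power2_eq_square mult_ac flip: ennreal_mult ennreal_numeral)
  also have "\<dots> \<le> ennreal (4 * M\<^sup>2 * g * \<epsilon> ^ DIM('a))"
    using g \<epsilon> N by (intro ennreal_leI mult_right_mono mult_left_mono power_mono) auto
  also have "4 * M\<^sup>2 * g * \<epsilon> ^ DIM('a) = ?v * ?R"
    using \<beta> \<epsilon> unit_ball_vol_pos[of "real DIM('a)"] by (simp add: power_mult_distrib less_imp_neq[symmetric])
  also have "ennreal (?v * ?R) = ennreal ?v * ennreal ?R"
    using v g \<beta> by (intro ennreal_mult) auto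
  finally show ?thesis using \<beta> \<epsilon> unit_ball_vol_pos[of "real DIM('a)"]
    by (subst (asm) ennreal_mult_le_mult_iff) (auto simp: less_imp_neq[symmetric])
qed

text \<open>
  Pairs of points of the ball are sorted by their difference \<open>h\<close>, and each fixed \<open>h\<close> is handled by
  a chain of equally many steps along the segment, which stays in the ball by convexity.
\<close>

lemma ball_increments:
  fixes q :: "'a::euclidean_space"
  assumes \<rho>: "0 < \<rho>" and sub: "ball q (2 * \<rho>) \<subseteq> \<Omega>" and [measurable]: "\<Omega> \<in> sets borel"
  shows "\<exists>K>0. \<forall>\<epsilon> f g. 0 < \<epsilon> \<longrightarrow> \<epsilon> \<le> \<rho> \<longrightarrow> f \<in> borel_measurable borel \<longrightarrow> 0 \<le> g \<longrightarrow>
    increments_le \<Omega> \<epsilon> g f \<longrightarrow>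
    (\<integral>\<^sup>+x. \<integral>\<^sup>+y. indicator (ball q \<rho>) x * indicator (ball q \<rho>) y * ennreal ((f y - f x)\<^sup>2) \<partial>lborel \<partial>lborel)
      \<le> ennreal (K * g)"
proof -
  let ?\<omega> = "unit_ball_vol (real DIM('a))"
  \<comment> \<open>The chains below have \<open>N * \<epsilon> \<le> 5 * \<rho>\<close> and intermediate balls of radius \<open>\<epsilon> / 2\<close>.\<close>
  define K0 where "K0 = 4 * (5 * \<rho>)\<^sup>2 / (?\<omega> * (1/2) ^ DIM('a))"
  define K where "K = ?\<omega> * (2 * \<rho>) ^ DIM('a) * K0"
  have K0: "0 < K0" using \<rho> by (simp add: K0_def)
  have K: "0 < K" using \<rho> K0 by (simp add: K_def)
  let ?B = "ball q \<rho>"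
  have [measurable]: "?B \<in> sets borel" by simp
  have "(\<integral>\<^sup>+x. \<integral>\<^sup>+y. indicator ?B x * indicator ?B y * ennreal ((f y - f x)\<^sup>2) \<partial>lborel \<partial>lborel) \<le> ennreal (K * g)"
    if \<epsilon>: "0 < \<epsilon>" "\<epsilon> \<le> \<rho>" and f [measurable]: "f \<in> borel_measurable borel" and g: "0 \<le> g"
      and E: "increments_le \<Omega> \<epsilon> g f" for \<epsilon> f g
  proof -
    \<comment> \<open>Differences have length below \<open>2\<rho>\<close>, so the steps have length at most \<open>\<epsilon> / 2\<close>; the number of steps does not depend on \<open>h\<close>.\<close>
    define N where "N = nat \<lceil>4 * \<rho> / \<epsilon>\<rceil>"
    have N0: "4 * \<rho> / \<epsilon> \<le> real N" "real N \<le> 4 * \<rho> / \<epsilon> + 1"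
    proof -
      have "0 \<le> 4 * \<rho> / \<epsilon>" using \<rho> \<epsilon> by simp
      then show "real N \<le> 4 * \<rho> / \<epsilon> + 1" unfolding N_def by linarith
      show "4 * \<rho> / \<epsilon> \<le> real N" unfolding N_def by (rule real_nat_ceiling_ge)
    qed
    have Npos: "0 < real N" using N0(1) \<rho> \<epsilon> by (smt (verit) divide_pos_pos)
    have N1: "4 * \<rho> \<le> real N * \<epsilon>" using N0(1) \<epsilon> by (simp add: field_simps)
    have "real N * \<epsilon> \<le> (4 * \<rho> / \<epsilon> + 1) * \<epsilon>" using N0(2) \<epsilon> by (intro mult_right_mono) auto
    also have "\<dots> = 4 * \<rho> + \<epsilon>" using \<epsilon> by (simp add: field_simps)
    also have "\<dots> \<le> 5 * \<rho>" using \<epsilon> by simp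
    finally have N2: "real N * \<epsilon> \<le> 5 * \<rho>" .
    have fixh: "(\<integral>\<^sup>+x. indicator ?B x * indicator ?B (x + h) * ennreal ((f (x + h) - f x)\<^sup>2) \<partial>lborel)
        \<le> ennreal (K0 * g) * indicator (ball 0 (2 * \<rho>)) h" for h
    proof (cases "norm h < 2 * \<rho>")
      case False
      have zero: "indicator ?B x * indicator ?B (x + h) = (0 :: ennreal)" for x
      proof (rule ccontr)
        assume "indicator ?B x * indicator ?B (x + h) \<noteq> (0 :: ennreal)"
        then have "dist q x < \<rho>" "dist q (x + h) < \<rho>" by (auto simp: indicator_def split: if_splits)
        then have "dist x (x + h) < \<rho> + \<rho>" using dist_triangle_less_add[of x q \<rho> "x + h" \<rho>] by (simp add: dist_commute)
        then show False using False by (simp add: dist_norm)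
      qed
      show ?thesis unfolding zero by simp
    next
      case True
      define k where "k = (1 / real N) *\<^sub>R h"
      define A where "A = {x. dist q x < \<rho> \<and> dist q (x + h) < \<rho>}"
      have Nk: "real N *\<^sub>R k = h" using Npos by (simp add: k_def)
      have "norm h \<le> real N * (\<epsilon> / 2)" using True N1 by simp
      then have nk: "norm k \<le> \<epsilon> / 2" using Npos by (simp add: k_def field_simps)
      have conv: "x + real i *\<^sub>R k \<in> ?B" if "x \<in> A" "i \<le> N" for x i
      proof -
        have "x + real i *\<^sub>R k = (1 - real i / real N) *\<^sub>R x + (real i / real N) *\<^sub>R (x + h)"
          by (simp add: k_def algebra_simps)
        moreover have "\<dots> \<in> ?B"
          using that Npos convex_ball[of q \<rho>] by (intro convexD) (auto simp: A_def)
        ultimately show ?thesis by simp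
      qed
      have "(\<integral>\<^sup>+x. indicator ?B x * indicator ?B (x + h) * ennreal ((f (x + h) - f x)\<^sup>2) \<partial>lborel)
        = square_mass A (\<lambda>x. f (x + real N *\<^sub>R k) - f x)"
        unfolding Nk by (intro nn_integral_cong) (auto simp: A_def indicator_def)
      also have "\<dots> \<le> ennreal (4 * (5 * \<rho>)\<^sup>2 / (?\<omega> * (1/2) ^ DIM('a)) * g)"
      proof (rule increment_chain_scaled[where v = 0 and \<beta> = "1/2", OF f _ _ _ _ _ _ \<epsilon>(1) N2 g E])
        show "A \<in> sets borel" unfolding A_def by measurable
        fix x i assume x: "x \<in> A" "i < N"
        have "ball (x + real i *\<^sub>R k) (1 / 2 * \<epsilon>) \<subseteq> ball q (2 * \<rho>)"
        proof
          fix z assume z: "z \<in> ball (x + real i *\<^sub>R k) (1 / 2 * \<epsilon>)"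
          have "dist q (x + real i *\<^sub>R k) < \<rho>" using conv[of x i] x by simp
          then have "dist q z < \<rho> + \<epsilon>"
            using z \<epsilon> dist_triangle[of q z "x + real i *\<^sub>R k"] by simp
          then show "z \<in> ball q (2 * \<rho>)" using \<epsilon> by simp
        qed
        moreover have "?B \<subseteq> \<Omega>" using sub \<rho> by (auto simp: subset_iff)
        ultimately show "x + real i *\<^sub>R k \<in> \<Omega> \<and> x + real (Suc i) *\<^sub>R k \<in> \<Omega> \<and>
            ball (x + real i *\<^sub>R k + 0) (1 / 2 * \<epsilon>) \<subseteq> \<Omega>"
          using conv[of x i] conv[of x "Suc i"] x sub by auto
      qed (use nk \<epsilon> in auto)
      also have "\<dots> = ennreal (K0 * g) * indicator (ball 0 (2 * \<rho>)) h" using True by (simp add: K0_def)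
      finally show ?thesis .
    qed
    have "(\<integral>\<^sup>+x. \<integral>\<^sup>+y. indicator ?B x * indicator ?B y * ennreal ((f y - f x)\<^sup>2) \<partial>lborel \<partial>lborel) =
        (\<integral>\<^sup>+x. \<integral>\<^sup>+h. indicator ?B x * indicator ?B (x + h) * ennreal ((f (x + h) - f x)\<^sup>2) \<partial>lborel \<partial>lborel)"
    proof (rule nn_integral_cong)
      fix x :: 'a
      show "(\<integral>\<^sup>+y. indicator ?B x * indicator ?B y * ennreal ((f y - f x)\<^sup>2) \<partial>lborel) =
        (\<integral>\<^sup>+h. indicator ?B x * indicator ?B (x + h) * ennreal ((f (x + h) - f x)\<^sup>2) \<partial>lborel)"
        by (subst nn_integral_lborel_shift[where h = x, symmetric]) (measurable, simp add: add.commute)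
    qed
    also have "\<dots> = (\<integral>\<^sup>+h. \<integral>\<^sup>+x. indicator ?B x * indicator ?B (x + h) * ennreal ((f (x + h) - f x)\<^sup>2) \<partial>lborel \<partial>lborel)"
      by (rule lborel_pair.Fubini'[symmetric]) measurable
    also have "\<dots> \<le> (\<integral>\<^sup>+h. ennreal (K0 * g) * indicator (ball (0::'a) (2 * \<rho>)) h \<partial>lborel)"
      by (rule nn_integral_mono) (rule fixh)
    also have "\<dots> = ennreal (K * g)"
      using \<rho> K0 g by (simp add: nn_integral_cmult_indicator emeasure_ball K_def mult_ac flip: ennreal_mult)
    finally show ?thesis .
  qed
  then show ?thesis using K by blast
qed

text \<open>
  The constant is the value of \<open>f\<close> at a point \<open>x\<close> where \<open>\<integral> (f(y) - f(x))\<^sup>2 dy\<close> is at most twice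
  the bound on its mean over the ball.
\<close>

lemma ball_poincare:
  fixes q :: "'a::euclidean_space"
  assumes \<rho>: "0 < \<rho>" and sub: "ball q (2 * \<rho>) \<subseteq> \<Omega>" and \<Omega>: "\<Omega> \<in> sets borel"
  shows "\<exists>K>0. \<forall>\<epsilon> f g. 0 < \<epsilon> \<longrightarrow> \<epsilon> \<le> \<rho> \<longrightarrow> f \<in> borel_measurable borel \<longrightarrow> 0 < g \<longrightarrow>
    increments_le \<Omega> \<epsilon> g f \<longrightarrow>
    (\<exists>m. square_mass (ball q \<rho>) (\<lambda>y. f y - m) \<le> ennreal (K * g))"
proof -
  obtain K where K: "0 < K" and main: "\<And>\<epsilon> f g. 0 < \<epsilon> \<Longrightarrow> \<epsilon> \<le> \<rho> \<Longrightarrow> f \<in> borel_measurable borel \<Longrightarrow> 0 \<le> g \<Longrightarrow>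
    increments_le \<Omega> \<epsilon> g f \<Longrightarrow>
    (\<integral>\<^sup>+x. \<integral>\<^sup>+y. indicator (ball q \<rho>) x * indicator (ball q \<rho>) y * ennreal ((f y - f x)\<^sup>2) \<partial>lborel \<partial>lborel)
      \<le> ennreal (K * g)"
    using ball_increments[OF assms] by blast
  define V where "V = measure lborel (ball q \<rho>)"
  have V: "0 < V" "emeasure lborel (ball q \<rho>) = ennreal V"
    using \<rho> by (auto simp: V_def content_ball_pos emeasure_ball content_ball)
  have "\<exists>m. square_mass (ball q \<rho>) (\<lambda>y. f y - m) \<le> ennreal (2 * K / V * g)"
    if \<epsilon>: "0 < \<epsilon>" "\<epsilon> \<le> \<rho>" and f [measurable]: "f \<in> borel_measurable borel" and g: "0 < g"
      and E: "increments_le \<Omega> \<epsilon> g f" for \<epsilon> f g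
  proof (rule ccontr)
    assume neg: "\<not> ?thesis"
    have "ennreal (2 * K / V * g) * ennreal V = (\<integral>\<^sup>+x. ennreal (2 * K / V * g) * indicator (ball q \<rho>) x \<partial>lborel)"
      by (simp add: nn_integral_cmult_indicator V)
    also have "\<dots> \<le> (\<integral>\<^sup>+x. \<integral>\<^sup>+y. indicator (ball q \<rho>) x * indicator (ball q \<rho>) y * ennreal ((f y - f x)\<^sup>2) \<partial>lborel \<partial>lborel)"
    proof (rule nn_integral_mono)
      fix x
      have "ennreal (2 * K / V * g) \<le> square_mass (ball q \<rho>) (\<lambda>y. f y - f x)"
        using neg by (auto simp: not_le intro: less_imp_le)
      then show "ennreal (2 * K / V * g) * indicator (ball q \<rho>) x \<le>
          (\<integral>\<^sup>+y. indicator (ball q \<rho>) x * indicator (ball q \<rho>) y * ennreal ((f y - f x)\<^sup>2) \<partial>lborel)"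
        by (cases "x \<in> ball q \<rho>") auto
    qed
    also have "\<dots> \<le> ennreal (K * g)" using main \<epsilon> f g E by (simp add: less_imp_le)
    finally have "2 * K * g \<le> K * g" using V K g by (simp add: field_simps flip: ennreal_mult)
    then show False using K g by simp
  qed
  then show ?thesis using K V by (intro exI[of _ "2 * K / V"]) simp
qed

section \<open>Boundary charts and the nonlocal trace\<close>

locale boundary_chart = height_function \<phi> \<nu> \<Lambda>
  for \<phi> :: "'a::euclidean_space \<Rightarrow> real" and \<nu> \<Lambda> +
  fixes \<Omega> :: "'a set" and p :: 'a and r :: real
  assumes open_domain: "open \<Omega>" and r_pos: "0 < r" and p_frontier: "p \<in> frontier \<Omega>"
    and chart: "x \<in> ball p r \<Longrightarrow> x \<in> \<Omega> \<longleftrightarrow> 0 < \<phi> x"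
begin

lemma measurable_domain [measurable]: "\<Omega> \<in> sets borel"
  using open_domain by simp

lemma frontier_eq_graph: "frontier \<Omega> \<inter> ball p r = graph \<inter> ball p r"
proof (intro equalityI subsetI)
  fix x assume "x \<in> frontier \<Omega> \<inter> ball p r"
  then have x: "x \<in> closure \<Omega>" "x \<notin> \<Omega>" "x \<in> ball p r"
    using open_domain by (auto simp: frontier_def interior_open)
  then have "\<phi> x \<le> 0" using chart[of x] by auto
  moreover have "0 \<le> \<phi> x"
  proof (rule ccontr)
    assume "\<not> 0 \<le> \<phi> x"
    moreover have "open {y. \<phi> y < 0}"
      using continuous_height[of UNIV] by (intro open_Collect_less) (auto simp: continuous_on_const)
    ultimately have "open ({y. \<phi> y < 0} \<inter> ball p r)" "x \<in> {y. \<phi> y < 0} \<inter> ball p r" using x by auto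
    then have "{y. \<phi> y < 0} \<inter> ball p r \<inter> \<Omega> \<noteq> {}"
      using x(1) open_Int_closure_eq_empty[of "{y. \<phi> y < 0} \<inter> ball p r" \<Omega>] by blast
    then obtain y where "\<phi> y < 0" "y \<in> ball p r" "y \<in> \<Omega>" by auto
    then show False using chart[of y] by simp
  qed
  ultimately show "x \<in> graph \<inter> ball p r" using x by simp
next
  fix x assume x: "x \<in> graph \<inter> ball p r"
  then have "x \<notin> \<Omega>" using chart[of x] by simp
  moreover have "x \<in> closure \<Omega>"
    unfolding closure_approachable
  proof (intro allI impI)
    fix e :: real assume e: "0 < e"
    define t where "t = min (e / 2) ((r - dist p x) / 2)"
    have t: "0 < t" "t < e" "t < r - dist p x" using e x by (auto simp: t_def min_def field_simps)
    have "dist (x + t *\<^sub>R \<nu>) x = t" using t by (simp add: dist_norm)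
    moreover have "x + t *\<^sub>R \<nu> \<in> \<Omega>"
    proof -
      have "dist p (x + t *\<^sub>R \<nu>) \<le> dist p x + dist x (x + t *\<^sub>R \<nu>)" by (rule dist_triangle)
      then have "x + t *\<^sub>R \<nu> \<in> ball p r" using t by (simp add: dist_norm)
      then show ?thesis using chart x t by (simp add: shift)
    qed
    ultimately show "\<exists>y\<in>\<Omega>. dist y x < e"
      using t by (intro bexI[of _ "x + t *\<^sub>R \<nu>"]) simp_all
  qed
  ultimately show "x \<in> frontier \<Omega> \<inter> ball p r"
    using x open_domain by (auto simp: frontier_def interior_open)
qed

lemma \<phi>_p: "\<phi> p = 0"
proof -
  have "p \<in> frontier \<Omega> \<inter> ball p r" using p_frontier r_pos by simp
  then show ?thesis unfolding frontier_eq_graph by simp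
qed

text \<open>
  Moving up by \<open>t\<close> leaves room for a ball of radius \<open>t / \<Lambda>\<close>: the domain satisfies a cone condition
  at all points of nonnegative height, the boundary included.
\<close>

lemma above_in_domain:
  assumes "norm (x - p) + \<bar>t\<bar> + b \<le> r" "0 \<le> \<phi> x" "\<Lambda> * b \<le> t"
  shows "ball (x + t *\<^sub>R \<nu>) b \<subseteq> \<Omega>"
proof
  fix z assume "z \<in> ball (x + t *\<^sub>R \<nu>) b"
  then have z: "norm (z - (x + t *\<^sub>R \<nu>)) < b" by (simp add: dist_norm norm_minus_commute)
  have "norm (z - p) \<le> norm (z - (x + t *\<^sub>R \<nu>)) + norm ((x - p) + t *\<^sub>R \<nu>)"
    using norm_triangle_ineq[of "z - (x + t *\<^sub>R \<nu>)" "(x - p) + t *\<^sub>R \<nu>"] by (simp add: algebra_simps)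
  moreover have "norm ((x - p) + t *\<^sub>R \<nu>) \<le> norm (x - p) + \<bar>t\<bar>"
    using norm_triangle_ineq[of "x - p" "t *\<^sub>R \<nu>"] by simp
  ultimately have "z \<in> ball p r" using z assms by (simp add: dist_norm norm_minus_commute)
  moreover have "\<phi> (x + t *\<^sub>R \<nu>) - \<phi> z \<le> \<Lambda> * norm (z - (x + t *\<^sub>R \<nu>))"
    using lipschitz[of "x + t *\<^sub>R \<nu>" z] by (simp add: norm_minus_commute)
  moreover have "\<Lambda> * norm (z - (x + t *\<^sub>R \<nu>)) < \<Lambda> * b" using z \<Lambda>_ge_1 by simp
  ultimately show "z \<in> \<Omega>" using chart[of z] assms by (simp add: shift)
qed

text \<open>
  The constant of \<open>increment_chain_scaled\<close> for intermediate balls of radius \<open>\<epsilon> / (4\<Lambda>)\<close>.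
\<close>

definition step_const :: real where
  "step_const = 4 / (unit_ball_vol (real DIM('a)) * (1 / (4 * \<Lambda>)) ^ DIM('a))"

lemma step_const_pos: "0 < step_const"
  using \<Lambda>_ge_1 by (simp add: step_const_def)

text \<open>
  Here the intermediate points lie around \<open>x + (\<epsilon> / 2) \<nu>\<close>, above \<open>x\<close> rather than around it, so
  that the estimate holds for points arbitrarily close to the boundary.
\<close>

lemma vertical_increment:
  assumes \<epsilon>: "0 < \<epsilon>" and s: "0 \<le> s" "s \<le> \<epsilon> / 2" and r1: "r1 + real N * s + \<epsilon> \<le> r"
    and f: "f \<in> borel_measurable borel" and g: "0 \<le> g"
    and E: "increments_le \<Omega> \<epsilon> g f"
  shows "square_mass (\<Omega> \<inter> ball p r1) (\<lambda>x. f (x + (real N * s) *\<^sub>R \<nu>) - f x)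
    \<le> ennreal (step_const * (real N * \<epsilon>)\<^sup>2 * g)"
proof -
  define \<beta> where "\<beta> = 1 / (4 * \<Lambda>)"
  have \<beta>: "0 < \<beta>" "\<beta> \<le> 1 / 4" "\<Lambda> * \<beta> = 1 / 4" using \<Lambda>_ge_1 by (auto simp: \<beta>_def field_simps)
  have \<beta>\<epsilon>: "0 < \<beta> * \<epsilon>" "\<beta> * \<epsilon> \<le> \<epsilon> / 4" "\<Lambda> * (\<beta> * \<epsilon>) = \<epsilon> / 4"
    using \<beta> \<epsilon> mult_right_mono[OF \<beta>(2), of \<epsilon>] by (auto simp flip: mult.assoc)
  have "square_mass (\<Omega> \<inter> ball p r1) (\<lambda>x. f (x + real N *\<^sub>R (s *\<^sub>R \<nu>)) - f x)
    \<le> ennreal (4 * (real N * \<epsilon>)\<^sup>2 / (unit_ball_vol (real DIM('a)) * \<beta> ^ DIM('a)) * g)"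
  proof (rule increment_chain_scaled[where v = "(\<epsilon> / 2) *\<^sub>R \<nu>" and \<beta> = \<beta>, OF f _ _ _ _ _ _ \<epsilon>(1) order_refl g E])
    show "norm ((\<epsilon> / 2) *\<^sub>R \<nu>) + \<beta> * \<epsilon> \<le> \<epsilon>" using \<epsilon> \<beta>\<epsilon> by simp
    have "norm ((\<epsilon> / 2) *\<^sub>R \<nu> - s *\<^sub>R \<nu>) = \<epsilon> / 2 - s"
      using s by (simp add: scaleR_diff_left[symmetric])
    then show "norm ((\<epsilon> / 2) *\<^sub>R \<nu> - s *\<^sub>R \<nu>) + \<beta> * \<epsilon> \<le> \<epsilon>" using \<epsilon> \<beta>\<epsilon> s by simp
    fix x i assume x: "x \<in> \<Omega> \<inter> ball p r1" "i < N"
    have nx: "norm (x - p) < r1" using x by (simp add: dist_norm norm_minus_commute)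
    have le: "real j * s \<le> real N * s" if "j \<le> N" for j using that s by (intro mult_right_mono) auto
    have "0 \<le> real N * s" using s by simp
    then have "x \<in> ball p r"
      using nx r1 \<epsilon> unfolding mem_ball dist_norm norm_minus_commute[of p] by linarith
    then have \<phi>x: "0 < \<phi> x" using x(1) chart by auto
    have pt: "x + real j *\<^sub>R (s *\<^sub>R \<nu>) \<in> \<Omega>" if j: "j \<le> N" for j
    proof -
      have js: "0 \<le> real j * s" using s by simp
      have "norm ((x - p) + (real j * s) *\<^sub>R \<nu>) \<le> norm (x - p) + real j * s"
        using norm_triangle_ineq[of "x - p" "(real j * s) *\<^sub>R \<nu>"] js by simp
      then have "x + (real j * s) *\<^sub>R \<nu> \<in> ball p r"
        using nx le[OF j] r1 \<epsilon> by (simp add: dist_norm norm_minus_commute[of p] algebra_simps)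
      then show ?thesis using chart \<phi>x js by (simp add: shift)
    qed
    have "ball (x + (real i * s + \<epsilon> / 2) *\<^sub>R \<nu>) (\<beta> * \<epsilon>) \<subseteq> \<Omega>"
    proof (rule above_in_domain)
      have is0: "0 \<le> real i * s" using s by simp
      then show "norm (x - p) + \<bar>real i * s + \<epsilon> / 2\<bar> + \<beta> * \<epsilon> \<le> r"
        using nx le[OF less_imp_le[OF x(2)]] r1 \<beta>\<epsilon>(2) \<epsilon> by linarith
      show "\<Lambda> * (\<beta> * \<epsilon>) \<le> real i * s + \<epsilon> / 2"
        using \<beta>\<epsilon>(3) \<epsilon> is0 by linarith
    qed (use \<phi>x in simp)
    then show "x + real i *\<^sub>R s *\<^sub>R \<nu> \<in> \<Omega> \<and> x + real (Suc i) *\<^sub>R s *\<^sub>R \<nu> \<in> \<Omega> \<and>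
        ball (x + real i *\<^sub>R s *\<^sub>R \<nu> + (\<epsilon> / 2) *\<^sub>R \<nu>) (\<beta> * \<epsilon>) \<subseteq> \<Omega>"
      using pt[of i] pt[of "Suc i"] x(2) by (simp add: algebra_simps)
  qed (use \<beta> in \<open>auto intro!: sets.Int\<close>)
  then show ?thesis by (simp add: step_const_def \<beta>_def)
qed

end

lemma card_le_diameter:
  fixes I :: "nat set"
  assumes "finite I" "\<And>i j. i \<in> I \<Longrightarrow> j \<in> I \<Longrightarrow> real i - real j \<le> L" "0 \<le> L"
  shows "real (card I) \<le> L + 1"
proof (cases "I = {}")
  case False
  have "I \<subseteq> {Min I..Min I + nat \<lfloor>L\<rfloor>}"
  proof
    fix i assume i: "i \<in> I"
    then have "real i - real (Min I) \<le> L" using assms False by simp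
    moreover have "Min I \<le> i" using i assms by simp
    ultimately show "i \<in> {Min I..Min I + nat \<lfloor>L\<rfloor>}" by (simp add: le_nat_floor flip: of_nat_diff) linarith
  qed
  then have "card I \<le> nat \<lfloor>L\<rfloor> + 1" using card_mono[of "{Min I..Min I + nat \<lfloor>L\<rfloor>}" I] by simp
  then show ?thesis using assms(3) by linarith
qed (use assms in simp)

text \<open>
  Instead of Cauchy-Schwarz this uses \<open>\<bar>F\<bar> \<le> a + F\<^sup>2 / a\<close>, which is of the same quality when \<open>a\<close>
  has the size of the root mean square of \<open>F\<close> and avoids square roots of extended reals.
\<close>

lemma nn_integral_abs_le:
  fixes F :: "'b \<Rightarrow> real"
  assumes [measurable]: "F \<in> borel_measurable M" "A \<in> sets M" and a: "0 < a"
    and V: "emeasure M A \<le> ennreal V" "0 \<le> V"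
    and F2: "(\<integral>\<^sup>+x. indicator A x * ennreal ((F x)\<^sup>2) \<partial>M) \<le> ennreal (K * a\<^sup>2)" and K: "0 \<le> K"
  shows "(\<integral>\<^sup>+x. indicator A x * ennreal \<bar>F x\<bar> \<partial>M) \<le> ennreal ((V + K) * a)"
proof -
  have "(\<integral>\<^sup>+x. indicator A x * ennreal \<bar>F x\<bar> \<partial>M) \<le>
      (\<integral>\<^sup>+x. ennreal a * indicator A x + ennreal (1 / a) * (indicator A x * ennreal ((F x)\<^sup>2)) \<partial>M)"
  proof (rule nn_integral_mono)
    fix x
    have "\<bar>F x\<bar> \<le> a + 1 / a * (F x)\<^sup>2"
    proof -
      have "0 \<le> (\<bar>F x\<bar> - a)\<^sup>2" by simp
      then have "2 * (a * \<bar>F x\<bar>) \<le> a * a + (F x)\<^sup>2" by (simp add: power2_eq_square algebra_simps)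
      moreover have "0 \<le> a * \<bar>F x\<bar>" using a by simp
      moreover have "a * (a + 1 / a * (F x)\<^sup>2) = a * a + (F x)\<^sup>2" using a by (simp add: algebra_simps)
      ultimately have "a * \<bar>F x\<bar> \<le> a * (a + 1 / a * (F x)\<^sup>2)" by linarith
      then show ?thesis using a by (simp only: mult_le_cancel_left_pos)
    qed
    then have "ennreal \<bar>F x\<bar> \<le> ennreal a + ennreal (1 / a) * ennreal ((F x)\<^sup>2)"
      using a by (simp add: ennreal_leI flip: ennreal_plus ennreal_mult)
    then show "indicator A x * ennreal \<bar>F x\<bar> \<le>
        ennreal a * indicator A x + ennreal (1 / a) * (indicator A x * ennreal ((F x)\<^sup>2))"
      by (cases "x \<in> A") auto
  qed
  also have "\<dots> = ennreal a * emeasure M A + ennreal (1 / a) * (\<integral>\<^sup>+x. indicator A x * ennreal ((F x)\<^sup>2) \<partial>M)"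
    by (subst nn_integral_add) (auto simp: nn_integral_cmult nn_integral_cmult_indicator)
  also have "\<dots> \<le> ennreal a * ennreal V + ennreal (1 / a) * ennreal (K * a\<^sup>2)"
    by (intro add_mono mult_left_mono V F2) auto
  also have "\<dots> = ennreal ((V + K) * a)"
    using a V K by (simp add: power2_eq_square algebra_simps flip: ennreal_mult ennreal_plus)
  finally show ?thesis .
qed

context boundary_chart begin

definition strip :: "real \<Rightarrow> real \<Rightarrow> 'a set" where
  "strip r1 H = {y \<in> ball p r1. 0 < \<phi> y \<and> \<phi> y \<le> H}"

lemma measurable_strip [measurable]: "strip r1 H \<in> sets borel"
  unfolding strip_def mem_ball by measurable

text \<open>
  The bound is proportional to the width \<open>\<epsilon>\<close> of the strip although the shift has a fixed length.
  The shift is cut into steps of length between \<open>\<epsilon> / 4\<close> and \<open>\<epsilon> / 2\<close>. The \<open>i\<close>-th step takes place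
  over the strip raised by \<open>i\<close> steps, and a point lies in at most \<open>4h + 1\<close> of these raised strips,
  so the sum over \<open>i\<close> is bounded by the integral of one step over the chart.
\<close>

lemma strip_increment:
  assumes \<epsilon>: "0 < \<epsilon>" and T: "\<epsilon> \<le> T" and r1: "r1 + T + 2 * \<epsilon> \<le> r" and H: "0 \<le> h" "H = h * \<epsilon>"
    and f [measurable]: "f \<in> borel_measurable borel" and g: "0 < g"
    and E: "increments_le \<Omega> \<epsilon> g f"
  shows "abs_mass (strip r1 H) (\<lambda>y. f (y + T *\<^sub>R \<nu>) - f y)
    \<le> ennreal ((4 * h + 1) * (measure lborel (ball p r) + step_const) * (\<epsilon> * sqrt g))"
proof -
  define N where "N = nat \<lceil>2 * T / \<epsilon>\<rceil>"
  define s where "s = T / real N"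
  have N: "2 * T / \<epsilon> \<le> real N" "real N \<le> 4 * T / \<epsilon>"
  proof -
    have 1: "1 \<le> T / \<epsilon>" using T \<epsilon> by simp
    then have "real N \<le> 2 * T / \<epsilon> + 1" unfolding N_def by linarith
    also have "\<dots> \<le> 2 * T / \<epsilon> + 2 * T / \<epsilon>" using 1 by (intro add_left_mono) linarith
    finally show "real N \<le> 4 * T / \<epsilon>" by simp
    show "2 * T / \<epsilon> \<le> real N" unfolding N_def by (rule real_nat_ceiling_ge)
  qed
  have Tpos: "0 < T" using T \<epsilon> by simp
  have Npos: "0 < real N" using N(1) Tpos \<epsilon> by (smt (verit) divide_pos_pos)
  have s: "0 < s" "s \<le> \<epsilon> / 2" "\<epsilon> / 4 \<le> s" "real N * s = T"
    using N Npos Tpos \<epsilon> by (auto simp: s_def field_simps)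
  let ?S = "strip r1 H"
  let ?A = "\<Omega> \<inter> ball p (r1 + T)"
  have [measurable]: "?A \<in> sets borel" using open_domain by (intro borel_open open_Int) auto
  have count: "(\<Sum>i<N. indicator ?S (y - (real i * s) *\<^sub>R \<nu>)) \<le> ennreal (4 * h + 1) * indicator ?A y" for y
  proof -
    \<comment> \<open>The raised strips that contain \<open>y\<close>; their indices differ by at most \<open>H / s\<close>.\<close>
    define I where "I = {i. i < N \<and> y - (real i * s) *\<^sub>R \<nu> \<in> ?S}"
    have \<phi>I: "real i * s < \<phi> y" "\<phi> y \<le> real i * s + H" if "i \<in> I" for i
      using that shift[of y "- (real i * s)"] by (auto simp: I_def strip_def)
    have "(\<Sum>i<N. indicator ?S (y - (real i * s) *\<^sub>R \<nu>)) = (\<Sum>i<N. if i \<in> I then 1 else 0 :: ennreal)"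
      by (intro sum.cong) (auto simp: I_def)
    also have "\<dots> = of_nat (card I)"
      by (simp add: sum.If_cases) (simp add: I_def Int_def conj_commute)
    finally have eq: "(\<Sum>i<N. indicator ?S (y - (real i * s) *\<^sub>R \<nu>)) = (of_nat (card I) :: ennreal)" .
    show ?thesis
    proof (cases "I = {}")
      case False
      then obtain i where i: "i \<in> I" by blast
      have "real i * s \<le> real N * s" using i s by (intro mult_right_mono) (auto simp: I_def)
      then have iT: "0 \<le> real i * s" "real i * s \<le> T" using s by auto
      have "norm (y - (real i * s) *\<^sub>R \<nu> - p) < r1"
        using i by (auto simp: I_def strip_def dist_norm norm_minus_commute)
      moreover have "norm (y - p) \<le> norm (y - (real i * s) *\<^sub>R \<nu> - p) + norm ((real i * s) *\<^sub>R \<nu>)"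
        using norm_triangle_ineq[of "y - (real i * s) *\<^sub>R \<nu> - p" "(real i * s) *\<^sub>R \<nu>"] by simp
      ultimately have y: "norm (y - p) < r1 + T" using iT by simp
      then have "y \<in> ball p r" using r1 \<epsilon> by (simp add: dist_norm norm_minus_commute)
      then have "y \<in> \<Omega>" using chart \<phi>I(1)[OF i] iT by simp
      then have yA: "y \<in> ?A" using y by (simp add: dist_norm norm_minus_commute)
      have "real (card I) \<le> H / s + 1"
      proof (rule card_le_diameter)
        show "finite I" by (simp add: I_def)
        show "0 \<le> H / s" using H \<epsilon> s by simp
        fix i j assume "i \<in> I" "j \<in> I"
        then have "real i * s - real j * s \<le> H" using \<phi>I[of i] \<phi>I[of j] by linarith
        then show "real i - real j \<le> H / s" using s by (simp add: field_simps)
      qed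
      also have "H / s \<le> H / (\<epsilon> / 4)" using s H \<epsilon> by (intro divide_left_mono) auto
      also have "\<dots> = 4 * h" using H \<epsilon> by simp
      finally have "real (card I) \<le> 4 * h + 1" by simp
      then show ?thesis unfolding eq using yA by (simp add: ennreal_of_nat_eq_real_of_nat ennreal_leI)
    qed (simp add: eq)
  qed
  have "abs_mass ?S (\<lambda>y. f (y + T *\<^sub>R \<nu>) - f y) \<le>
    (\<integral>\<^sup>+y. (\<Sum>i<N. indicator ?S y * ennreal \<bar>f (y + (real (Suc i) * s) *\<^sub>R \<nu>) - f (y + (real i * s) *\<^sub>R \<nu>)\<bar>) \<partial>lborel)"
  proof (rule nn_integral_mono)
    fix y
    have "f (y + T *\<^sub>R \<nu>) - f y = (\<Sum>i<N. f (y + (real (Suc i) * s) *\<^sub>R \<nu>) - f (y + (real i * s) *\<^sub>R \<nu>))"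
      by (subst sum_lessThan_telescope) (simp add: s)
    then have "\<bar>f (y + T *\<^sub>R \<nu>) - f y\<bar> \<le> (\<Sum>i<N. \<bar>f (y + (real (Suc i) * s) *\<^sub>R \<nu>) - f (y + (real i * s) *\<^sub>R \<nu>)\<bar>)"
      by (simp only:) (rule sum_abs)
    then have "ennreal \<bar>f (y + T *\<^sub>R \<nu>) - f y\<bar> \<le> (\<Sum>i<N. ennreal \<bar>f (y + (real (Suc i) * s) *\<^sub>R \<nu>) - f (y + (real i * s) *\<^sub>R \<nu>)\<bar>)"
      by (subst sum_ennreal) (auto intro: ennreal_leI)
    then show "indicator ?S y * ennreal \<bar>f (y + T *\<^sub>R \<nu>) - f y\<bar> \<le>
        (\<Sum>i<N. indicator ?S y * ennreal \<bar>f (y + (real (Suc i) * s) *\<^sub>R \<nu>) - f (y + (real i * s) *\<^sub>R \<nu>)\<bar>)"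
      by (auto simp: indicator_def)
  qed
  also have "\<dots> = (\<Sum>i<N. \<integral>\<^sup>+y. indicator ?S y * ennreal \<bar>f (y + (real (Suc i) * s) *\<^sub>R \<nu>) - f (y + (real i * s) *\<^sub>R \<nu>)\<bar> \<partial>lborel)"
    by (rule nn_integral_sum) measurable
  also have "\<dots> = (\<Sum>i<N. \<integral>\<^sup>+y. indicator ?S (y - (real i * s) *\<^sub>R \<nu>) * ennreal \<bar>f (y + s *\<^sub>R \<nu>) - f y\<bar> \<partial>lborel)"
  proof (rule sum.cong[OF refl])
    fix i
    show "abs_mass ?S (\<lambda>y. f (y + (real (Suc i) * s) *\<^sub>R \<nu>) - f (y + (real i * s) *\<^sub>R \<nu>)) =
      (\<integral>\<^sup>+y. indicator ?S (y - (real i * s) *\<^sub>R \<nu>) * ennreal \<bar>f (y + s *\<^sub>R \<nu>) - f y\<bar> \<partial>lborel)"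
      by (subst nn_integral_lborel_shift[where h = "(real i * s) *\<^sub>R \<nu>", symmetric])
        (measurable, simp add: algebra_simps)
  qed
  also have "\<dots> = (\<integral>\<^sup>+y. (\<Sum>i<N. indicator ?S (y - (real i * s) *\<^sub>R \<nu>) * ennreal \<bar>f (y + s *\<^sub>R \<nu>) - f y\<bar>) \<partial>lborel)"
    by (rule nn_integral_sum[symmetric]) measurable
  also have "\<dots> \<le> (\<integral>\<^sup>+y. ennreal (4 * h + 1) * (indicator ?A y * ennreal \<bar>f (y + s *\<^sub>R \<nu>) - f y\<bar>) \<partial>lborel)"
    unfolding sum_distrib_right[symmetric] mult.assoc[symmetric]
    by (intro nn_integral_mono mult_right_mono count) simp
  also have "\<dots> = ennreal (4 * h + 1) * abs_mass ?A (\<lambda>y. f (y + s *\<^sub>R \<nu>) - f y)"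
    by (rule nn_integral_cmult) measurable
  also have "\<dots> \<le> ennreal (4 * h + 1) * ennreal ((measure lborel (ball p r) + step_const) * (\<epsilon> * sqrt g))"
  proof (intro mult_left_mono nn_integral_abs_le)
    have "emeasure lborel ?A \<le> emeasure lborel (ball p r)"
      using r1 \<epsilon> by (intro emeasure_mono) auto
    also have "\<dots> = ennreal (measure lborel (ball p r))"
      using r_pos by (simp add: emeasure_ball content_ball)
    finally show "emeasure lborel ?A \<le> ennreal (measure lborel (ball p r))" .
    have "square_mass ?A (\<lambda>y. f (y + (real 1 * s) *\<^sub>R \<nu>) - f y)
      \<le> ennreal (step_const * (real 1 * \<epsilon>)\<^sup>2 * g)"
      using r1 s \<epsilon> g by (intro vertical_increment f E) auto
    then show "square_mass ?A (\<lambda>y. f (y + s *\<^sub>R \<nu>) - f y)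
      \<le> ennreal (step_const * (\<epsilon> * sqrt g)\<^sup>2)"
      using g by (simp add: power_mult_distrib mult.assoc)
    show "?A \<in> sets lborel" by measurable
  qed (use \<epsilon> g step_const_pos in \<open>auto simp: less_imp_le\<close>)
  also have "\<dots> = ennreal ((4 * h + 1) * (measure lborel (ball p r) + step_const) * (\<epsilon> * sqrt g))"
    using H step_const_pos \<epsilon> g by (subst ennreal_mult[symmetric]) (auto simp: mult.assoc)
  finally show ?thesis .
qed

end

context boundary_chart begin

lemma emeasure_hausdorff_graph_le:
  assumes "0 < s" "S \<subseteq> graph \<inter> cball y s" "S \<in> sets borel"
  shows "emeasure (hausdorff_measure (DIM('a) - 1)) S
    \<le> ennreal (unit_ball_vol (real (DIM('a) - 1)) * ((8 * \<Lambda>) ^ DIM('a) * s ^ (DIM('a) - 1)))"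
proof -
  have "emeasure (hausdorff_measure (DIM('a) - 1)) S \<le> emeasure (hausdorff_measure (DIM('a) - 1)) (graph \<inter> cball y s)"
    using assms closed_graph by (intro emeasure_mono) (auto intro!: borel_closed closed_Int)
  also have "\<dots> = hausdorff_outer (DIM('a) - 1) (graph \<inter> cball y s)"
    using closed_graph by (intro emeasure_hausdorff_measure borel_closed closed_Int) auto
  also note hausdorff_graph_upper[OF assms(1)]
  finally show ?thesis .
qed

text \<open>
  A single translate of the strip is too thin for information on a ball to say anything about it.
  Averaged over heights \<open>T\<close> in an interval of length \<open>\<tau>\<close>, the translates cover each point of the
  ball for a set of \<open>T\<close> of length at most \<open>H\<close>, which gives the factor \<open>H / \<tau>\<close>, again proportional
  to \<open>\<epsilon>\<close>.
\<close>

lemma strip_oscillation: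
  assumes \<epsilon>: "0 < \<epsilon>" and small: "\<epsilon> \<le> \<tau>" "r1 \<le> \<tau>" "64 * \<tau> \<le> r"
    and H: "0 \<le> h" "H = h * \<epsilon>"
    and f [measurable]: "f \<in> borel_measurable borel" and g: "0 < g"
    and E: "increments_le \<Omega> \<epsilon> g f"
    and K: "0 \<le> K" and m: "square_mass (ball (p + (r / 4) *\<^sub>R \<nu>) (4 * \<tau>)) (\<lambda>y. f y - m) \<le> ennreal (K * g)"
  shows "abs_mass (strip r1 H) (\<lambda>y. f y - m)
    \<le> ennreal (((4 * h + 1) * (measure lborel (ball p r) + step_const) +
        h / \<tau> * (measure lborel (ball p r) + K)) * (\<epsilon> * sqrt g))"
proof -
  let ?V = "measure lborel (ball p r)"
  let ?S = "strip r1 H"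
  let ?B = "ball (p + (r / 4) *\<^sub>R \<nu>) (4 * \<tau>)"
  let ?c1 = "(4 * h + 1) * (?V + step_const)"
  have [measurable]: "?B \<in> sets borel" by simp
  have \<tau>: "0 < \<tau>" using \<epsilon> small by simp
  define I where "I = {r / 4..r / 4 + \<tau>}"
  have [measurable]: "I \<in> sets borel" by (simp add: I_def)
  have eI: "emeasure lborel I = ennreal \<tau>" using \<tau> by (simp add: I_def)
  define X where "X = abs_mass ?S (\<lambda>y. f y - m)"
  have step: "X \<le> ennreal (?c1 * (\<epsilon> * sqrt g)) +
      abs_mass ?S (\<lambda>y. f (y + T *\<^sub>R \<nu>) - m)" if T: "T \<in> I" for T
  proof -
    have "X \<le> (\<integral>\<^sup>+y. indicator ?S y * ennreal \<bar>f (y + T *\<^sub>R \<nu>) - f y\<bar> +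
        indicator ?S y * ennreal \<bar>f (y + T *\<^sub>R \<nu>) - m\<bar> \<partial>lborel)"
      unfolding X_def
    proof (rule nn_integral_mono)
      fix y
      have "ennreal \<bar>f y - m\<bar> \<le> ennreal (\<bar>f (y + T *\<^sub>R \<nu>) - f y\<bar> + \<bar>f (y + T *\<^sub>R \<nu>) - m\<bar>)"
        by (rule ennreal_leI) linarith
      then show "indicator ?S y * ennreal \<bar>f y - m\<bar> \<le> indicator ?S y * ennreal \<bar>f (y + T *\<^sub>R \<nu>) - f y\<bar> +
        indicator ?S y * ennreal \<bar>f (y + T *\<^sub>R \<nu>) - m\<bar>"
        by (cases "y \<in> ?S") (auto simp: ennreal_plus)
    qed
    also have "\<dots> = abs_mass ?S (\<lambda>y. f (y + T *\<^sub>R \<nu>) - f y) +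
        abs_mass ?S (\<lambda>y. f (y + T *\<^sub>R \<nu>) - m)"
      by (rule nn_integral_add) measurable
    also have "abs_mass ?S (\<lambda>y. f (y + T *\<^sub>R \<nu>) - f y) \<le> ennreal (?c1 * (\<epsilon> * sqrt g))"
      using T small \<epsilon> \<tau> by (intro strip_increment[OF _ _ _ H f g E]) (auto simp: I_def)
    finally show ?thesis by (simp add: add_right_mono)
  qed
  have "ennreal \<tau> * X = (\<integral>\<^sup>+T. X * indicator I T \<partial>lborel)"
    by (subst nn_integral_cmult_indicator) (auto simp: eI mult.commute)
  also have "\<dots> \<le> (\<integral>\<^sup>+T. ennreal (?c1 * (\<epsilon> * sqrt g)) * indicator I T +
      indicator I T * abs_mass ?S (\<lambda>y. f (y + T *\<^sub>R \<nu>) - m) \<partial>lborel)"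
  proof (rule nn_integral_mono)
    fix T show "X * indicator I T \<le> ennreal (?c1 * (\<epsilon> * sqrt g)) * indicator I T +
      indicator I T * abs_mass ?S (\<lambda>y. f (y + T *\<^sub>R \<nu>) - m)"
      using step[of T] by (cases "T \<in> I") auto
  qed
  also have "\<dots> = ennreal (?c1 * (\<epsilon> * sqrt g)) * ennreal \<tau> +
      (\<integral>\<^sup>+T. indicator I T * abs_mass ?S (\<lambda>y. f (y + T *\<^sub>R \<nu>) - m) \<partial>lborel)"
    by (subst nn_integral_add) (auto simp: nn_integral_cmult_indicator eI)
  also have "(\<integral>\<^sup>+T. indicator I T * abs_mass ?S (\<lambda>y. f (y + T *\<^sub>R \<nu>) - m) \<partial>lborel) =
      (\<integral>\<^sup>+T. \<integral>\<^sup>+z. indicator I T * indicator ?S (z - T *\<^sub>R \<nu>) * ennreal \<bar>f z - m\<bar> \<partial>lborel \<partial>lborel)"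
  proof (rule nn_integral_cong)
    fix T
    have "abs_mass ?S (\<lambda>y. f (y + T *\<^sub>R \<nu>) - m) =
        (\<integral>\<^sup>+z. indicator ?S (z - T *\<^sub>R \<nu>) * ennreal \<bar>f z - m\<bar> \<partial>lborel)"
      using nn_integral_lborel_shift[of "\<lambda>z. indicator ?S (z - T *\<^sub>R \<nu>) * ennreal \<bar>f z - m\<bar>" "T *\<^sub>R \<nu>"]
      by simp
    then show "indicator I T * abs_mass ?S (\<lambda>y. f (y + T *\<^sub>R \<nu>) - m) =
      (\<integral>\<^sup>+z. indicator I T * indicator ?S (z - T *\<^sub>R \<nu>) * ennreal \<bar>f z - m\<bar> \<partial>lborel)"
      by (simp add: mult.assoc nn_integral_cmult)
  qed
  also have "\<dots> = (\<integral>\<^sup>+z. \<integral>\<^sup>+T. indicator I T * indicator ?S (z - T *\<^sub>R \<nu>) * ennreal \<bar>f z - m\<bar> \<partial>lborel \<partial>lborel)"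
    by (rule lborel_pair.Fubini') measurable
  also have "\<dots> \<le> (\<integral>\<^sup>+z. ennreal H * (indicator ?B z * ennreal \<bar>f z - m\<bar>) \<partial>lborel)"
  proof (rule nn_integral_mono)
    fix z
    have "(\<integral>\<^sup>+T. indicator I T * indicator ?S (z - T *\<^sub>R \<nu>) * ennreal \<bar>f z - m\<bar> \<partial>lborel) \<le>
        (\<integral>\<^sup>+T. (indicator ?B z * ennreal \<bar>f z - m\<bar>) * indicator {\<phi> z - H..\<phi> z} T \<partial>lborel)"
    proof (rule nn_integral_mono)
      fix T
      show "indicator I T * indicator ?S (z - T *\<^sub>R \<nu>) * ennreal \<bar>f z - m\<bar> \<le>
          (indicator ?B z * ennreal \<bar>f z - m\<bar>) * indicator {\<phi> z - H..\<phi> z} T"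
      proof (cases "T \<in> I \<and> z - T *\<^sub>R \<nu> \<in> ?S")
        case True
        then have T: "r / 4 \<le> T" "T \<le> r / 4 + \<tau>" and z: "norm (z - T *\<^sub>R \<nu> - p) < r1"
          "0 < \<phi> (z - T *\<^sub>R \<nu>)" "\<phi> (z - T *\<^sub>R \<nu>) \<le> H"
          by (auto simp: I_def strip_def dist_norm norm_minus_commute)
        have "\<phi> (z - T *\<^sub>R \<nu>) = \<phi> z - T" using shift[of z "- T"] by simp
        then have "T \<in> {\<phi> z - H..\<phi> z}" using z by simp
        moreover have "z \<in> ?B"
        proof -
          have "norm (z - (p + (r / 4) *\<^sub>R \<nu>)) \<le> norm (z - T *\<^sub>R \<nu> - p) + norm ((T - r / 4) *\<^sub>R \<nu>)"
            using norm_triangle_ineq[of "z - T *\<^sub>R \<nu> - p" "(T - r / 4) *\<^sub>R \<nu>"] by (simp add: algebra_simps)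
          then show ?thesis using z T small \<tau> by (simp add: dist_norm norm_minus_commute)
        qed
        ultimately show ?thesis using True by simp
      next
        case False
        then show ?thesis by (auto simp: indicator_def)
      qed
    qed
    also have "\<dots> = ennreal H * (indicator ?B z * ennreal \<bar>f z - m\<bar>)"
      using H \<epsilon> by (subst nn_integral_cmult_indicator) (auto simp: mult.commute)
    finally show "(\<integral>\<^sup>+T. indicator I T * indicator ?S (z - T *\<^sub>R \<nu>) * ennreal \<bar>f z - m\<bar> \<partial>lborel) \<le>
      ennreal H * (indicator ?B z * ennreal \<bar>f z - m\<bar>)" .
  qed
  also have "\<dots> = ennreal H * abs_mass ?B (\<lambda>z. f z - m)"
    by (rule nn_integral_cmult) measurable
  also have "abs_mass ?B (\<lambda>z. f z - m) \<le> ennreal ((?V + K) * sqrt g)"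
  proof (rule nn_integral_abs_le)
    have "emeasure lborel ?B \<le> emeasure lborel (ball p r)"
    proof (rule emeasure_mono, rule subsetI)
      fix z assume "z \<in> ?B"
      moreover have "dist p z \<le> dist p (p + (r / 4) *\<^sub>R \<nu>) + dist (p + (r / 4) *\<^sub>R \<nu>) z" by (rule dist_triangle)
      ultimately show "z \<in> ball p r" using small r_pos by (simp add: dist_norm)
    qed simp
    also have "\<dots> = ennreal ?V" using r_pos by (simp add: emeasure_ball content_ball)
    finally show "emeasure lborel ?B \<le> ennreal ?V" .
  qed (use K m g in auto)
  finally have "ennreal \<tau> * X \<le> ennreal (?c1 * (\<epsilon> * sqrt g)) * ennreal \<tau> + ennreal H * ennreal ((?V + K) * sqrt g)"
    by (simp add: add_left_mono mult_left_mono)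
  also have "\<dots> = ennreal \<tau> * ennreal ((?c1 + h / \<tau> * (?V + K)) * (\<epsilon> * sqrt g))"
    using \<tau> H \<epsilon> g K step_const_pos
    by (simp add: field_simps flip: ennreal_mult ennreal_plus)
  finally show ?thesis unfolding X_def using \<tau> by (subst (asm) ennreal_mult_le_mult_iff) auto
qed

text \<open>
  The trace estimate. By Fubini and \<open>hausdorff_graph_upper\<close> the oscillation near the boundary
  patch is at most of order \<open>\<epsilon>\<^sup>d\<^sup>-\<^sup>1\<close> times the integral of \<open>\<bar>f - m\<bar>\<close> over a strip of width of
  order \<open>\<epsilon>\<close>, and the latter is of order \<open>\<epsilon>\<close>. The patch has radius \<open>\<tau> / 2\<close>, and the constant \<open>m\<close>
  belongs to the ball of radius \<open>4\<tau>\<close> that is centred at height \<open>r / 4\<close> above \<open>p\<close>.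
\<close>

lemma boundary_oscillation:
  fixes \<alpha> :: real
  assumes \<alpha>: "0 < \<alpha>"
  defines "\<tau> \<equiv> r / (64 * \<Lambda>)"
  defines "q \<equiv> p + (r / 4) *\<^sub>R \<nu>"
  shows "\<exists>\<epsilon>0>0. \<exists>K>0. \<forall>\<epsilon> f g. 0 < \<epsilon> \<longrightarrow> \<epsilon> \<le> \<epsilon>0 \<longrightarrow> f \<in> borel_measurable borel \<longrightarrow> 0 < g \<longrightarrow>
    increments_le \<Omega> \<epsilon> g f \<longrightarrow>
    (\<exists>m. square_mass (ball q (4 * \<tau>)) (\<lambda>y. f y - m) \<le> ennreal (K * g) \<and>
      trace_oscillation \<Omega> (graph \<inter> ball p (\<tau> / 2)) (\<alpha> * \<epsilon>) f m \<le> ennreal (K * (\<epsilon> ^ DIM('a) * sqrt g)))"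
proof -
  have \<tau>: "0 < \<tau>" "64 * (\<Lambda> * \<tau>) = r" "64 * \<tau> \<le> r"
  proof -
    show "0 < \<tau>" "64 * (\<Lambda> * \<tau>) = r" using r_pos \<Lambda>_ge_1 by (auto simp: \<tau>_def)
    then show "64 * \<tau> \<le> r" using mult_right_mono[OF \<Lambda>_ge_1, of \<tau>] by linarith
  qed
  have "ball q (2 * (4 * \<tau>)) \<subseteq> \<Omega>"
    unfolding q_def using \<tau> r_pos \<phi>_p by (intro above_in_domain) auto
  then obtain K0 where K0: "0 < K0" and poincare: "\<And>\<epsilon> f g. 0 < \<epsilon> \<Longrightarrow> \<epsilon> \<le> 4 * \<tau> \<Longrightarrow> f \<in> borel_measurable borel \<Longrightarrow> 0 < g \<Longrightarrow>
    increments_le \<Omega> \<epsilon> g f \<Longrightarrow>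
    \<exists>m. square_mass (ball q (4 * \<tau>)) (\<lambda>y. f y - m) \<le> ennreal (K0 * g)"
    using ball_poincare[of "4 * \<tau>" q \<Omega>] \<tau> measurable_domain by auto
  let ?V = "measure lborel (ball p r)"
  let ?H = "hausdorff_measure (DIM('a) - 1) :: 'a measure"
  define h where "h = \<Lambda> * \<alpha>"
  have h: "0 \<le> h" using \<alpha> \<Lambda>_ge_1 by (simp add: h_def)
  define c1 where "c1 = (4 * h + 1) * (?V + step_const) + h / \<tau> * (?V + K0)"
  define c2 where "c2 = unit_ball_vol (real (DIM('a) - 1)) * ((8 * \<Lambda>) ^ DIM('a) * \<alpha> ^ (DIM('a) - 1))"
  have c1: "0 \<le> c1" using h step_const_pos \<tau> K0 by (simp add: c1_def)
  have c2: "0 \<le> c2" using \<alpha> \<Lambda>_ge_1 by (simp add: c2_def)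
  define P where "P = graph \<inter> ball p (\<tau> / 2)"
  have P [measurable]: "P \<in> sets borel" using closed_graph by (auto simp: P_def)
  \<comment> \<open>Then \<open>\<alpha> * \<epsilon> \<le> \<tau> / 2\<close>, and points that close to the patch lie in a strip over \<open>ball p \<tau>\<close>.\<close>
  define \<epsilon>0 where "\<epsilon>0 = min \<tau> (\<tau> / (2 * \<alpha>))"
  have \<epsilon>0: "0 < \<epsilon>0" using \<tau> \<alpha> by (simp add: \<epsilon>0_def)
  have main: "\<exists>m. square_mass (ball q (4 * \<tau>)) (\<lambda>y. f y - m) \<le> ennreal (K0 * g) \<and>
      trace_oscillation \<Omega> P (\<alpha> * \<epsilon>) f m \<le> ennreal (c2 * c1 * (\<epsilon> ^ DIM('a) * sqrt g))"
    if \<epsilon>: "0 < \<epsilon>" "\<epsilon> \<le> \<epsilon>0" and f [measurable]: "f \<in> borel_measurable borel" and g: "0 < g"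
      and E: "increments_le \<Omega> \<epsilon> g f" for \<epsilon> f g
  proof -
    have \<epsilon>': "\<epsilon> \<le> \<tau>" "\<alpha> * \<epsilon> \<le> \<tau> / 2"
      using \<epsilon> \<alpha> by (auto simp: \<epsilon>0_def field_simps)
    obtain m where m: "square_mass (ball q (4 * \<tau>)) (\<lambda>y. f y - m) \<le> ennreal (K0 * g)"
      using poincare[OF \<epsilon>(1) _ f g E] \<epsilon>' \<tau> by auto
    let ?S = "strip \<tau> (h * \<epsilon>)"
    have S: "abs_mass ?S (\<lambda>y. f y - m) \<le> ennreal (c1 * (\<epsilon> * sqrt g))"
      unfolding c1_def using \<epsilon> \<epsilon>' \<tau> K0 m
      by (intro strip_oscillation[OF _ _ _ _ h refl f g E]) (auto simp: q_def)
    define M where "M = density ?H (indicator P)"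
    have sM [measurable_cong]: "sets M = sets borel" by (simp add: M_def)
    have eM: "emeasure M A = emeasure ?H (A \<inter> P)" if "A \<in> sets borel" for A
      using that P unfolding M_def by (subst emeasure_density) (auto simp: Int_commute simp flip: indicator_inter_arith)
    have "emeasure M (space M) < \<infinity>"
    proof -
      have "emeasure M (space M) = emeasure ?H P" using eM[of UNIV] by (simp add: M_def)
      also have "\<dots> \<le> ennreal (unit_ball_vol (real (DIM('a) - 1)) * ((8 * \<Lambda>) ^ DIM('a) * \<tau> ^ (DIM('a) - 1)))"
        using \<tau> P by (intro emeasure_hausdorff_graph_le[where y = p]) (auto simp: P_def)
      finally show ?thesis by (auto simp: le_less_trans)
    qed
    then interpret M: finite_measure M by (intro finite_measureI) auto
    interpret pair: pair_sigma_finite lborel M ..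
    have "trace_oscillation \<Omega> P (\<alpha> * \<epsilon>) f m =
        (\<integral>\<^sup>+x. \<integral>\<^sup>+y. indicator \<Omega> y * indicator {..\<alpha> * \<epsilon>} (dist x y) * ennreal \<bar>f y - m\<bar> \<partial>lborel \<partial>M)"
      unfolding M_def by (subst nn_integral_density) (auto simp: mult.assoc nn_integral_cmult)
    also have "\<dots> = (\<integral>\<^sup>+y. \<integral>\<^sup>+x. indicator \<Omega> y * indicator {..\<alpha> * \<epsilon>} (dist x y) * ennreal \<bar>f y - m\<bar> \<partial>M \<partial>lborel)"
      by (rule pair.Fubini') measurable
    also have "\<dots> \<le> (\<integral>\<^sup>+y. ennreal (c2 * \<epsilon> ^ (DIM('a) - 1)) * (indicator ?S y * ennreal \<bar>f y - m\<bar>) \<partial>lborel)"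
    proof (rule nn_integral_mono)
      fix y
      have "(\<integral>\<^sup>+x. indicator \<Omega> y * indicator {..\<alpha> * \<epsilon>} (dist x y) * ennreal \<bar>f y - m\<bar> \<partial>M) =
          indicator \<Omega> y * ennreal \<bar>f y - m\<bar> * (\<integral>\<^sup>+x. indicator (cball y (\<alpha> * \<epsilon>)) x \<partial>M)"
        by (subst nn_integral_cmult[symmetric]) (auto simp: sM intro!: borel_measurable_indicator nn_integral_cong split: split_indicator simp: dist_commute)
      also have "(\<integral>\<^sup>+x. indicator (cball y (\<alpha> * \<epsilon>)) x \<partial>M) = emeasure ?H (cball y (\<alpha> * \<epsilon>) \<inter> P)"
        by (subst nn_integral_indicator) (auto simp: sM eM)
      also have "indicator \<Omega> y * ennreal \<bar>f y - m\<bar> * emeasure ?H (cball y (\<alpha> * \<epsilon>) \<inter> P) \<le>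
          ennreal (c2 * \<epsilon> ^ (DIM('a) - 1)) * (indicator ?S y * ennreal \<bar>f y - m\<bar>)"
      proof (cases "y \<in> \<Omega> \<and> cball y (\<alpha> * \<epsilon>) \<inter> P \<noteq> {}")
        case True
        then obtain x where x: "\<phi> x = 0" "dist p x < \<tau> / 2" "dist y x \<le> \<alpha> * \<epsilon>" by (auto simp: P_def)
        have "dist p y < \<tau>" using x \<epsilon>' dist_triangle[of p y x] by (simp add: dist_commute)
        moreover have "0 < \<phi> y" using True chart[of y] \<open>dist p y < \<tau>\<close> \<tau> by simp
        moreover have "\<phi> y \<le> h * \<epsilon>"
        proof -
          have "\<phi> y \<le> \<Lambda> * norm (y - x)" using lipschitz[of y x] x by simp
          also have "\<dots> \<le> \<Lambda> * (\<alpha> * \<epsilon>)" using x \<Lambda>_ge_1 by (intro mult_left_mono) (auto simp: dist_norm)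
          finally show ?thesis by (simp add: h_def mult.assoc)
        qed
        ultimately have "y \<in> ?S" by (simp add: strip_def)
        moreover have "emeasure ?H (cball y (\<alpha> * \<epsilon>) \<inter> P) \<le>
            ennreal (unit_ball_vol (real (DIM('a) - 1)) * ((8 * \<Lambda>) ^ DIM('a) * (\<alpha> * \<epsilon>) ^ (DIM('a) - 1)))"
          using \<alpha> \<epsilon> P by (intro emeasure_hausdorff_graph_le) (auto simp: P_def)
        then have "emeasure ?H (cball y (\<alpha> * \<epsilon>) \<inter> P) \<le> ennreal (c2 * \<epsilon> ^ (DIM('a) - 1))"
          by (simp add: c2_def power_mult_distrib mult.assoc)
        ultimately show ?thesis using True by (simp add: mult.commute mult_left_mono)
      qed auto
      finally show "(\<integral>\<^sup>+x. indicator \<Omega> y * indicator {..\<alpha> * \<epsilon>} (dist x y) * ennreal \<bar>f y - m\<bar> \<partial>M) \<le>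
          ennreal (c2 * \<epsilon> ^ (DIM('a) - 1)) * (indicator ?S y * ennreal \<bar>f y - m\<bar>)" .
    qed
    also have "\<dots> = ennreal (c2 * \<epsilon> ^ (DIM('a) - 1)) * abs_mass ?S (\<lambda>y. f y - m)"
      by (rule nn_integral_cmult) measurable
    also have "\<dots> \<le> ennreal (c2 * \<epsilon> ^ (DIM('a) - 1)) * ennreal (c1 * (\<epsilon> * sqrt g))"
      by (rule mult_left_mono[OF S]) simp
    also have "\<dots> = ennreal (c2 * c1 * (\<epsilon> ^ DIM('a) * sqrt g))"
    proof -
      obtain d where d: "DIM('a) = Suc d" using DIM_positive by (metis gr0_conv_Suc)
      show ?thesis unfolding d using c1 c2 \<epsilon> g by (simp add: mult_ac flip: ennreal_mult)
    qed
    finally show ?thesis using m by blast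
  qed
  define K where "K = max K0 (c2 * c1)"
  have Kg: "ennreal (K0 * x) \<le> ennreal (K * x)" "ennreal (c2 * c1 * x) \<le> ennreal (K * x)" if "0 \<le> x" for x
    using that by (auto intro!: ennreal_leI mult_right_mono simp: K_def)
  show ?thesis
  proof (rule exI[of _ \<epsilon>0], rule conjI[OF \<epsilon>0], rule exI[of _ K], rule conjI, goal_cases)
    case 2
    show ?case
    proof (intro allI impI)
      fix \<epsilon> f g assume *: "0 < \<epsilon>" "\<epsilon> \<le> \<epsilon>0" "f \<in> borel_measurable borel" "0 < (g :: real)"
        "increments_le \<Omega> \<epsilon> g f"
      have g0: "0 \<le> g" "0 \<le> \<epsilon> ^ DIM('a) * sqrt g" using * by auto
      show "\<exists>m. square_mass (ball q (4 * \<tau>)) (\<lambda>y. f y - m) \<le> ennreal (K * g) \<and>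
        trace_oscillation \<Omega> (graph \<inter> ball p (\<tau> / 2)) (\<alpha> * \<epsilon>) f m \<le> ennreal (K * (\<epsilon> ^ DIM('a) * sqrt g))"
        using main[OF *] Kg(1)[OF g0(1)] Kg(2)[OF g0(2)] unfolding P_def by (meson order_trans)
    qed
  qed (use K0 in \<open>auto simp: K_def\<close>)
qed

end

section \<open>Propagation of vanishing mass\<close>

lemma square_mass_mono: "A \<subseteq> B \<Longrightarrow> square_mass A f \<le> square_mass B f"
  by (intro nn_integral_mono mult_right_mono) (auto simp: indicator_def)

lemma square_mass_UN_le:
  assumes "finite I" "\<And>i. i \<in> I \<Longrightarrow> B i \<in> sets borel" "f \<in> borel_measurable borel" "A \<subseteq> (\<Union>i\<in>I. B i)"
  shows "square_mass A f \<le> (\<Sum>i\<in>I. square_mass (B i) f)"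
proof -
  have "square_mass A f \<le> (\<integral>\<^sup>+x. (\<Sum>i\<in>I. indicator (B i) x * ennreal ((f x)\<^sup>2)) \<partial>lborel)"
  proof (rule nn_integral_mono)
    fix x
    show "indicator A x * ennreal ((f x)\<^sup>2) \<le> (\<Sum>i\<in>I. indicator (B i) x * ennreal ((f x)\<^sup>2))"
    proof (cases "x \<in> A")
      case True
      then obtain i where "i \<in> I" "x \<in> B i" using assms by blast
      then show ?thesis using assms(1) True
        by (intro order_trans[OF _ member_le_sum[of i]]) auto
    qed simp
  qed
  also have "\<dots> = (\<Sum>i\<in>I. square_mass (B i) f)"
    using assms by (intro nn_integral_sum) auto
  finally show ?thesis .
qed

lemma compact_ball_cover:
  fixes C :: "'a::metric_space set"
  assumes "compact C" "\<And>x. x \<in> C \<Longrightarrow> 0 < \<rho> x"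
  shows "\<exists>I. I \<subseteq> C \<and> finite I \<and> C \<subseteq> (\<Union>x\<in>I. ball x (\<rho> x))"
proof (rule compactE_image[OF assms(1), of C "\<lambda>x. ball x (\<rho> x)"])
  show "C \<subseteq> (\<Union>x\<in>C. ball x (\<rho> x))" using assms(2) by force
  fix I assume "I \<subseteq> C" "finite I" "C \<subseteq> (\<Union>x\<in>I. ball x (\<rho> x))"
  then show ?thesis by blast
qed simp

text \<open>
  The hypotheses on the sequence that the first term of the energies provides. Positivity of \<open>g\<close>
  allows division by its square root.
\<close>

locale vanishing_increments =
  fixes \<Omega> :: "'a::euclidean_space set" and f :: "nat \<Rightarrow> 'a \<Rightarrow> real" and \<epsilon> g :: "nat \<Rightarrow> real"
  assumes open_\<Omega>: "open \<Omega>"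
    and f [measurable]: "\<And>n. f n \<in> borel_measurable borel"
    and \<epsilon>_pos: "\<And>n. 0 < \<epsilon> n" and \<epsilon>_lim: "\<epsilon> \<longlonglongrightarrow> 0"
    and g_pos: "\<And>n. 0 < g n" and g_lim: "g \<longlonglongrightarrow> 0"
    and increments: "\<And>n. increments_le \<Omega> (\<epsilon> n) (g n) (f n)"
begin

definition vanishes_on :: "'a set \<Rightarrow> bool" where
  "vanishes_on A \<longleftrightarrow> (\<lambda>n. square_mass A (f n)) \<longlonglongrightarrow> 0"

lemma eventually_\<epsilon>_le: "0 < e \<Longrightarrow> \<forall>\<^sub>F n in sequentially. \<epsilon> n \<le> e"
  using order_tendstoD(2)[OF \<epsilon>_lim, of e] by (auto elim: eventually_mono)

lemma vanishes_on_leI: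
  assumes "\<forall>\<^sub>F n in sequentially. square_mass A (f n) \<le> X n" "X \<longlonglongrightarrow> 0"
  shows "vanishes_on A"
  unfolding vanishes_on_def by (rule tendsto_sandwich[OF _ assms(1) tendsto_const assms(2)]) simp

lemma vanishes_on_subset: "vanishes_on B \<Longrightarrow> A \<subseteq> B \<Longrightarrow> vanishes_on A"
  by (rule vanishes_on_leI[of _ "\<lambda>n. square_mass B (f n)"])
    (auto simp: vanishes_on_def intro!: always_eventually square_mass_mono)

lemma vanishes_on_cover:
  assumes "finite I" "\<And>i. i \<in> I \<Longrightarrow> B i \<in> sets borel" "\<And>i. i \<in> I \<Longrightarrow> vanishes_on (B i)" "A \<subseteq> (\<Union>i\<in>I. B i)"
  shows "vanishes_on A"
proof (rule vanishes_on_leI)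
  show "\<forall>\<^sub>F n in sequentially. square_mass A (f n) \<le> (\<Sum>i\<in>I. square_mass (B i) (f n))"
    using assms by (intro always_eventually allI square_mass_UN_le f) auto
  have "(\<lambda>n. \<Sum>i\<in>I. square_mass (B i) (f n)) \<longlonglongrightarrow> (\<Sum>i\<in>I. 0)"
    using assms(3) by (intro tendsto_sum) (auto simp: vanishes_on_def)
  then show "(\<lambda>n. \<Sum>i\<in>I. square_mass (B i) (f n)) \<longlonglongrightarrow> 0" by simp
qed

lemma square_mass_le_oscillation:
  assumes [measurable]: "h \<in> borel_measurable borel" "B \<in> sets borel"
  shows "square_mass B h \<le> 2 * square_mass B (\<lambda>y. h y - m) + 2 * (emeasure lborel B * ennreal (m\<^sup>2))"
    and "emeasure lborel B * ennreal (m\<^sup>2) \<le> 2 * square_mass B (\<lambda>y. h y - m) + 2 * square_mass B h"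
proof -
  have eq: "emeasure lborel B * ennreal (m\<^sup>2) = (\<integral>\<^sup>+y. indicator B y * ennreal (m\<^sup>2) \<partial>lborel)"
    by (simp add: nn_integral_multc)
  have a: "ennreal ((h y)\<^sup>2) \<le> 2 * ennreal ((h y - m)\<^sup>2) + 2 * ennreal (m\<^sup>2)" for y
    using ennreal_leI[OF square_diff_le[of "h y" 0 m]] by (simp add: ennreal_plus ennreal_mult)
  have b: "ennreal (m\<^sup>2) \<le> 2 * ennreal ((h y - m)\<^sup>2) + 2 * ennreal ((h y)\<^sup>2)" for y
    using ennreal_leI[OF square_diff_le[of m 0 "h y"]] by (simp add: ennreal_plus ennreal_mult power2_commute)
  have "square_mass B h \<le> (\<integral>\<^sup>+y. 2 * (indicator B y * ennreal ((h y - m)\<^sup>2)) + 2 * (indicator B y * ennreal (m\<^sup>2)) \<partial>lborel)"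
    using a by (intro nn_integral_mono) (simp add: indicator_def)
  also have "\<dots> = 2 * square_mass B (\<lambda>y. h y - m) + 2 * (emeasure lborel B * ennreal (m\<^sup>2))"
    unfolding eq by (subst nn_integral_add) (auto simp: nn_integral_cmult)
  finally show "square_mass B h \<le> 2 * square_mass B (\<lambda>y. h y - m) + 2 * (emeasure lborel B * ennreal (m\<^sup>2))" .
  have "emeasure lborel B * ennreal (m\<^sup>2) \<le> (\<integral>\<^sup>+y. 2 * (indicator B y * ennreal ((h y - m)\<^sup>2)) + 2 * (indicator B y * ennreal ((h y)\<^sup>2)) \<partial>lborel)"
    unfolding eq using b by (intro nn_integral_mono) (simp add: indicator_def)
  also have "\<dots> = 2 * square_mass B (\<lambda>y. h y - m) + 2 * square_mass B h"
    by (subst nn_integral_add) (auto simp: nn_integral_cmult)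
  finally show "emeasure lborel B * ennreal (m\<^sup>2) \<le> 2 * square_mass B (\<lambda>y. h y - m) + 2 * square_mass B h" .
qed

lemma vanishes_on_ball_of_mean:
  assumes osc: "\<forall>\<^sub>F n in sequentially. square_mass (ball q \<rho>) (\<lambda>y. f n y - m n) \<le> ennreal (K * g n)"
    and m: "(\<lambda>n. ennreal ((m n)\<^sup>2)) \<longlonglongrightarrow> 0"
  shows "vanishes_on (ball q \<rho>)"
proof (rule vanishes_on_leI)
  show "\<forall>\<^sub>F n in sequentially. square_mass (ball q \<rho>) (f n) \<le>
      2 * ennreal (K * g n) + 2 * (ennreal (measure lborel (ball q \<rho>)) * ennreal ((m n)\<^sup>2))"
    using osc
  proof eventually_elim
    case (elim n)
    have "emeasure lborel (ball q \<rho>) = ennreal (measure lborel (ball q \<rho>))"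
      by (rule emeasure_eq_ennreal_measure) (use emeasure_bounded_finite[OF bounded_ball, of q \<rho>] in auto)
    then have "square_mass (ball q \<rho>) (f n) \<le> 2 * square_mass (ball q \<rho>) (\<lambda>y. f n y - m n)
        + 2 * (ennreal (measure lborel (ball q \<rho>)) * ennreal ((m n)\<^sup>2))"
      using square_mass_le_oscillation(1)[OF f, of "ball q \<rho>" n "m n"] by simp
    also have "\<dots> \<le> 2 * ennreal (K * g n) + 2 * (ennreal (measure lborel (ball q \<rho>)) * ennreal ((m n)\<^sup>2))"
      by (intro add_right_mono mult_left_mono elim) auto
    finally show ?case .
  qed
  have "(\<lambda>n. ennreal (K * g n)) \<longlonglongrightarrow> ennreal (K * 0)" by (intro tendsto_ennrealI tendsto_intros g_lim)
  then have "(\<lambda>n. 2 * ennreal (K * g n) + 2 * (ennreal (measure lborel (ball q \<rho>)) * ennreal ((m n)\<^sup>2)))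
      \<longlonglongrightarrow> 2 * ennreal (K * 0) + 2 * (ennreal (measure lborel (ball q \<rho>)) * 0)"
    using m by (intro tendsto_add ennreal_tendsto_cmult) auto
  then show "(\<lambda>n. 2 * ennreal (K * g n) + 2 * (ennreal (measure lborel (ball q \<rho>)) * ennreal ((m n)\<^sup>2))) \<longlonglongrightarrow> 0"
    by simp
qed

text \<open>
  On the ball the functions are close to constants, and the subball shows that the constants tend
  to \<open>0\<close>.
\<close>

lemma vanishes_on_ball_of_subball:
  assumes \<rho>: "0 < \<rho>" "ball q (2 * \<rho>) \<subseteq> \<Omega>" and \<rho>': "0 < \<rho>'" "ball q' \<rho>' \<subseteq> ball q \<rho>"
    and van: "vanishes_on (ball q' \<rho>')"
  shows "vanishes_on (ball q \<rho>)"
proof -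
  obtain K where K: "0 < K" and poincare: "\<And>\<epsilon> f g. 0 < \<epsilon> \<Longrightarrow> \<epsilon> \<le> \<rho> \<Longrightarrow> f \<in> borel_measurable borel \<Longrightarrow> 0 < g \<Longrightarrow>
    increments_le \<Omega> \<epsilon> g f \<Longrightarrow>
    \<exists>m. square_mass (ball q \<rho>) (\<lambda>y. f y - m) \<le> ennreal (K * g)"
    using ball_poincare[OF \<rho>] open_\<Omega> by (auto simp: borel_open)
  have "\<forall>n. \<exists>m. \<epsilon> n \<le> \<rho> \<longrightarrow> square_mass (ball q \<rho>) (\<lambda>y. f n y - m) \<le> ennreal (K * g n)"
    using poincare[OF \<epsilon>_pos _ f g_pos increments] by blast
  then obtain m where m: "\<And>n. \<epsilon> n \<le> \<rho> \<Longrightarrow>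
      square_mass (ball q \<rho>) (\<lambda>y. f n y - m n) \<le> ennreal (K * g n)"
    by metis
  define V where "V = measure lborel (ball q' \<rho>')"
  have V: "0 < V" "emeasure lborel (ball q' \<rho>') = ennreal V"
    using \<rho>' by (auto simp: V_def content_ball_pos emeasure_ball content_ball)
  show ?thesis
  proof (rule vanishes_on_ball_of_mean)
    show "\<forall>\<^sub>F n in sequentially. square_mass (ball q \<rho>) (\<lambda>y. f n y - m n) \<le> ennreal (K * g n)"
      using eventually_\<epsilon>_le[OF \<rho>(1)] by eventually_elim (rule m)
    show "(\<lambda>n. ennreal ((m n)\<^sup>2)) \<longlonglongrightarrow> 0"
    proof (rule tendsto_sandwich[OF _ _ tendsto_const])
      show "\<forall>\<^sub>F n in sequentially. ennreal ((m n)\<^sup>2) \<le>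
          ennreal (1 / V) * (2 * ennreal (K * g n) + 2 * square_mass (ball q' \<rho>') (f n))"
        using eventually_\<epsilon>_le[OF \<rho>(1)]
      proof eventually_elim
        case (elim n)
        have "ennreal V * ennreal ((m n)\<^sup>2) \<le> 2 * square_mass (ball q' \<rho>') (\<lambda>y. f n y - m n)
            + 2 * square_mass (ball q' \<rho>') (f n)"
          using square_mass_le_oscillation(2)[OF f, of "ball q' \<rho>'" "m n" n] V by simp
        also have "square_mass (ball q' \<rho>') (\<lambda>y. f n y - m n) \<le>
            square_mass (ball q \<rho>) (\<lambda>y. f n y - m n)"
          using \<rho>' by (intro nn_integral_mono mult_right_mono) (auto simp: indicator_def)
        also have "\<dots> \<le> ennreal (K * g n)" by (rule m[OF elim])
        finally have "ennreal V * ennreal ((m n)\<^sup>2) \<le> 2 * ennreal (K * g n) + 2 * square_mass (ball q' \<rho>') (f n)"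
          by (simp add: add_right_mono mult_left_mono)
        then have "ennreal (1 / V) * (ennreal V * ennreal ((m n)\<^sup>2)) \<le>
            ennreal (1 / V) * (2 * ennreal (K * g n) + 2 * square_mass (ball q' \<rho>') (f n))"
          by (rule mult_left_mono) simp
        then show ?case using V by (simp flip: ennreal_mult)
      qed
      have "(\<lambda>n. ennreal (K * g n)) \<longlonglongrightarrow> ennreal (K * 0)" by (intro tendsto_ennrealI tendsto_intros g_lim)
      then have "(\<lambda>n. ennreal (1 / V) * (2 * ennreal (K * g n) + 2 * square_mass (ball q' \<rho>') (f n)))
          \<longlonglongrightarrow> ennreal (1 / V) * (2 * ennreal (K * 0) + 2 * 0)"
        using van unfolding vanishes_on_def by (intro tendsto_add ennreal_tendsto_cmult) auto
      then show "(\<lambda>n. ennreal (1 / V) * (2 * ennreal (K * g n) + 2 * square_mass (ball q' \<rho>') (f n))) \<longlonglongrightarrow> 0"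
        by simp
    qed simp
  qed
qed

text \<open>
  The points that have a neighbourhood with vanishing mass form an open set, which is also closed
  in \<open>\<Omega>\<close> by \<open>vanishes_on_ball_of_subball\<close>; connectedness and a finite cover do the rest.
\<close>

lemma vanishes_on_compact:
  assumes conn: "connected \<Omega>" and start: "0 < \<rho>0" "ball q0 \<rho>0 \<subseteq> \<Omega>" "vanishes_on (ball q0 \<rho>0)"
    and C: "compact C" "C \<subseteq> \<Omega>"
  shows "vanishes_on C"
proof -
  define S where "S = {q \<in> \<Omega>. \<exists>\<rho>>0. ball q \<rho> \<subseteq> \<Omega> \<and> vanishes_on (ball q \<rho>)}"
  have openS: "open S"
    unfolding open_contains_ball
  proof
    fix q assume "q \<in> S"
    then obtain \<rho> where \<rho>: "0 < \<rho>" "ball q \<rho> \<subseteq> \<Omega>" "vanishes_on (ball q \<rho>)" by (auto simp: S_def)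
    have "ball q \<rho> \<subseteq> S"
    proof
      fix q' assume q': "q' \<in> ball q \<rho>"
      have sub: "ball q' (\<rho> - dist q q') \<subseteq> ball q \<rho>"
      proof
        fix z assume "z \<in> ball q' (\<rho> - dist q q')"
        then show "z \<in> ball q \<rho>" using dist_triangle[of q z q'] by simp
      qed
      then show "q' \<in> S" unfolding S_def using q' \<rho> vanishes_on_subset[OF \<rho>(3) sub]
        by (auto intro!: exI[of _ "\<rho> - dist q q'"])
    qed
    then show "\<exists>e>0. ball q e \<subseteq> S" using \<rho> by blast
  qed
  have closedS: "q \<in> S" if q: "q \<in> \<Omega>" "q \<in> closure S" for q
  proof -
    obtain r where r: "0 < r" "ball q r \<subseteq> \<Omega>" using open_\<Omega> q open_contains_ball by blast
    define \<rho> where "\<rho> = r / 2"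
    have \<rho>: "0 < \<rho>" "ball q (2 * \<rho>) \<subseteq> \<Omega>" using r by (auto simp: \<rho>_def)
    obtain q' where q': "q' \<in> S" "dist q' q < \<rho>" using q \<rho> by (auto simp: closure_approachable)
    then obtain \<rho>' where \<rho>': "0 < \<rho>'" "vanishes_on (ball q' \<rho>')" by (auto simp: S_def)
    define \<rho>'' where "\<rho>'' = min \<rho>' (\<rho> - dist q' q)"
    have \<rho>'': "0 < \<rho>''" using \<rho>' q' by (simp add: \<rho>''_def)
    have sub: "ball q' \<rho>'' \<subseteq> ball q \<rho>"
    proof
      fix z assume "z \<in> ball q' \<rho>''"
      then show "z \<in> ball q \<rho>" using dist_triangle[of q z q'] by (simp add: \<rho>''_def dist_commute)
    qed
    have "vanishes_on (ball q' \<rho>'')"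
      by (rule vanishes_on_subset[OF \<rho>'(2)]) (auto simp: \<rho>''_def)
    then have "vanishes_on (ball q \<rho>)" by (rule vanishes_on_ball_of_subball[OF \<rho> \<rho>'' sub])
    moreover have "ball q \<rho> \<subseteq> \<Omega>" using r by (auto simp: \<rho>_def)
    ultimately show ?thesis using q \<rho> by (auto simp: S_def)
  qed
  have "q0 \<in> S" using start by (auto simp: S_def)
  moreover have "openin (top_of_set \<Omega>) S" using openS by (auto simp: S_def intro!: open_openin_trans[OF open_\<Omega>])
  moreover have "closedin (top_of_set \<Omega>) S"
  proof -
    have "S \<subseteq> \<Omega>" by (auto simp: S_def)
    then have "S = \<Omega> \<inter> closure S" using closedS closure_subset[of S] by blast
    then show ?thesis unfolding closedin_closed using closed_closure by blast
  qed
  ultimately have S: "S = \<Omega>" using conn unfolding connected_clopen by blast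
  have "\<exists>\<rho>>0. vanishes_on (ball q \<rho>)" if "q \<in> C" for q using that C S by (auto simp: S_def)
  then obtain \<rho> where \<rho>: "\<And>q. q \<in> C \<Longrightarrow> 0 < \<rho> q" "\<And>q. q \<in> C \<Longrightarrow> vanishes_on (ball q (\<rho> q))" by metis
  then obtain I where I: "I \<subseteq> C" "finite I" "C \<subseteq> (\<Union>q\<in>I. ball q (\<rho> q))"
    using compact_ball_cover[OF C(1), of \<rho>] by blast
  show ?thesis
    by (rule vanishes_on_cover[OF I(2) _ _ I(3)]) (use I(1) \<rho>(2) in auto)
qed

end

locale chart_sequence = boundary_chart \<phi> \<nu> \<Lambda> \<Omega> p r + vanishing_increments \<Omega> f \<epsilon> g
  for \<phi> \<nu> \<Lambda> and \<Omega> :: "'a::euclidean_space set" and p r f \<epsilon> g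
begin

text \<open>
  A vertical shift by a fixed height moves the part of the chart near the boundary into a compact
  subset of \<open>\<Omega>\<close>.
\<close>

lemma vanishes_near_boundary:
  assumes compact: "\<And>C. compact C \<Longrightarrow> C \<subseteq> \<Omega> \<Longrightarrow> vanishes_on C"
  shows "vanishes_on (\<Omega> \<inter> ball p (r / 4))"
proof -
  define T where "T = r / 4"
  have T: "0 < T" using r_pos by (simp add: T_def)
  let ?A = "\<Omega> \<inter> ball p (r / 4)"
  have [measurable]: "?A \<in> sets borel" using open_domain by (intro borel_open open_Int) auto
  define C where "C = {y. T \<le> \<phi> y} \<inter> cball p (r / 2)"
  have "compact C"
    unfolding C_def using continuous_height[of UNIV]
    by (intro closed_Int_compact closed_Collect_le) (auto simp: continuous_on_const)
  moreover have "C \<subseteq> \<Omega>" using chart T r_pos by (auto simp: C_def)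
  ultimately have C: "vanishes_on C" by (rule compact)
  show ?thesis
  proof (rule vanishes_on_leI)
    have "\<forall>\<^sub>F n in sequentially. \<epsilon> n \<le> r / 4" using r_pos by (intro eventually_\<epsilon>_le) simp
    then show "\<forall>\<^sub>F n in sequentially. square_mass ?A (f n) \<le>
        2 * ennreal (step_const * r\<^sup>2 * g n) + 2 * square_mass C (f n)"
    proof eventually_elim
      case (elim n)
      define N where "N = nat \<lceil>2 * T / \<epsilon> n\<rceil>"
      define s where "s = T / real N"
      have e: "0 < \<epsilon> n" by (rule \<epsilon>_pos)
      have N: "2 * T / \<epsilon> n \<le> real N" unfolding N_def by (rule real_nat_ceiling_ge)
      have "0 \<le> 2 * T / \<epsilon> n" using T e by simp
      then have "real N \<le> 2 * T / \<epsilon> n + 1" unfolding N_def by linarith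
      then have "real N * \<epsilon> n \<le> (2 * T / \<epsilon> n + 1) * \<epsilon> n" using e by (intro mult_right_mono) auto
      also have "\<dots> = 2 * T + \<epsilon> n" using e by (simp add: field_simps)
      finally have N2: "real N * \<epsilon> n \<le> r" using elim r_pos by (simp add: T_def)
      have Npos: "0 < real N" using N T e by (smt (verit) divide_pos_pos)
      have s: "0 \<le> s" "s \<le> \<epsilon> n / 2" "real N * s = T"
        using N Npos T e by (auto simp: s_def field_simps)
      have "square_mass ?A (\<lambda>x. f n (x + (real N * s) *\<^sub>R \<nu>) - f n x)
          \<le> ennreal (step_const * (real N * \<epsilon> n)\<^sup>2 * g n)"
        using s elim e r_pos g_pos[of n] by (intro vertical_increment f increments) (auto simp: T_def)
      also have "\<dots> \<le> ennreal (step_const * r\<^sup>2 * g n)"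
        using N2 g_pos[of n] step_const_pos e by (intro ennreal_leI mult_right_mono mult_left_mono power_mono) auto
      finally have inc: "square_mass ?A (\<lambda>x. f n (x + T *\<^sub>R \<nu>) - f n x)
          \<le> ennreal (step_const * r\<^sup>2 * g n)" by (simp add: s)
      have [measurable]: "C \<in> sets borel" using \<open>compact C\<close> by (rule borel_compact)
      have "square_mass ?A (f n) \<le> (\<integral>\<^sup>+x. 2 * (indicator ?A x * ennreal ((f n (x + T *\<^sub>R \<nu>) - f n x)\<^sup>2)) +
          2 * (indicator C (x + T *\<^sub>R \<nu>) * ennreal ((f n (x + T *\<^sub>R \<nu>))\<^sup>2)) \<partial>lborel)"
      proof (rule nn_integral_mono)
        fix x
        show "indicator ?A x * ennreal ((f n x)\<^sup>2) \<le> 2 * (indicator ?A x * ennreal ((f n (x + T *\<^sub>R \<nu>) - f n x)\<^sup>2)) +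
          2 * (indicator C (x + T *\<^sub>R \<nu>) * ennreal ((f n (x + T *\<^sub>R \<nu>))\<^sup>2))"
        proof (cases "x \<in> ?A")
          case True
          have "dist p (x + T *\<^sub>R \<nu>) \<le> dist p x + dist x (x + T *\<^sub>R \<nu>)" by (rule dist_triangle)
          then have "x + T *\<^sub>R \<nu> \<in> C"
            using True chart[of x] r_pos T by (auto simp: C_def shift dist_norm T_def)
          moreover have "ennreal ((f n x)\<^sup>2) \<le> 2 * ennreal ((f n (x + T *\<^sub>R \<nu>) - f n x)\<^sup>2) + 2 * ennreal ((f n (x + T *\<^sub>R \<nu>))\<^sup>2)"
            using ennreal_leI[OF square_diff_le[of "f n x" 0 "f n (x + T *\<^sub>R \<nu>)"]]
            by (simp add: ennreal_plus ennreal_mult power2_commute)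
          ultimately show ?thesis using True by simp
        qed simp
      qed
      also have "\<dots> = 2 * square_mass ?A (\<lambda>x. f n (x + T *\<^sub>R \<nu>) - f n x) +
          2 * (\<integral>\<^sup>+x. indicator C (x + T *\<^sub>R \<nu>) * ennreal ((f n (x + T *\<^sub>R \<nu>))\<^sup>2) \<partial>lborel)"
        by (subst nn_integral_add) (measurable, simp add: nn_integral_cmult)
      also have "(\<integral>\<^sup>+x. indicator C (x + T *\<^sub>R \<nu>) * ennreal ((f n (x + T *\<^sub>R \<nu>))\<^sup>2) \<partial>lborel) = square_mass C (f n)"
        by (rule nn_integral_lborel_shift) measurable
      finally show ?case using inc by (meson add_right_mono mult_left_mono order_trans zero_le)
    qed
    have "(\<lambda>n. ennreal (step_const * r\<^sup>2 * g n)) \<longlonglongrightarrow> ennreal (step_const * r\<^sup>2 * 0)"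
      by (intro tendsto_ennrealI tendsto_intros g_lim)
    then have "(\<lambda>n. 2 * ennreal (step_const * r\<^sup>2 * g n) + 2 * square_mass C (f n)) \<longlonglongrightarrow>
        2 * ennreal (step_const * r\<^sup>2 * 0) + 2 * 0"
      using C unfolding vanishes_on_def by (intro tendsto_add ennreal_tendsto_cmult) auto
    then show "(\<lambda>n. 2 * ennreal (step_const * r\<^sup>2 * g n) + 2 * square_mass C (f n)) \<longlonglongrightarrow> 0" by simp
  qed
qed

text \<open>
  The starting point of the propagation. The hypothesis \<open>bound\<close> is what the kernel averages \<open>w n\<close>
  satisfy: averages of \<open>f n\<close> near \<open>x\<close> differ from \<open>m\<close> by at most the mean oscillation. Integrated
  over the patch, the powers of \<open>\<epsilon>\<close> cancel against those of \<open>boundary_oscillation\<close>.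
\<close>

lemma vanishes_on_ball_of_trace:
  fixes w :: "nat \<Rightarrow> 'a \<Rightarrow> real"
  assumes \<alpha>: "0 < \<alpha>" and c: "0 \<le> c"
    and w [measurable]: "\<And>n. w n \<in> borel_measurable borel"
    and w_lim: "(\<lambda>n. \<integral>\<^sup>+x. indicator (graph \<inter> ball p (r / (128 * \<Lambda>))) x * ennreal ((w n x)\<^sup>2)
        \<partial>hausdorff_measure (DIM('a) - 1)) \<longlonglongrightarrow> 0"
    and bound: "\<forall>\<^sub>F n in sequentially. \<forall>m. \<forall>x\<in>graph \<inter> ball p (r / (128 * \<Lambda>)). ennreal \<bar>m\<bar> \<le> ennreal \<bar>w n x\<bar> +
      ennreal (c / \<epsilon> n ^ DIM('a)) *
        near_oscillation \<Omega> (\<alpha> * \<epsilon> n) (f n) m x"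
  shows "\<exists>q \<rho>. 0 < \<rho> \<and> ball q \<rho> \<subseteq> \<Omega> \<and> vanishes_on (ball q \<rho>)"
proof -
  define \<tau> where "\<tau> = r / (64 * \<Lambda>)"
  define q where "q = p + (r / 4) *\<^sub>R \<nu>"
  have \<tau>: "0 < \<tau>" "64 * (\<Lambda> * \<tau>) = r" "64 * \<tau> \<le> r" "r / (128 * \<Lambda>) = \<tau> / 2"
  proof -
    show "0 < \<tau>" "64 * (\<Lambda> * \<tau>) = r" "r / (128 * \<Lambda>) = \<tau> / 2" using r_pos \<Lambda>_ge_1 by (auto simp: \<tau>_def)
    then show "64 * \<tau> \<le> r" using mult_right_mono[OF \<Lambda>_ge_1, of \<tau>] by linarith
  qed
  let ?H = "hausdorff_measure (DIM('a) - 1) :: 'a measure"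
  define P where "P = graph \<inter> ball p (\<tau> / 2)"
  have P [measurable]: "P \<in> sets borel" using closed_graph by (auto simp: P_def)
  define V where "V = measure ?H P"
  have "emeasure ?H P \<le> ennreal (unit_ball_vol (real (DIM('a) - 1)) * ((8 * \<Lambda>) ^ DIM('a) * \<tau> ^ (DIM('a) - 1)))"
    using \<tau> P by (intro emeasure_hausdorff_graph_le[where y = p]) (auto simp: P_def)
  then have eV: "emeasure ?H P = ennreal V"
    unfolding V_def by (intro emeasure_eq_ennreal_measure) (auto simp: top_unique)
  have "0 < emeasure ?H P"
    using hausdorff_graph_pos[OF \<phi>_p, of "\<tau> / 2"] \<tau> P by (simp add: emeasure_hausdorff_measure P_def)
  then have V: "0 < V" unfolding eV by simp
  obtain \<epsilon>0 K where \<epsilon>0: "0 < \<epsilon>0" and K: "0 < K" and osc: "\<forall>\<epsilon> f g. 0 < \<epsilon> \<longrightarrow> \<epsilon> \<le> \<epsilon>0 \<longrightarrow> f \<in> borel_measurable borel \<longrightarrow> 0 < g \<longrightarrow>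
    increments_le \<Omega> \<epsilon> g f \<longrightarrow>
    (\<exists>m. square_mass (ball q (4 * \<tau>)) (\<lambda>y. f y - m) \<le> ennreal (K * g) \<and>
      trace_oscillation \<Omega> P (\<alpha> * \<epsilon>) f m \<le> ennreal (K * (\<epsilon> ^ DIM('a) * sqrt g)))"
    using boundary_oscillation[OF \<alpha>, folded \<tau>_def q_def, folded P_def]
    by (elim exE conjE) (rule that)
  let ?Q = "\<lambda>n m. square_mass (ball q (4 * \<tau>)) (\<lambda>y. f n y - m) \<le> ennreal (K * g n) \<and>
      trace_oscillation \<Omega> P (\<alpha> * \<epsilon> n) (f n) m \<le> ennreal (K * (\<epsilon> n ^ DIM('a) * sqrt (g n)))"
  have "\<forall>n. \<exists>m. \<epsilon> n \<le> \<epsilon>0 \<longrightarrow> ?Q n m"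
    using osc[rule_format, OF \<epsilon>_pos _ f g_pos increments] by meson
  then have "\<exists>m. \<forall>n. \<epsilon> n \<le> \<epsilon>0 \<longrightarrow> ?Q n (m n)" by (rule choice)
  then obtain m where "\<forall>n. \<epsilon> n \<le> \<epsilon>0 \<longrightarrow> ?Q n (m n)" ..
  then have m: "\<epsilon> n \<le> \<epsilon>0 \<Longrightarrow> ?Q n (m n)" for n by (elim allE impE)
  have trace: "\<forall>\<^sub>F n in sequentially. \<bar>m n\<bar> * V \<le> (V + 1) * a + c * K * sqrt (g n)" if a: "0 < a" for a
  proof -
    have "\<forall>\<^sub>F n in sequentially. (\<integral>\<^sup>+x. indicator P x * ennreal ((w n x)\<^sup>2) \<partial>?H) < ennreal (1 * a\<^sup>2)"
      using a w_lim unfolding P_def \<tau>(4) by (intro order_tendstoD(2)) auto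
    then show ?thesis using eventually_\<epsilon>_le[OF \<epsilon>0] bound
    proof eventually_elim
      case (elim n)
      have L1: "(\<integral>\<^sup>+x. indicator P x * ennreal \<bar>w n x\<bar> \<partial>?H) \<le> ennreal ((V + 1) * a)"
        using elim(1) a V eV by (intro nn_integral_abs_le) (auto simp: less_imp_le)
      have "ennreal (\<bar>m n\<bar> * V) = (\<integral>\<^sup>+x. ennreal \<bar>m n\<bar> * indicator P x \<partial>?H)"
        using V by (subst nn_integral_cmult_indicator) (simp_all only: eV ennreal_mult abs_ge_zero less_imp_le P sets_hausdorff_measure)
      also have "\<dots> \<le> (\<integral>\<^sup>+x. indicator P x * ennreal \<bar>w n x\<bar> + ennreal (c / \<epsilon> n ^ DIM('a)) *
        (\<integral>\<^sup>+y. indicator P x * indicator \<Omega> y * indicator {..\<alpha> * \<epsilon> n} (dist x y) * ennreal \<bar>f n y - m n\<bar> \<partial>lborel) \<partial>?H)"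
      proof (rule nn_integral_mono)
        fix x
        show "ennreal \<bar>m n\<bar> * indicator P x \<le> indicator P x * ennreal \<bar>w n x\<bar> + ennreal (c / \<epsilon> n ^ DIM('a)) *
          (\<integral>\<^sup>+y. indicator P x * indicator \<Omega> y * indicator {..\<alpha> * \<epsilon> n} (dist x y) * ennreal \<bar>f n y - m n\<bar> \<partial>lborel)"
        proof (cases "x \<in> P")
          case True
          then have "x \<in> graph \<inter> ball p (r / (128 * \<Lambda>))" by (simp only: P_def \<tau>(4))
          from elim(3)[rule_format, OF this, of "m n"] True show ?thesis by simp
        qed simp
      qed
      also have "\<dots> = (\<integral>\<^sup>+x. indicator P x * ennreal \<bar>w n x\<bar> \<partial>?H) + ennreal (c / \<epsilon> n ^ DIM('a)) *
        trace_oscillation \<Omega> P (\<alpha> * \<epsilon> n) (f n) (m n)"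
        by (subst nn_integral_add) (measurable, subst nn_integral_cmult, measurable)
      also have "\<dots> \<le> ennreal ((V + 1) * a) + ennreal (c / \<epsilon> n ^ DIM('a)) * ennreal (K * (\<epsilon> n ^ DIM('a) * sqrt (g n)))"
        using m[OF elim(2)] by (intro add_mono L1 mult_left_mono) auto
      also have "\<dots> = ennreal ((V + 1) * a + c * K * sqrt (g n))"
        using a V c K g_pos[of n] \<epsilon>_pos[of n] by (simp add: mult_ac flip: ennreal_mult ennreal_plus)
      finally show ?case using a V c K g_pos[of n] by (subst (asm) ennreal_le_iff) auto
    qed
  qed
  have "m \<longlonglongrightarrow> 0"
  proof (rule LIMSEQ_I)
    fix e :: real assume e: "0 < e"
    \<comment> \<open>The parameter of \<open>nn_integral_abs_le\<close> for which the contribution of \<open>w n\<close> is half of the tolerance.\<close>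
    define a where "a = e * V / (2 * (V + 1))"
    have a: "0 < a" "(V + 1) * a = e * V / 2" using e V by (auto simp: a_def field_simps)
    have "(\<lambda>n. c * K * sqrt (g n)) \<longlonglongrightarrow> c * K * sqrt 0" by (intro tendsto_intros g_lim)
    then have "\<forall>\<^sub>F n in sequentially. c * K * sqrt (g n) < e * V / 2"
      using e V by (intro order_tendstoD(2)) auto
    then have "\<forall>\<^sub>F n in sequentially. norm (m n - 0) < e"
      using trace[OF a(1)]
    proof eventually_elim
      case (elim n)
      then have "\<bar>m n\<bar> * V < e * V" using a by linarith
      then show ?case using V by simp
    qed
    then show "\<exists>N. \<forall>n\<ge>N. norm (m n - 0) < e" by (simp add: eventually_sequentially)
  qed
  then have "(\<lambda>n. ennreal ((m n)\<^sup>2)) \<longlonglongrightarrow> ennreal (0\<^sup>2)" by (intro tendsto_ennrealI tendsto_power)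
  then have m0: "(\<lambda>n. ennreal ((m n)\<^sup>2)) \<longlonglongrightarrow> 0" by simp
  have "vanishes_on (ball q (4 * \<tau>))"
  proof (rule vanishes_on_ball_of_mean[OF _ m0])
    show "\<forall>\<^sub>F n in sequentially. square_mass (ball q (4 * \<tau>)) (\<lambda>y. f n y - m n) \<le> ennreal (K * g n)"
      using eventually_\<epsilon>_le[OF \<epsilon>0] by eventually_elim (rule conjunct1[OF m])
  qed
  moreover have "ball q (4 * \<tau>) \<subseteq> \<Omega>"
    unfolding q_def using \<tau> r_pos \<phi>_p by (intro above_in_domain) auto
  ultimately show ?thesis using \<tau> by (intro exI[of _ q] exI[of _ "4 * \<tau>"]) auto
qed

end

text \<open>
  The height is the difference between the coordinate along \<open>\<nu>\<close> and the value of the graph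
  function at the orthogonal projection, which does not increase distances.
\<close>

lemma lipschitz_boundary_chart:
  fixes \<Omega> :: "'a::euclidean_space set"
  assumes "open \<Omega>" "lipschitz_boundary \<Omega>" "p \<in> frontier \<Omega>"
  shows "\<exists>\<phi> \<nu> \<Lambda> r. boundary_chart \<phi> \<nu> \<Lambda> \<Omega> p r"
proof -
  obtain r \<nu> L \<gamma> where r: "0 < r" and \<nu>: "norm \<nu> = 1" and lip: "L-lipschitz_on {w. w \<bullet> \<nu> = 0} \<gamma>"
    and eq: "\<Omega> \<inter> ball p r = {x \<in> ball p r. \<gamma> (x - (x \<bullet> \<nu>) *\<^sub>R \<nu>) < x \<bullet> \<nu>}"
    using assms(2)[unfolded lipschitz_boundary_def, rule_format, OF assms(3)]
    by (elim exE conjE) (rule that)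
  have \<nu>\<nu>: "\<nu> \<bullet> \<nu> = 1" using \<nu> by (simp add: norm_eq_1)
  define pr where "pr x = x - (x \<bullet> \<nu>) *\<^sub>R \<nu>" for x :: 'a
  define \<phi> where "\<phi> x = x \<bullet> \<nu> - \<gamma> (pr x)" for x
  have pr0: "pr x \<bullet> \<nu> = 0" for x by (simp add: pr_def inner_diff_left \<nu>\<nu>)
  have L: "0 \<le> L" using lip by (rule lipschitz_on_nonneg)
  have "height_function \<phi> \<nu> (1 + L)"
  proof
    fix x y :: 'a and t
    have "\<bar>\<gamma> (pr x) - \<gamma> (pr y)\<bar> \<le> L * norm (pr x - pr y)"
      using lipschitz_onD[OF lip, of "pr x" "pr y"] pr0 by (simp add: dist_norm)
    also have "norm (pr x - pr y) \<le> norm (x - y)"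
    proof (rule power2_le_imp_le)
      have "pr x - pr y = pr (x - y)" by (simp add: pr_def inner_diff_left algebra_simps)
      moreover have "norm (pr z) ^ 2 = norm z ^ 2 - (z \<bullet> \<nu>)\<^sup>2" for z
      proof -
        have "pr z \<bullet> pr z = pr z \<bullet> z - (z \<bullet> \<nu>) * (pr z \<bullet> \<nu>)"
          by (subst (2) pr_def) (simp only: inner_diff_right inner_scaleR_right)
        also have "\<dots> = z \<bullet> z - (z \<bullet> \<nu>) * (\<nu> \<bullet> z)"
          unfolding pr0 by (simp only: pr_def inner_diff_left inner_scaleR_left)
        finally show ?thesis 
          unfolding power2_norm_eq_inner power2_eq_square[of "z \<bullet> \<nu>"] inner_commute[of \<nu> z] .
      qed
      ultimately show "(norm (pr x - pr y))\<^sup>2 \<le> (norm (x - y))\<^sup>2" by simp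
    qed simp
    finally have "\<bar>\<gamma> (pr x) - \<gamma> (pr y)\<bar> \<le> L * norm (x - y)" using L by (simp add: mult_left_mono)
    moreover have "\<bar>x \<bullet> \<nu> - y \<bullet> \<nu>\<bar> \<le> norm (x - y)"
      using Cauchy_Schwarz_ineq2[of "x - y" \<nu>] \<nu> by (simp add: inner_diff_left)
    ultimately show "\<bar>\<phi> x - \<phi> y\<bar> \<le> (1 + L) * norm (x - y)"
      unfolding \<phi>_def by (simp add: algebra_simps)
    have "pr (x + t *\<^sub>R \<nu>) = pr x" by (simp add: pr_def inner_add_left \<nu>\<nu> algebra_simps)
    then show "\<phi> (x + t *\<^sub>R \<nu>) = \<phi> x + t" by (simp add: \<phi>_def inner_add_left \<nu>\<nu>)
  qed (rule \<nu>)
  moreover have "x \<in> \<Omega> \<longleftrightarrow> 0 < \<phi> x" if "x \<in> ball p r" for x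
  proof -
    have "x \<in> \<Omega> \<inter> ball p r \<longleftrightarrow> x \<in> {x \<in> ball p r. \<gamma> (x - (x \<bullet> \<nu>) *\<^sub>R \<nu>) < x \<bullet> \<nu>}" by (simp only: eq)
    then show ?thesis using that by (simp add: \<phi>_def pr_def)
  qed
  ultimately have "boundary_chart \<phi> \<nu> (1 + L) \<Omega> p r"
    using assms r by (simp add: boundary_chart_def boundary_chart_axioms_def)
  then show ?thesis by blast
qed

context vanishing_increments begin

lemma vanishes_on_domain:
  assumes \<Omega>: "bounded_lipschitz_domain \<Omega>" and start: "0 < \<rho>" "ball q \<rho> \<subseteq> \<Omega>" "vanishes_on (ball q \<rho>)"
  shows "vanishes_on \<Omega>"
proof -
  have conn: "connected \<Omega>" and bdd: "bounded \<Omega>" and lip: "lipschitz_boundary \<Omega>"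
    using \<Omega> by (auto simp: bounded_lipschitz_domain_def)
  note compact = vanishes_on_compact[OF conn start]
  have "\<exists>\<rho>>0. vanishes_on (\<Omega> \<inter> ball x \<rho>)" if "x \<in> frontier \<Omega>" for x
  proof -
    obtain \<phi> \<nu> \<Lambda> r where "boundary_chart \<phi> \<nu> \<Lambda> \<Omega> x r"
      using lipschitz_boundary_chart[OF open_\<Omega> lip \<open>x \<in> frontier \<Omega>\<close>] by blast
    then interpret chart_sequence \<phi> \<nu> \<Lambda> \<Omega> x r f \<epsilon> g
      using vanishing_increments_axioms by (simp add: chart_sequence_def)
    show ?thesis using vanishes_near_boundary[OF compact] r_pos by (intro exI[of _ "r / 4"]) simp
  qed
  then obtain \<rho>' where \<rho>': "\<And>x. x \<in> frontier \<Omega> \<Longrightarrow> 0 < \<rho>' x"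
      "\<And>x. x \<in> frontier \<Omega> \<Longrightarrow> vanishes_on (\<Omega> \<inter> ball x (\<rho>' x))" by metis
  have cf: "compact (frontier \<Omega>)" using bdd by (rule compact_frontier_bounded)
  then obtain I where I: "I \<subseteq> frontier \<Omega>" "finite I" "frontier \<Omega> \<subseteq> (\<Union>x\<in>I. ball x (\<rho>' x))"
    using compact_ball_cover[OF cf, of \<rho>'] \<rho>'(1) by blast
  define C where "C = closure \<Omega> - (\<Union>x\<in>I. ball x (\<rho>' x))"
  have "compact C"
    unfolding C_def using bdd by (intro compact_diff) (auto simp: compact_closure)
  moreover have "C \<subseteq> \<Omega>"
    using I(3) open_\<Omega> by (auto simp: C_def frontier_def interior_open)
  ultimately have "vanishes_on C" by (rule compact)
  define B where "B x = (case x of None \<Rightarrow> C | Some x \<Rightarrow> \<Omega> \<inter> ball x (\<rho>' x))" for x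
  show ?thesis
  proof (rule vanishes_on_cover[of "insert None (Some ` I)" B])
    show "\<And>i. i \<in> insert None (Some ` I) \<Longrightarrow> B i \<in> sets borel"
      using borel_compact[OF \<open>compact C\<close>] borel_open[OF open_\<Omega>] by (auto simp: B_def)
    show "\<And>i. i \<in> insert None (Some ` I) \<Longrightarrow> vanishes_on (B i)"
      using \<open>vanishes_on C\<close> \<rho>'(2) I(1) by (auto simp: B_def)
    show "\<Omega> \<subseteq> (\<Union>i\<in>insert None (Some ` I). B i)"
      using closure_subset[of \<Omega>] by (auto simp: B_def C_def)
  qed (use I in auto)
qed

end

section \<open>Test functions separate integrable functions\<close>

lemma Ck_fun_Suc_imp: "Ck_fun (Suc k) f \<Longrightarrow> Ck_fun k f"
proof (induction k arbitrary: f)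
  case 0
  then show ?case
    by (auto simp: continuous_on_eq_continuous_at intro: differentiable_imp_continuous_within)
qed auto

lemma Ck_fun_const: "Ck_fun k (\<lambda>x. c)"
proof (induction k arbitrary: c)
  case (Suc k)
  then show ?case by (auto simp: frechet_derivative_const)
qed simp

lemma Ck_fun_add: "Ck_fun k f \<Longrightarrow> Ck_fun k g \<Longrightarrow> Ck_fun k (\<lambda>x. f x + g x)"
proof (induction k arbitrary: f g)
  case (Suc k)
  have fd: "f differentiable (at x)" and gd: "g differentiable (at x)" for x using Suc.prems by auto
  have "frechet_derivative (\<lambda>x. f x + g x) (at x) v =
      frechet_derivative f (at x) v + frechet_derivative g (at x) v" for x v
    by (rule fun_cong[OF frechet_derivative_at, symmetric])
      (intro has_derivative_add frechet_derivative_works[THEN iffD1] fd gd)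
  moreover have "Ck_fun k (\<lambda>x. frechet_derivative f (at x) v + frechet_derivative g (at x) v)" for v
    using Suc.prems by (intro Suc.IH) auto
  ultimately show ?case using fd gd by simp
qed (simp add: continuous_on_add)

lemma Ck_fun_mult: "Ck_fun k f \<Longrightarrow> Ck_fun k g \<Longrightarrow> Ck_fun k (\<lambda>x. f x * g x)"
proof (induction k arbitrary: f g)
  case (Suc k)
  have fd: "f differentiable (at x)" and gd: "g differentiable (at x)" for x using Suc.prems by auto
  have "frechet_derivative (\<lambda>x. f x * g x) (at x) v =
      f x * frechet_derivative g (at x) v + frechet_derivative f (at x) v * g x" for x v
    by (rule fun_cong[OF frechet_derivative_at, symmetric])
      (intro has_derivative_mult frechet_derivative_works[THEN iffD1] fd gd)
  moreover have "Ck_fun k (\<lambda>x. f x * frechet_derivative g (at x) v + frechet_derivative f (at x) v * g x)" for v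
    using Suc.prems by (intro Ck_fun_add Suc.IH) (auto intro: Ck_fun_Suc_imp)
  ultimately show ?case using fd gd by simp
qed (simp add: continuous_on_mult)

lemma Ck_fun_prod: "finite I \<Longrightarrow> (\<And>i. i \<in> I \<Longrightarrow> Ck_fun k (f i)) \<Longrightarrow> Ck_fun k (\<lambda>x. \<Prod>i\<in>I. f i x)"
  by (induction I rule: finite_induct) (auto simp: Ck_fun_const intro: Ck_fun_mult)

text \<open>
  The powers of \<open>1 / t\<close> make the family closed under differentiation up to linear combinations, so
  that smoothness follows by one induction.
\<close>

definition flat_exp :: "nat \<Rightarrow> real \<Rightarrow> real" where
  "flat_exp m t = (if t \<le> 0 then 0 else (1 / t) ^ m * exp (- 1 / t))"

lemma flat_exp_tendsto_0: "(flat_exp m \<longlongrightarrow> 0) (at 0)"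
proof -
  have "((\<lambda>t. (inverse t) ^ m / exp (inverse t)) \<longlongrightarrow> (0::real)) (at_right 0)"
    by (rule filterlim_compose[OF tendsto_power_div_exp_0 filterlim_inverse_at_top_right])
  moreover have "\<forall>\<^sub>F t::real in at_right 0. (inverse t) ^ m / exp (inverse t) = flat_exp m t"
    unfolding eventually_at_right_field
    by (intro exI[of _ 1]) (auto simp: flat_exp_def inverse_eq_divide exp_minus field_simps)
  ultimately have "(flat_exp m \<longlongrightarrow> 0) (at_right 0)" by (rule Lim_transform_eventually)
  moreover have "(flat_exp m \<longlongrightarrow> 0) (at_left 0)"
    by (rule Lim_transform_eventually[OF tendsto_const])
      (auto simp: eventually_at_left_field flat_exp_def intro!: exI[of _ "-1"])
  ultimately show ?thesis by (simp add: filterlim_split_at)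
qed

lemma flat_exp_derivative:
  "(flat_exp m has_real_derivative (flat_exp (m + 2) t - real m * flat_exp (m + 1) t)) (at t)"
proof (cases t "0 :: real" rule: linorder_cases)
  case less
  have "((\<lambda>t. 0) has_real_derivative 0) (at t)" by simp
  then have "(flat_exp m has_real_derivative 0) (at t)"
    by (rule has_field_derivative_transform_within_open[where S = "{..<0}"]) (use less in \<open>auto simp: flat_exp_def\<close>)
  then show ?thesis using less by (simp add: flat_exp_def)
next
  case greater
  have "((\<lambda>t. (1 / t) ^ m * exp (- 1 / t)) has_real_derivative
      (flat_exp (m + 2) t - real m * flat_exp (m + 1) t)) (at t)"
  proof -
    have "((\<lambda>t. (1 / t) ^ m * exp (- 1 / t)) has_real_derivative
      (real m * (1 / t) ^ (m - 1) * (- 1 / t\<^sup>2)) * exp (- 1 / t) + (1 / t) ^ m * (exp (- 1 / t) * (1 / t\<^sup>2))) (at t)"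
    proof -
      have "((\<lambda>t. 1 / t) has_real_derivative (- 1 / t\<^sup>2)) (at t)"
        using greater by (auto intro!: derivative_eq_intros simp: power2_eq_square)
      moreover have "((\<lambda>t. exp (- 1 / t)) has_real_derivative (exp (- 1 / t) * (1 / t\<^sup>2))) (at t)"
        using greater by (auto intro!: derivative_eq_intros simp: power2_eq_square)
      ultimately show ?thesis
        by (intro DERIV_cong[OF DERIV_mult[OF DERIV_power]]) (auto simp: mult_ac)
    qed
    moreover have "real m * (1 / t) ^ (m - 1) * (- 1 / t\<^sup>2) = - (real m * (1 / t) ^ (m + 1))"
      by (cases m) (auto simp: power2_eq_square power_divide)
    moreover have "flat_exp (m + 2) t - real m * flat_exp (m + 1) t =
        - (real m * (1 / t) ^ (m + 1)) * exp (- 1 / t) + (1 / t) ^ m * (exp (- 1 / t) * (1 / t\<^sup>2))"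
      using greater by (simp add: flat_exp_def power2_eq_square)
    ultimately show ?thesis by (simp only:)
  qed
  then show ?thesis
    by (rule has_field_derivative_transform_within_open[where S = "{0<..}"]) (use greater in \<open>auto simp: flat_exp_def\<close>)
next
  case equal
  have "((\<lambda>h. (flat_exp m h - flat_exp m 0) / (h - 0)) \<longlongrightarrow> 0) (at 0)"
    by (rule Lim_transform_eventually[OF flat_exp_tendsto_0[of "m + 1"]])
      (auto simp: flat_exp_def eventually_at_filter)
  then have "(flat_exp m has_real_derivative 0) (at 0)"
    unfolding has_field_derivative_iff by simp
  then show ?thesis using equal by (simp add: flat_exp_def)
qed

lemma Ck_fun_flat_exp:
  fixes w :: "'a::euclidean_space"
  shows "Ck_fun k (\<lambda>x. flat_exp m (x \<bullet> w + \<alpha>))"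
proof (induction k arbitrary: m)
  case 0
  have "isCont (flat_exp m) t" for t using flat_exp_derivative by (rule DERIV_isCont)
  then have "continuous_on UNIV (flat_exp m)" by (simp add: continuous_on_eq_continuous_at)
  then have "continuous_on UNIV (\<lambda>x. flat_exp m (x \<bullet> w + \<alpha>))"
    by (rule continuous_on_compose2) (auto intro!: continuous_intros)
  then show ?case by simp
next
  case (Suc k)
  have D: "((\<lambda>x. flat_exp m (x \<bullet> w + \<alpha>)) has_derivative
      (\<lambda>v. (flat_exp (m + 2) (x \<bullet> w + \<alpha>) - real m * flat_exp (m + 1) (x \<bullet> w + \<alpha>)) * (v \<bullet> w))) (at x)" for x
  proof -
    have "((\<lambda>x. x \<bullet> w + \<alpha>) has_derivative (\<lambda>v. v \<bullet> w)) (at x)"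
      by (auto intro!: derivative_eq_intros)
    from has_derivative_compose[OF this flat_exp_derivative[of m, unfolded has_field_derivative_def]]
    show ?thesis by simp
  qed
  have "frechet_derivative (\<lambda>x. flat_exp m (x \<bullet> w + \<alpha>)) (at x) v =
      (flat_exp (m + 2) (x \<bullet> w + \<alpha>) + (- real m) * flat_exp (m + 1) (x \<bullet> w + \<alpha>)) * (v \<bullet> w)" for x v
    using fun_cong[OF frechet_derivative_at[OF D[of x], symmetric], of v] by simp
  moreover have "Ck_fun k (\<lambda>x. (flat_exp (m + 2) (x \<bullet> w + \<alpha>) + (- real m) * flat_exp (m + 1) (x \<bullet> w + \<alpha>)) * (v \<bullet> w))" for v
    by (intro Ck_fun_mult Ck_fun_add Ck_fun_const Suc.IH)
  moreover have "(\<lambda>x. flat_exp m (x \<bullet> w + \<alpha>)) differentiable (at x)" for x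
    using D unfolding differentiable_def by blast
  ultimately show ?case by simp
qed

text \<open>
  The steepness \<open>N + 1\<close> makes these functions increase to the indicator function of the box.
\<close>

definition box_bump :: "'a::euclidean_space \<Rightarrow> 'a \<Rightarrow> nat \<Rightarrow> 'a \<Rightarrow> real" where
  "box_bump a b N x = (\<Prod>i\<in>Basis. flat_exp 0 (x \<bullet> (real (Suc N) *\<^sub>R i) + - real (Suc N) * (a \<bullet> i)) *
      flat_exp 0 (x \<bullet> (- real (Suc N) *\<^sub>R i) + real (Suc N) * (b \<bullet> i)))"

lemma flat_exp_0_bounds: "0 \<le> flat_exp 0 t" "flat_exp 0 t \<le> 1"
  by (auto simp: flat_exp_def)

lemma box_bump_bounds: "0 \<le> box_bump a b N x" "box_bump a b N x \<le> 1"
  unfolding box_bump_def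
  by (auto intro!: prod_nonneg prod_le_1 mult_nonneg_nonneg mult_le_one simp: flat_exp_0_bounds)

lemma box_bump_outside: "x \<notin> box a b \<Longrightarrow> box_bump a b N x = 0"
proof -
  assume "x \<notin> box a b"
  then obtain i where i: "i \<in> Basis" "x \<bullet> i \<le> a \<bullet> i \<or> b \<bullet> i \<le> x \<bullet> i"
    by (auto simp: mem_box not_less)
  have "x \<bullet> i \<le> a \<bullet> i \<Longrightarrow> real (Suc N) * (x \<bullet> i) \<le> real (Suc N) * (a \<bullet> i)"
    "b \<bullet> i \<le> x \<bullet> i \<Longrightarrow> real (Suc N) * (b \<bullet> i) \<le> real (Suc N) * (x \<bullet> i)"
    by (intro mult_left_mono; simp)+
  then have "flat_exp 0 (x \<bullet> (real (Suc N) *\<^sub>R i) + - real (Suc N) * (a \<bullet> i)) *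
      flat_exp 0 (x \<bullet> (- real (Suc N) *\<^sub>R i) + real (Suc N) * (b \<bullet> i)) = 0"
    using i(2) by (auto simp: flat_exp_def simp del: of_nat_Suc)
  then show ?thesis using i(1) unfolding box_bump_def by (intro prod_zero) auto
qed

lemma box_bump_limit: "(\<lambda>N. box_bump a b N x) \<longlonglongrightarrow> indicator (box a b) x"
proof (cases "x \<in> box a b")
  case True
  have lim: "(\<lambda>N. flat_exp 0 (real (Suc N) * s)) \<longlonglongrightarrow> 1" if "0 < s" for s
  proof -
    have "(\<lambda>N. exp (- (1 / s) * inverse (real (Suc N)))) \<longlonglongrightarrow> exp (- (1 / s) * 0)"
      by (intro tendsto_intros LIMSEQ_inverse_real_of_nat)
    moreover have "exp (- (1 / s) * inverse (real (Suc N))) = flat_exp 0 (real (Suc N) * s)" for N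
    proof -
      have "0 < real (Suc N) * s" using that by (intro mult_pos_pos) auto
      then show ?thesis by (simp add: flat_exp_def inverse_eq_divide mult.commute del: of_nat_Suc)
    qed
    ultimately show ?thesis by simp
  qed
  have eq: "box_bump a b N x = (\<Prod>i\<in>Basis. flat_exp 0 (real (Suc N) * (x \<bullet> i - a \<bullet> i)) *
      flat_exp 0 (real (Suc N) * (b \<bullet> i - x \<bullet> i)))" for N
    unfolding box_bump_def by (intro prod.cong refl) (simp add: algebra_simps)
  have "(\<lambda>N. box_bump a b N x) \<longlonglongrightarrow> (\<Prod>i\<in>(Basis::'a set). 1 * 1)"
    unfolding eq using True by (intro tendsto_prod tendsto_mult lim) (auto simp: mem_box)
  then show ?thesis using True by simp
qed (simp add: box_bump_outside)

lemma box_bump_test_function: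
  assumes "cbox a b \<subseteq> \<Omega>"
  shows "box_bump a b N \<in> test_functions \<Omega>"
proof -
  have sub: "closure {x. box_bump a b N x \<noteq> 0} \<subseteq> cbox a b"
  proof (rule closure_minimal)
    show "{x. box_bump a b N x \<noteq> 0} \<subseteq> cbox a b"
      using box_bump_outside[of _ a b N] box_subset_cbox[of a b] by blast
  qed (rule closed_cbox)
  have "compact (closure {x. box_bump a b N x \<noteq> 0})"
    using sub by (meson bounded_cbox bounded_closure bounded_subset closed_closure compact_eq_bounded_closed)
  moreover have "Ck_fun k (box_bump a b N)" for k
    unfolding box_bump_def[abs_def] by (intro Ck_fun_prod Ck_fun_mult Ck_fun_flat_exp) auto
  ultimately show ?thesis using sub assms unfolding test_functions_def by blast
qed

lemma integral_lebesgue_on_borel: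
  fixes F :: "'a::euclidean_space \<Rightarrow> real"
  assumes "F \<in> borel_measurable borel" "S \<in> sets borel"
  shows "(\<integral>x. F x \<partial>lebesgue_on S) = (\<integral>x. indicator S x * F x \<partial>lborel)"
  using assms by (simp add: integral_restrict_space integral_completion)

lemma ex_borel_representative:
  fixes u :: "'a::euclidean_space \<Rightarrow> real"
  assumes S: "S \<in> sets borel" and u: "u \<in> borel_measurable (lebesgue_on S)"
  shows "\<exists>f. f \<in> borel_measurable borel \<and> (AE x in lebesgue_on S. u x = f x)"
proof -
  have S': "S \<in> sets lebesgue" using S by simp
  have "(\<lambda>x. if x \<in> S then u x else 0) \<in> borel_measurable lebesgue"
    using u S' by (simp add: borel_measurable_if)
  then obtain f where f: "f \<in> borel_measurable lborel" "AE x in lborel. (if x \<in> S then u x else 0) = f x"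
    using completion_ex_borel_measurable_real by blast
  have "AE x in lebesgue. (if x \<in> S then u x else 0) = f x" using f(2) by (rule AE_completion)
  then have "AE x in lebesgue_on S. u x = f x"
    unfolding AE_restrict_space_iff[of S lebesgue, simplified, OF S'] by eventually_elim auto
  then show ?thesis using f(1) by auto
qed

text \<open>
  Bump functions approximate the indicator function of a box, so \<open>h\<close> has integral \<open>0\<close> over every
  box whose closure lies in \<open>\<Omega>\<close>. Boxes form an intersection-stable generator of the Borel sets, so
  the same holds for all Borel sets inside such a box, and countably many of these boxes exhaust
  \<open>\<Omega>\<close> up to a null set.
\<close>

lemma AE_zero_of_test_functions:
  fixes h :: "'a::euclidean_space \<Rightarrow> real"
  assumes \<Omega>: "open \<Omega>" and h: "integrable (lebesgue_on \<Omega>) h"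
    and zero: "\<And>\<phi>. \<phi> \<in> test_functions \<Omega> \<Longrightarrow> (\<integral>x. h x * \<phi> x \<partial>lebesgue_on \<Omega>) = 0"
  shows "AE x in lebesgue_on \<Omega>. h x = 0"
proof -
  have \<Omega>b [measurable]: "\<Omega> \<in> sets borel" using \<Omega> by simp
  obtain F where F [measurable]: "F \<in> borel_measurable borel" and FAE: "AE x in lebesgue_on \<Omega>. h x = F x"
    using ex_borel_representative[OF \<Omega>b borel_measurable_integrable[OF h]] by blast
  define H where "H x = indicator \<Omega> x * F x" for x
  have H [measurable]: "H \<in> borel_measurable borel" unfolding H_def by measurable
  have Hint: "integrable lborel H"
  proof -
    have "integrable (lebesgue_on \<Omega>) F"
      by (rule integrable_cong_AE_imp[OF h measurable_restrict_space1[OF measurable_completion]])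
        (use FAE in \<open>auto elim: eventually_mono\<close>)
    then have "integrable lebesgue (\<lambda>x. indicator \<Omega> x * F x)"
      by (simp add: integrable_restrict_space)
    then show ?thesis unfolding H_def by (subst (asm) integrable_completion) auto
  qed
  have boxes: "(\<integral>x. H x * indicator (box a b) x \<partial>lborel) = 0" if "cbox a b \<subseteq> \<Omega>" for a b
  proof -
    have meas [measurable]: "box_bump a b N \<in> borel_measurable borel" for N
    proof -
      have "Ck_fun 0 (box_bump a b N)"
        using box_bump_test_function[OF that, of N] unfolding test_functions_def by blast
      then show ?thesis by (auto intro: borel_measurable_continuous_onI)
    qed
    have "(\<lambda>N. \<integral>x. H x * box_bump a b N x \<partial>lborel) \<longlonglongrightarrow> (\<integral>x. H x * indicator (box a b) x \<partial>lborel)"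
    proof (rule integral_dominated_convergence[where w = "\<lambda>x. \<bar>H x\<bar>"])
      show "AE x in lborel. (\<lambda>N. H x * box_bump a b N x) \<longlonglongrightarrow> H x * indicator (box a b) x"
        by (intro AE_I2 tendsto_intros box_bump_limit)
      show "AE x in lborel. norm (H x * box_bump a b N x) \<le> \<bar>H x\<bar>" for N
        using box_bump_bounds[of a b N] by (intro AE_I2) (auto simp: abs_mult intro: mult_right_le_one_le)
    qed (use Hint in auto)
    moreover have "(\<integral>x. H x * box_bump a b N x \<partial>lborel) = 0" for N
    proof -
      have "(\<integral>x. H x * box_bump a b N x \<partial>lborel) = (\<integral>x. F x * box_bump a b N x \<partial>lebesgue_on \<Omega>)"
        by (subst integral_lebesgue_on_borel) (auto simp: H_def mult.assoc)
      also have "\<dots> = (\<integral>x. h x * box_bump a b N x \<partial>lebesgue_on \<Omega>)"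
      proof (rule integral_cong_AE)
        show "(\<lambda>x. F x * box_bump a b N x) \<in> borel_measurable (lebesgue_on \<Omega>)"
          by (intro measurable_restrict_space1 measurable_completion) measurable
        have "box_bump a b N \<in> borel_measurable (lebesgue_on \<Omega>)"
          by (intro measurable_restrict_space1 measurable_completion) measurable
        then show "(\<lambda>x. h x * box_bump a b N x) \<in> borel_measurable (lebesgue_on \<Omega>)"
          using borel_measurable_integrable[OF h] by (intro borel_measurable_times)
        show "AE x in lebesgue_on \<Omega>. F x * box_bump a b N x = h x * box_bump a b N x"
          using FAE by eventually_elim simp
      qed
      also have "\<dots> = 0" by (rule zero[OF box_bump_test_function[OF that]])
      finally show ?thesis .
    qed
    ultimately show ?thesis by (simp add: LIMSEQ_const_iff)
  qed
  have local_zero: "AE x in lborel. x \<in> box c d \<longrightarrow> H x = 0" if cd: "cbox c d \<subseteq> \<Omega>" for c d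
  proof -
    define G where "G x = H x * indicator (box c d) x" for x
    have Gint: "integrable lborel G" unfolding G_def by (intro integrable_real_mult_indicator Hint) simp
    have sets_eq: "sets borel = sigma_sets UNIV (range (\<lambda>(a, b). box a b :: 'a set))"
      unfolding borel_eq_box by simp
    have "(\<integral>x. G x * indicator A x \<partial>lborel) = 0" if A: "A \<in> sets borel" for A
    proof -
      have "Int_stable (range (\<lambda>(a, b). box a b :: 'a set))" by (auto simp: Int_stable_def box_Int_box)
      moreover have "range (\<lambda>(a, b). box a b :: 'a set) \<subseteq> Pow UNIV" by simp
      moreover note A[unfolded sets_eq]
      ultimately show ?thesis
      proof (induction rule: sigma_sets_induct_disjoint)
        case (basic A)
        then obtain a b where A: "A = box a b" by auto
        obtain a' b' where I: "box c d \<inter> box a b = box a' b'" by (rule that[OF box_Int_box])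
        show ?case
        proof (cases "box a' b' = {}")
          case True
          then have zero: "G x * indicator A x = 0" for x using I by (auto simp: G_def A indicator_def)
          show ?thesis unfolding zero by simp
        next
          case False
          have "cbox a' b' \<subseteq> cbox c d"
          proof -
            have sub: "box a' b' \<subseteq> box c d" using I by blast
            then have "box c d \<noteq> {}" using False by blast
            then show ?thesis using closure_mono[OF sub] False by (simp add: closure_box)
          qed
          then have "(\<integral>x. H x * indicator (box a' b') x \<partial>lborel) = 0" using cd by (intro boxes) auto
          moreover have "G x * indicator A x = H x * indicator (box a' b') x" for x
            using I[symmetric] by (simp add: G_def A indicator_inter_arith mult.assoc)
          ultimately show ?thesis by simp
        qed
      next
        case empty
        then show ?case by simp
      next
        case (compl A)
        have A [measurable]: "A \<in> sets borel" using compl sets_eq by simp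
        have "G x * indicator (UNIV - A) x = G x - G x * indicator A x" for x
          by (simp add: indicator_def)
        then have "(\<integral>x. G x * indicator (UNIV - A) x \<partial>lborel) =
            (\<integral>x. G x \<partial>lborel) - (\<integral>x. G x * indicator A x \<partial>lborel)"
          using integrable_real_mult_indicator[OF _ Gint, of A] Gint
          by (simp add: Bochner_Integration.integral_diff)
        moreover have "(\<integral>x. G x \<partial>lborel) = 0" unfolding G_def by (rule boxes[OF cd])
        ultimately show ?case using compl by simp
      next
        case (union A)
        have A [measurable]: "A i \<in> sets borel" for i using union sets_eq by auto
        have "(\<lambda>n. \<integral>x. G x * indicator (\<Union>i<n. A i) x \<partial>lborel) \<longlonglongrightarrow> (\<integral>x. G x * indicator (\<Union>i. A i) x \<partial>lborel)"
        proof (rule integral_dominated_convergence[where w = "\<lambda>x. \<bar>G x\<bar>"])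
          show "AE x in lborel. (\<lambda>n. G x * indicator (\<Union>i<n. A i) x) \<longlonglongrightarrow> G x * indicator (\<Union>i. A i) x"
            by (intro AE_I2 tendsto_mult tendsto_const LIMSEQ_indicator_UN)
          show "AE x in lborel. norm (G x * indicator (\<Union>i<n. A i) x) \<le> \<bar>G x\<bar>" for n
            by (intro AE_I2) (auto simp: indicator_def)
        qed (use Gint in auto)
        moreover have "(\<integral>x. G x * indicator (\<Union>i<n. A i) x \<partial>lborel) = 0" for n
        proof -
          have "indicator (\<Union>i<n. A i) x = (\<Sum>i<n. indicator (A i) x :: real)" for x
            using union(1) by (intro indicator_UN_disjoint) (auto simp: disjoint_family_on_def)
          then have "(\<integral>x. G x * indicator (\<Union>i<n. A i) x \<partial>lborel) = (\<integral>x. (\<Sum>i<n. G x * indicator (A i) x) \<partial>lborel)"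
            by (simp add: sum_distrib_left)
          also have "\<dots> = (\<Sum>i<n. \<integral>x. G x * indicator (A i) x \<partial>lborel)"
            by (intro Bochner_Integration.integral_sum integrable_real_mult_indicator Gint) auto
          finally show ?thesis using union by simp
        qed
        ultimately show ?case by (simp add: LIMSEQ_const_iff)
      qed
    qed
    then have "AE x in lborel. G x = 0"
      using Gint by (intro density_unique_real) (auto simp: set_lebesgue_integral_def mult.commute)
    then show ?thesis by eventually_elim (auto simp: G_def)
  qed
  obtain \<D> where \<D>: "countable \<D>" "\<And>X. X \<in> \<D> \<Longrightarrow> \<exists>a b. X = cbox a b" "\<Union>\<D> = \<Omega>" "\<D> \<subseteq> Pow \<Omega>"
    using open_countable_Union_open_cbox[OF \<Omega>] by metis
  have "AE x in lborel. \<forall>X\<in>\<D>. x \<in> X \<longrightarrow> H x = 0"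
    unfolding AE_ball_countable[OF \<D>(1)]
  proof
    fix X assume X: "X \<in> \<D>"
    then obtain a b where ab: "X = cbox a b" using \<D>(2) by blast
    have "negligible (cbox a b - box a b)"
      using negligible_frontier_interval by (metis)
    then have "AE x in lebesgue. x \<notin> cbox a b - box a b"
      by (intro AE_not_in) (simp add: negligible_iff_null_sets)
    moreover have "cbox a b - box a b \<in> sets lborel" by simp
    ultimately have "AE x in lborel. x \<notin> cbox a b - box a b"
      by (metis AE_not_in \<open>negligible (cbox a b - box a b)\<close> negligible_iff_null_sets null_sets_completion_iff)
    moreover have "cbox a b \<subseteq> \<Omega>" using X ab \<D>(4) by blast
    then have "AE x in lborel. x \<in> box a b \<longrightarrow> H x = 0" by (rule local_zero)
    ultimately show "AE x in lborel. x \<in> X \<longrightarrow> H x = 0" unfolding ab by eventually_elim auto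
  qed
  then have "AE x in lborel. x \<in> \<Omega> \<longrightarrow> F x = 0"
  proof eventually_elim
    case (elim x)
    then show ?case using \<D>(3)[symmetric] by (auto simp: H_def)
  qed
  then have "AE x in lebesgue_on \<Omega>. F x = 0"
    using \<Omega>b by (auto simp: AE_restrict_space_iff intro: AE_completion)
  with FAE show ?thesis by eventually_elim simp
qed

section \<open>Null functions and convergence to zero in the Lebesgue space\<close>

lemma finite_measure_lebesgue_on_bounded:
  fixes \<Omega> :: "'a::euclidean_space set"
  assumes "open \<Omega>" "bounded \<Omega>"
  shows "finite_measure (lebesgue_on \<Omega>)"
  using assms by (intro finite_measure_lebesgue_on bounded_set_imp_lmeasurable) auto

text \<open>
  The weak gradient of a null function is orthogonal to all test functions.
\<close>

lemma weak_gradient_of_null: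
  fixes \<Omega> :: "'a::euclidean_space set"
  assumes \<Omega>: "open \<Omega>" "bounded \<Omega>" and w: "AE x in lebesgue_on \<Omega>. w x = 0"
    and g: "is_weak_gradient \<Omega> w g"
  shows "AE x in lebesgue_on \<Omega>. g x = 0"
proof -
  interpret finite_measure "lebesgue_on \<Omega>" by (rule finite_measure_lebesgue_on_bounded[OF \<Omega>])
  have gL2: "g \<in> borel_measurable (lebesgue_on \<Omega>)" "integrable (lebesgue_on \<Omega>) (\<lambda>x. (norm (g x))\<^sup>2)"
    using g by (auto simp: is_weak_gradient_def L2_def)
  have gi: "integrable (lebesgue_on \<Omega>) (\<lambda>x. g x \<bullet> b)" if b: "b \<in> Basis" for b
  proof (rule square_integrable_imp_integrable)
    show m: "(\<lambda>x. g x \<bullet> b) \<in> borel_measurable (lebesgue_on \<Omega>)" using gL2(1) by simp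
    have "(g x \<bullet> b)\<^sup>2 \<le> (norm (g x))\<^sup>2" for x
      using Basis_le_norm[OF b, of "g x"] by (metis abs_ge_zero power2_abs power_mono)
    then show "integrable (lebesgue_on \<Omega>) (\<lambda>x. (g x \<bullet> b)\<^sup>2)"
      using m by (intro Bochner_Integration.integrable_bound[OF gL2(2)]) auto
  qed
  have "AE x in lebesgue_on \<Omega>. g x \<bullet> b = 0" if b: "b \<in> Basis" for b
  proof (rule AE_zero_of_test_functions[OF \<Omega>(1)])
    show "integrable (lebesgue_on \<Omega>) (\<lambda>x. g x \<bullet> b)" by (rule gi[OF b])
    fix \<phi> :: "'a \<Rightarrow> real" assume \<phi>: "\<phi> \<in> test_functions \<Omega>"
    have "(\<integral>x. w x * frechet_derivative \<phi> (at x) b \<partial>lebesgue_on \<Omega>) = 0"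
      using w by (intro integral_eq_zero_AE) (auto elim: eventually_mono)
    then show "(\<integral>x. (g x \<bullet> b) * \<phi> x \<partial>lebesgue_on \<Omega>) = 0"
      using g \<phi> b by (simp add: is_weak_gradient_def)
  qed
  then have "AE x in lebesgue_on \<Omega>. \<forall>b\<in>Basis. g x \<bullet> b = 0"
    by (subst AE_finite_all) auto
  then show ?thesis by eventually_elim (simp add: euclidean_all_zero_iff)
qed

lemma zero_test_function: "(\<lambda>x. 0) \<in> test_functions \<Omega>"
  by (simp add: test_functions_def Ck_fun_const)

lemma zero_in_L2: "(\<lambda>x. 0) \<in> L2 \<Omega>"
  by (simp add: L2_def)

text \<open>
  Membership in \<open>H\<^sub>0\<^sup>1\<close> is witnessed by the constant sequence of zero test functions.
\<close>

lemma dirichlet_energy_null: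
  fixes \<Omega> :: "'a::euclidean_space set"
  assumes \<Omega>: "open \<Omega>" "bounded \<Omega>" and w: "w \<in> L2 \<Omega>" "AE x in lebesgue_on \<Omega>. w x = 0"
  shows "dirichlet_energy \<Omega> w = 0"
proof -
  have "is_weak_gradient \<Omega> w (\<lambda>x. 0)"
    using w(2) by (auto simp: is_weak_gradient_def zero_in_L2 intro!: integral_eq_zero_AE elim: eventually_mono)
  then have H1: "w \<in> H1 \<Omega>" and "is_weak_gradient \<Omega> w (weak_gradient \<Omega> w)"
    using w(1) someI[of "is_weak_gradient \<Omega> w"] unfolding H1_def weak_gradient_def by auto
  then have "AE x in lebesgue_on \<Omega>. weak_gradient \<Omega> w x = 0"
    by (intro weak_gradient_of_null[OF \<Omega> w(2)])
  then have grad0: "(\<integral>x. (norm (weak_gradient \<Omega> w x))\<^sup>2 \<partial>lebesgue_on \<Omega>) = 0"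
    by (intro integral_eq_zero_AE) (auto elim: eventually_mono)
  have "(\<integral>x. (norm (w x))\<^sup>2 \<partial>lebesgue_on \<Omega>) = 0"
    using w(2) by (intro integral_eq_zero_AE) (auto elim: eventually_mono)
  then have "H1_norm \<Omega> w = 0" using grad0 by (simp add: H1_norm_def L2_norm_def)
  then have "w \<in> H10 \<Omega>"
    using H1 unfolding H10_def by (auto intro!: exI[of _ "\<lambda>k x. 0"] simp: zero_test_function)
  then show ?thesis using grad0 by (simp add: dirichlet_energy_def)
qed

lemma dirichlet_energy_nonneg: "0 \<le> dirichlet_energy \<Omega> v"
  by (simp add: dirichlet_energy_def)

lemma L2_diff:
  fixes u v :: "'a::euclidean_space \<Rightarrow> real"
  assumes "u \<in> L2 \<Omega>" "v \<in> L2 \<Omega>"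
  shows "(\<lambda>x. u x - v x) \<in> L2 \<Omega>"
proof -
  have m: "(\<lambda>x. u x - v x) \<in> borel_measurable (lebesgue_on \<Omega>)"
    using assms by (intro borel_measurable_diff) (auto simp: L2_def)
  have "integrable (lebesgue_on \<Omega>) (\<lambda>x. (u x - v x)\<^sup>2)"
  proof (rule Bochner_Integration.integrable_bound)
    show "integrable (lebesgue_on \<Omega>) (\<lambda>x. 2 * (u x)\<^sup>2 + 2 * (v x)\<^sup>2)"
      using assms by (intro Bochner_Integration.integrable_add integrable_mult_right) (auto simp: L2_def)
    have "(u x - v x)\<^sup>2 \<le> 2 * (u x)\<^sup>2 + 2 * (v x)\<^sup>2" for x
      using zero_le_power2[of "u x + v x"] by (simp add: power2_eq_square algebra_simps)
    then show "AE x in lebesgue_on \<Omega>. norm ((u x - v x)\<^sup>2) \<le> norm (2 * (u x)\<^sup>2 + 2 * (v x)\<^sup>2)"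
      by (intro AE_I2) simp
  qed (use m in measurable)
  then show ?thesis using m by (simp add: L2_def)
qed

lemma L2_norm_nonneg: "0 \<le> L2_norm \<Omega> u"
  by (simp add: L2_norm_def)

lemma L2_norm_add_le:
  fixes u v :: "'a::euclidean_space \<Rightarrow> real"
  assumes u: "u \<in> L2 \<Omega>" and v: "v \<in> L2 \<Omega>"
  shows "L2_norm \<Omega> (\<lambda>x. u x + v x) \<le> L2_norm \<Omega> u + L2_norm \<Omega> v"
proof -
  let ?M = "lebesgue_on \<Omega>"
  define A where "A = (\<integral>x. (u x)\<^sup>2 \<partial>?M)"
  define B where "B = (\<integral>x. (v x)\<^sup>2 \<partial>?M)"
  have um [measurable]: "u \<in> borel_measurable ?M" and vm [measurable]: "v \<in> borel_measurable ?M"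
    and ui: "integrable ?M (\<lambda>x. (u x)\<^sup>2)" and vi: "integrable ?M (\<lambda>x. (v x)\<^sup>2)"
    using u v by (auto simp: L2_def)
  have A0: "0 \<le> A" and B0: "0 \<le> B" by (auto simp: A_def B_def)
  have uvi: "integrable ?M (\<lambda>x. u x * v x)"
  proof (rule Bochner_Integration.integrable_bound)
    show "integrable ?M (\<lambda>x. (u x)\<^sup>2 + (v x)\<^sup>2)" using ui vi by simp
    have "\<bar>u x * v x\<bar> \<le> (u x)\<^sup>2 + (v x)\<^sup>2" for x
    proof -
      have "2 * (\<bar>u x\<bar> * \<bar>v x\<bar>) \<le> (u x)\<^sup>2 + (v x)\<^sup>2"
        using zero_le_power2[of "\<bar>u x\<bar> - \<bar>v x\<bar>"] by (simp add: power2_eq_square algebra_simps)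
      moreover have "0 \<le> \<bar>u x\<bar> * \<bar>v x\<bar>" by simp
      ultimately show ?thesis unfolding abs_mult by linarith
    qed
    then show "AE x in ?M. norm (u x * v x) \<le> norm ((u x)\<^sup>2 + (v x)\<^sup>2)"
      by (intro AE_I2) simp
  qed measurable
  have CS: "(\<integral>x. u x * v x \<partial>?M) \<le> sqrt A * sqrt B"
  proof -
    have "(\<integral>\<^sup>+x. ennreal \<bar>u x\<bar> * ennreal \<bar>v x\<bar> \<partial>?M) = (\<integral>\<^sup>+x. ennreal \<bar>u x * v x\<bar> \<partial>?M)"
      by (simp add: abs_mult ennreal_mult)
    also have "\<dots> = ennreal (\<integral>x. \<bar>u x * v x\<bar> \<partial>?M)"
      using uvi by (intro nn_integral_eq_integral) auto
    finally have "ennreal ((\<integral>x. \<bar>u x * v x\<bar> \<partial>?M)\<^sup>2) = (\<integral>\<^sup>+x. ennreal \<bar>u x\<bar> * ennreal \<bar>v x\<bar> \<partial>?M)\<^sup>2"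
      by (simp add: ennreal_power)
    also have "\<dots> \<le> (\<integral>\<^sup>+x. (ennreal \<bar>u x\<bar>)\<^sup>2 \<partial>?M) * (\<integral>\<^sup>+x. (ennreal \<bar>v x\<bar>)\<^sup>2 \<partial>?M)"
      by (rule Cauchy_Schwarz_nn_integral) measurable
    also have "\<dots> = ennreal A * ennreal B"
      using ui vi by (simp add: A_def B_def ennreal_power nn_integral_eq_integral)
    finally have "(\<integral>x. \<bar>u x * v x\<bar> \<partial>?M)\<^sup>2 \<le> A * B"
      using A0 B0 by (simp flip: ennreal_mult)
    then have "(\<integral>x. \<bar>u x * v x\<bar> \<partial>?M) \<le> sqrt (A * B)" by (rule real_le_rsqrt)
    moreover have "(\<integral>x. u x * v x \<partial>?M) \<le> (\<integral>x. \<bar>u x * v x\<bar> \<partial>?M)"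
      using uvi by (intro integral_mono) auto
    ultimately show ?thesis by (simp add: real_sqrt_mult)
  qed
  have "(\<integral>x. (u x + v x)\<^sup>2 \<partial>?M) = (\<integral>x. (u x)\<^sup>2 + (v x)\<^sup>2 + 2 * (u x * v x) \<partial>?M)"
    by (simp add: power2_sum mult.assoc)
  also have "\<dots> = A + B + 2 * (\<integral>x. u x * v x \<partial>?M)"
    using ui vi uvi by (simp add: A_def B_def)
  also have "\<dots> \<le> A + B + 2 * (sqrt A * sqrt B)" using CS by simp
  also have "\<dots> = (sqrt A + sqrt B)\<^sup>2" using A0 B0 by (simp add: power2_sum)
  finally have "sqrt (\<integral>x. (u x + v x)\<^sup>2 \<partial>?M) \<le> sqrt A + sqrt B"
    using A0 B0 by (simp add: real_le_lsqrt)
  then show ?thesis by (simp add: L2_norm_def A_def B_def)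
qed

lemma L2_norm_triangle:
  fixes u v w :: "'a::euclidean_space \<Rightarrow> real"
  assumes "u \<in> L2 \<Omega>" "v \<in> L2 \<Omega>" "w \<in> L2 \<Omega>"
  shows "L2_norm \<Omega> (\<lambda>x. u x - w x) \<le> L2_norm \<Omega> (\<lambda>x. u x - v x) + L2_norm \<Omega> (\<lambda>x. v x - w x)"
  using L2_norm_add_le[OF L2_diff[OF assms(1,2)] L2_diff[OF assms(2,3)]] by simp

lemma L2_norm_diff_commute:
  fixes u v :: "'a::euclidean_space \<Rightarrow> real"
  shows "L2_norm \<Omega> (\<lambda>x. u x - v x) = L2_norm \<Omega> (\<lambda>x. v x - u x)"
  by (simp add: L2_norm_def power2_commute)

lemma openin_L2_ball:
  fixes v :: "'a::euclidean_space \<Rightarrow> real"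
  assumes v: "v \<in> L2 \<Omega>"
  shows "openin (L2_topology \<Omega>) {w \<in> L2 \<Omega>. L2_norm \<Omega> (\<lambda>x. w x - v x) < e}"
  unfolding openin_L2_topology
proof (intro conjI ballI)
  fix w assume w: "w \<in> {w \<in> L2 \<Omega>. L2_norm \<Omega> (\<lambda>x. w x - v x) < e}"
  show "\<exists>\<epsilon>>0. \<forall>z\<in>L2 \<Omega>. L2_norm \<Omega> (\<lambda>x. z x - w x) < \<epsilon> \<longrightarrow> z \<in> {w \<in> L2 \<Omega>. L2_norm \<Omega> (\<lambda>x. w x - v x) < e}"
  proof (intro exI[of _ "e - L2_norm \<Omega> (\<lambda>x. w x - v x)"] conjI ballI impI)
    fix z assume z: "z \<in> L2 \<Omega>" "L2_norm \<Omega> (\<lambda>x. z x - w x) < e - L2_norm \<Omega> (\<lambda>x. w x - v x)"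
    then show "z \<in> {w \<in> L2 \<Omega>. L2_norm \<Omega> (\<lambda>x. w x - v x) < e}"
      using L2_norm_triangle[of z \<Omega> w v] v w by auto
  qed (use w in auto)
qed auto

lemma openin_L2_topologyD:
  assumes "openin (L2_topology \<Omega>) U" "u \<in> U"
  shows "\<exists>e>0. \<forall>v. v \<in> L2 \<Omega> \<longrightarrow> L2_norm \<Omega> (\<lambda>x. v x - u x) < e \<longrightarrow> v \<in> U"
  using assms(1)[unfolded openin_L2_topology, THEN conjunct2, rule_format, OF assms(2)]
  unfolding Ball_def .

text \<open>
  The topology is not Hausdorff, so the closure of the range contains more than the range and the
  zero function. A point of the closure either lies in the neighbourhood of \<open>0\<close> that the cover
  provides or has distance \<open>0\<close> from one of finitely many members of the range, and then lies in
  the same open sets as this member.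
\<close>

lemma relatively_compact_of_null:
  fixes u :: "nat \<Rightarrow> 'a::euclidean_space \<Rightarrow> real"
  assumes u: "\<And>n. u n \<in> L2 \<Omega>" and lim: "(\<lambda>n. L2_norm \<Omega> (u n)) \<longlonglongrightarrow> 0"
  shows "relatively_compact_in (L2_topology \<Omega>) (range u)"
  unfolding relatively_compact_in_def
proof (intro conjI)
  let ?X = "L2_topology \<Omega>"
  let ?K = "?X closure_of (range u)"
  show sub: "range u \<subseteq> topspace ?X" unfolding topspace_L2_topology using u by blast
  have zero: "(\<lambda>x. 0) \<in> ?K"
    unfolding in_closure_of
  proof (intro conjI allI impI)
    fix T assume T: "(\<lambda>x. 0) \<in> T \<and> openin ?X T"
    obtain e where e: "0 < e" "\<forall>v. v \<in> L2 \<Omega> \<longrightarrow> L2_norm \<Omega> (\<lambda>x. v x - 0) < e \<longrightarrow> v \<in> T"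
      using openin_L2_topologyD[OF conjunct2[OF T] conjunct1[OF T]] by (elim exE conjE) (rule that)
    obtain n where "L2_norm \<Omega> (u n) < e"
      using order_tendstoD(2)[OF lim e(1)] by (auto simp: eventually_sequentially)
    then have "u n \<in> T" using e u by simp
    then show "\<exists>y. y \<in> range u \<and> y \<in> T" by blast
  qed (simp add: zero_in_L2)
  show "compactin ?X ?K"
    unfolding compactin_def
  proof (intro conjI allI impI)
    show "?K \<subseteq> topspace ?X" by (rule closure_of_subset_topspace)
    fix \<U> assume \<U>: "(\<forall>U\<in>\<U>. openin ?X U) \<and> ?K \<subseteq> \<Union>\<U>"
    obtain U0 where U0: "U0 \<in> \<U>" "(\<lambda>x. 0) \<in> U0" using \<U> zero by blast
    have openU: "openin ?X U" if "U \<in> \<U>" for U using \<U> that by simp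
    obtain e where "0 < e" and e0: "\<forall>v. v \<in> L2 \<Omega> \<longrightarrow> L2_norm \<Omega> (\<lambda>x. v x - 0) < e \<longrightarrow> v \<in> U0"
      using openin_L2_topologyD[OF openU[OF U0(1)] U0(2)] by (elim exE conjE) (rule that)
    have e: "0 < e" "v \<in> L2 \<Omega> \<Longrightarrow> L2_norm \<Omega> v < e \<Longrightarrow> v \<in> U0" for v
      using \<open>0 < e\<close> e0 by simp_all
    have "\<forall>n. \<exists>U. U \<in> \<U> \<and> u n \<in> U"
    proof
      fix n
      have "u n \<in> ?K" using closure_of_subset[OF sub] by (rule subsetD) simp
      then have "u n \<in> \<Union>\<U>" using conjunct2[OF \<U>] by (rule rev_subsetD)
      then show "\<exists>U. U \<in> \<U> \<and> u n \<in> U" by (simp add: Union_iff Bex_def)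
    qed
    from choice[OF this] obtain V where V': "\<forall>n. V n \<in> \<U> \<and> u n \<in> V n" ..
    then have V: "V n \<in> \<U>" "u n \<in> V n" for n by simp_all
    obtain N where N: "\<And>n. n \<ge> N \<Longrightarrow> L2_norm \<Omega> (u n) < e / 2"
      using order_tendstoD(2)[OF lim, of "e / 2"] e(1) by (auto simp: eventually_sequentially)
    have "?K \<subseteq> \<Union>(insert U0 (V ` {..<N}))"
    proof
      fix v assume v: "v \<in> ?K"
      then have vL: "v \<in> L2 \<Omega>" by (simp add: in_closure_of)
      show "v \<in> \<Union>(insert U0 (V ` {..<N}))"
      proof (rule ccontr)
        assume neg: "\<not> ?thesis"
        then have big: "e \<le> L2_norm \<Omega> v" using e(2)[OF vL] by (meson UnionI insertI1 not_le)
        have "\<forall>n. \<exists>s>0. \<forall>z. z \<in> L2 \<Omega> \<longrightarrow> L2_norm \<Omega> (\<lambda>x. z x - u n x) < s \<longrightarrow> z \<in> V n"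
          by (rule allI) (rule openin_L2_topologyD[OF openU[OF V(1)] V(2)])
        from choice[OF this] obtain s where s': "\<forall>n. 0 < s n \<and>
            (\<forall>z. z \<in> L2 \<Omega> \<longrightarrow> L2_norm \<Omega> (\<lambda>x. z x - u n x) < s n \<longrightarrow> z \<in> V n)" ..
        have s: "0 < s n" "z \<in> L2 \<Omega> \<Longrightarrow> L2_norm \<Omega> (\<lambda>x. z x - u n x) < s n \<Longrightarrow> z \<in> V n" for n z
          using s' by simp_all
        \<comment> \<open>A ball around \<open>v\<close> too small to reach any of \<open>u 0, \<dots>, u (N - 1)\<close> or the ball of radius \<open>e / 2\<close> around \<open>0\<close>.\<close>
        define t where "t = Min (insert (e / 2) (s ` {..<N}))"
        have t: "0 < t" using s(1) e(1) by (simp add: t_def)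
        have te: "t \<le> e / 2" "\<And>n. n < N \<Longrightarrow> t \<le> s n"
          unfolding t_def by (rule Min_le; auto)+
        have "openin ?X {w \<in> L2 \<Omega>. L2_norm \<Omega> (\<lambda>x. w x - v x) < t}" by (rule openin_L2_ball[OF vL])
        moreover have "v \<in> {w \<in> L2 \<Omega>. L2_norm \<Omega> (\<lambda>x. w x - v x) < t}"
          using vL t by (simp add: L2_norm_def)
        ultimately have "\<exists>y. y \<in> range u \<and> y \<in> {w \<in> L2 \<Omega>. L2_norm \<Omega> (\<lambda>x. w x - v x) < t}"
          using v[unfolded in_closure_of, THEN conjunct2, rule_format, of "{w \<in> L2 \<Omega>. L2_norm \<Omega> (\<lambda>x. w x - v x) < t}"]
          by simp
        then obtain n where n: "L2_norm \<Omega> (\<lambda>x. u n x - v x) < t" by auto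
        have n': "L2_norm \<Omega> (\<lambda>x. v x - u n x) < t" using n by (simp add: L2_norm_diff_commute)
        show False
        proof (cases "n < N")
          case True
          then have "v \<in> V n" using s(2)[OF vL, of n] n' te(2)[OF True] by simp
          then show False using neg True by blast
        next
          case False
          have "L2_norm \<Omega> (\<lambda>x. (v x - u n x) + u n x) \<le> L2_norm \<Omega> (\<lambda>x. v x - u n x) + L2_norm \<Omega> (u n)"
            by (intro L2_norm_add_le L2_diff vL u)
          then show False using n' te(1) N[of n] False big by simp
        qed
      qed
    qed
    then show "\<exists>\<F>. finite \<F> \<and> \<F> \<subseteq> \<U> \<and> ?K \<subseteq> \<Union>\<F>"
      using U0 V by (intro exI[of _ "insert U0 (V ` {..<N})"]) auto
  qed
qed

lemma cluster_point_of_null: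
  fixes u :: "nat \<Rightarrow> 'a::euclidean_space \<Rightarrow> real"
  assumes u: "\<And>n. u n \<in> L2 \<Omega>" and lim: "(\<lambda>n. L2_norm \<Omega> (u n)) \<longlonglongrightarrow> 0"
    and w: "cluster_point_in (L2_topology \<Omega>) u w"
  shows "w \<in> L2 \<Omega>" "AE x in lebesgue_on \<Omega>. w x = 0"
proof -
  obtain s where s: "strict_mono s" "limitin (L2_topology \<Omega>) (u \<circ> s) w sequentially"
    using w by (auto simp: cluster_point_in_def)
  then show wL: "w \<in> L2 \<Omega>" using limitin_topspace[OF s(2)] by simp
  have "L2_norm \<Omega> w \<le> 0 + e" if e: "0 < e" for e
  proof -
    have "\<forall>\<^sub>F n in sequentially. (u \<circ> s) n \<in> {z \<in> L2 \<Omega>. L2_norm \<Omega> (\<lambda>x. z x - w x) < e / 2}"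
      using s(2) openin_L2_ball[OF wL, of "e / 2"] wL e
      unfolding limitin_def by (auto simp: L2_norm_def)
    moreover have "(\<lambda>n. L2_norm \<Omega> (u (s n))) \<longlonglongrightarrow> 0"
      using LIMSEQ_subseq_LIMSEQ[OF lim s(1)] by (simp add: o_def)
    then have "\<forall>\<^sub>F n in sequentially. L2_norm \<Omega> (u (s n)) < e / 2"
      using e by (intro order_tendstoD(2)) auto
    ultimately have "\<forall>\<^sub>F n in sequentially. L2_norm \<Omega> w \<le> e"
    proof eventually_elim
      case (elim n)
      have "L2_norm \<Omega> (\<lambda>x. (w x - u (s n) x) + u (s n) x) \<le> L2_norm \<Omega> (\<lambda>x. w x - u (s n) x) + L2_norm \<Omega> (u (s n))"
        by (intro L2_norm_add_le L2_diff wL u)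
      then show ?case using elim L2_norm_diff_commute[of \<Omega> w "u (s n)"] by simp
    qed
    then show ?thesis by simp
  qed
  then have "L2_norm \<Omega> w \<le> 0" by (rule field_le_epsilon)
  then have "(\<integral>x. (w x)\<^sup>2 \<partial>lebesgue_on \<Omega>) \<le> 0" by (simp add: L2_norm_def)
  moreover have "integrable (lebesgue_on \<Omega>) (\<lambda>x. (w x)\<^sup>2)" using wL by (simp add: L2_def)
  ultimately have "AE x in lebesgue_on \<Omega>. (w x)\<^sup>2 = 0"
    using integral_nonneg_eq_0_iff_AE[of "lebesgue_on \<Omega>" "\<lambda>x. (w x)\<^sup>2"]
    by (simp add: order_antisym)
  then show "AE x in lebesgue_on \<Omega>. w x = 0" by eventually_elim simp
qed

section \<open>Kernels and kernel averages\<close>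

lemma admissible_kernelD:
  assumes K: "admissible_kernel K"
  shows "\<And>s. 0 \<le> s \<Longrightarrow> 0 \<le> K s" "\<And>s. 0 \<le> s \<Longrightarrow> K s \<le> K 0" "continuous_on {0..} K"
    "\<exists>r>0. \<forall>s\<ge>0. K s \<noteq> 0 \<longrightarrow> s \<le> r\<^sup>2"
proof -
  show "\<And>s. 0 \<le> s \<Longrightarrow> 0 \<le> K s" "\<exists>r>0. \<forall>s\<ge>0. K s \<noteq> 0 \<longrightarrow> s \<le> r\<^sup>2"
    using K unfolding admissible_kernel_def by simp_all
  have "antimono_on {0..} K" using K unfolding admissible_kernel_def by simp
  then show "K s \<le> K 0" if "0 \<le> s" for s
    using that by (auto simp: monotone_on_def)
  obtain K' where "\<forall>s\<ge>0. (K has_real_derivative K' s) (at s within {0..})"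
    using K unfolding admissible_kernel_def by blast
  then show "continuous_on {0..} K"
    unfolding continuous_on_eq_continuous_within by (auto intro: DERIV_continuous)
qed

text \<open>
  A nonincreasing nonnegative kernel that is not identically zero is positive at \<open>0\<close>.
\<close>

lemma admissible_kernel_lower_bound:
  assumes K: "admissible_kernel K" and nz: "\<exists>s\<ge>0. K s \<noteq> 0"
  shows "\<exists>\<kappa>>0. \<exists>\<eta>>0. \<forall>s. 0 \<le> s \<longrightarrow> s \<le> \<eta>\<^sup>2 \<longrightarrow> \<kappa> \<le> K s"
proof -
  note KD = admissible_kernelD[OF K]
  obtain s where "0 \<le> s" "K s \<noteq> 0" using nz by blast
  then have K0: "0 < K 0" using KD(1,2)[of s] by simp
  obtain d where d: "0 < d" "\<forall>s\<in>{0..}. dist s 0 < d \<longrightarrow> dist (K s) (K 0) < K 0 / 2"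
    using KD(3) K0 unfolding continuous_on_iff by (metis atLeast_iff half_gt_zero order_refl)
  define \<eta> where "\<eta> = sqrt (d / 2)"
  have \<eta>: "0 < \<eta>" "\<eta>\<^sup>2 < d" using d by (auto simp: \<eta>_def)
  have "K 0 / 2 \<le> K s" if "0 \<le> s" "s \<le> \<eta>\<^sup>2" for s
  proof -
    have "\<bar>K s - K 0\<bar> < K 0 / 2" using d(2) that \<eta> by (auto simp: dist_real_def)
    then show ?thesis by linarith
  qed
  then show ?thesis using K0 \<eta> by (intro exI[of _ "K 0 / 2"] conjI exI[of _ \<eta>]) auto
qed

lemma continuous_scaled_kernel:
  assumes "admissible_kernel K" "0 < \<delta>"
  shows "continuous_on UNIV (\<lambda>s. scaled_kernel d K \<delta> s)"
proof -
  have "continuous_on UNIV (\<lambda>s. K (s\<^sup>2 / \<delta>\<^sup>2))"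
    by (rule continuous_on_compose2[OF admissible_kernelD(3)[OF assms(1)]])
      (use assms in \<open>auto intro!: continuous_intros\<close>)
  then show ?thesis unfolding scaled_kernel_def by (intro continuous_intros)
qed

lemma scaled_kernel_bounds:
  assumes "admissible_kernel K" "0 < \<delta>"
  shows "0 \<le> scaled_kernel d K \<delta> s" "scaled_kernel d K \<delta> s \<le> K 0 / \<delta> ^ d"
  using admissible_kernelD(1,2)[OF assms(1), of "s\<^sup>2 / \<delta>\<^sup>2"] assms(2)
  by (auto simp: scaled_kernel_def divide_right_mono)

lemma scaled_kernel_measurable [measurable (raw)]:
  assumes "admissible_kernel K" "0 < \<delta>" "g \<in> borel_measurable M"
  shows "(\<lambda>x. scaled_kernel d K \<delta> (g x)) \<in> borel_measurable M"
  using borel_measurable_continuous_onI[OF continuous_scaled_kernel[OF assms(1,2), of d]] assms(3)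
  by (rule measurable_compose[rotated])

abbreviation kernel_form ::
    "nat \<Rightarrow> 'a::euclidean_space set \<Rightarrow> (real \<Rightarrow> real) \<Rightarrow> real \<Rightarrow> ('a \<Rightarrow> real) \<Rightarrow> real" where
  "kernel_form d \<Omega> K \<delta> u \<equiv>
    (\<integral>y. (\<integral>x. scaled_kernel d K \<delta> (norm (x - y)) * \<bar>u x - u y\<bar>\<^sup>2 \<partial>lebesgue_on \<Omega>) \<partial>lebesgue_on \<Omega>)"

text \<open>
  The kernel is at least \<open>\<kappa> / \<delta>\<^sup>d\<close> at distances up to \<open>\<eta>\<delta>\<close>. The iterated Bochner integral equals
  the corresponding integral of nonnegative functions because the integrand is integrable;
  otherwise its value \<open>0\<close> would carry no information.
\<close>

lemma increment_energy_le_nonlocal: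
  fixes f :: "'a::euclidean_space \<Rightarrow> real"
  assumes \<Omega>: "open \<Omega>" "bounded \<Omega>" and R: "admissible_kernel R" and \<delta>: "0 < \<delta>"
    and lower: "0 < \<kappa>" "0 < \<eta>" "\<And>s. 0 \<le> s \<Longrightarrow> s \<le> \<eta>\<^sup>2 \<Longrightarrow> \<kappa> \<le> R s"
    and f [measurable]: "f \<in> borel_measurable borel" and f2: "integrable lborel (\<lambda>x. indicator \<Omega> x * (f x)\<^sup>2)"
  shows "increment_energy \<Omega> (\<eta> * \<delta>) f \<le> ennreal (\<delta> ^ DIM('a) / \<kappa> *
    (kernel_form DIM('a) \<Omega> R \<delta> f))"
proof -
  let ?k = "\<lambda>x y. scaled_kernel DIM('a) R \<delta> (norm (x - y))"
  let ?D = "\<delta> ^ DIM('a) / \<kappa>"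
  have \<Omega>b [measurable]: "\<Omega> \<in> sets borel" using \<Omega> by simp
  note [measurable] = scaled_kernel_measurable[OF R \<delta>]
  define M where "M = R 0 / \<delta> ^ DIM('a)"
  have k: "0 \<le> ?k x y" "?k x y \<le> M" for x y using scaled_kernel_bounds[OF R \<delta>] by (auto simp: M_def)
  have M0: "0 \<le> M" using k order_trans by blast
  have \<Omega>i: "integrable lborel (\<lambda>x. indicator \<Omega> x :: real)"
    by (intro integrable_real_indicator \<Omega>b emeasure_bounded_finite \<Omega>) simp
  define G where "G y x = indicator \<Omega> y * (indicator \<Omega> x * (?k x y * \<bar>f x - f y\<bar>\<^sup>2))" for y x
  have G_meas [measurable]: "(\<lambda>(y, x). G y x) \<in> borel_measurable (borel \<Otimes>\<^sub>M borel)"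
    unfolding G_def by measurable
  have G0: "0 \<le> G y x" for y x unfolding G_def by (intro mult_nonneg_nonneg k) auto
  have G_le: "G y x \<le> indicator \<Omega> y * (2 * M * (indicator \<Omega> x * (f x)\<^sup>2) + 2 * M * (f y)\<^sup>2 * indicator \<Omega> x)" for y x
  proof -
    have "(f x - f y)\<^sup>2 \<le> 2 * (f x)\<^sup>2 + 2 * (f y)\<^sup>2"
      using square_diff_le[of "f x" "f y" 0] by simp
    then have "?k x y * (f x - f y)\<^sup>2 \<le> M * (2 * (f x)\<^sup>2 + 2 * (f y)\<^sup>2)"
      using k[of x y] M0 by (intro mult_mono) auto
    then show ?thesis by (simp add: G_def indicator_def algebra_simps)
  qed
  have inner: "integrable lborel (G y)" for y
  proof (rule Bochner_Integration.integrable_bound)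
    show "integrable lborel (\<lambda>x. indicator \<Omega> y * (2 * M * (indicator \<Omega> x * (f x)\<^sup>2) + 2 * M * (f y)\<^sup>2 * indicator \<Omega> x))"
      by (intro integrable_mult_right Bochner_Integration.integrable_add f2 \<Omega>i)
    show "AE x in lborel. norm (G y x) \<le> norm (indicator \<Omega> y * (2 * M * (indicator \<Omega> x * (f x)\<^sup>2) + 2 * M * (f y)\<^sup>2 * indicator \<Omega> x))"
      using G_le G0 by (intro AE_I2) (smt (verit) real_norm_def)
  qed measurable
  define I where "I y = (\<integral>x. G y x \<partial>lborel)" for y
  have I_meas [measurable]: "I \<in> borel_measurable borel" unfolding I_def by measurable
  have I0: "0 \<le> I y" for y unfolding I_def by (intro Bochner_Integration.integral_nonneg G0)
  have I_int: "integrable lborel I"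
  proof (rule Bochner_Integration.integrable_bound)
    define a where "a = (\<integral>x. indicator \<Omega> x * (f x)\<^sup>2 \<partial>lborel)"
    let ?B = "\<lambda>y. 2 * M * a * indicator \<Omega> y + 2 * M * measure lborel \<Omega> * (indicator \<Omega> y * (f y)\<^sup>2)"
    show "integrable lborel ?B"
      by (intro integrable_mult_right Bochner_Integration.integrable_add f2 \<Omega>i)
    have "I y \<le> ?B y" for y
    proof -
      have "I y \<le> (\<integral>x. indicator \<Omega> y * (2 * M * (indicator \<Omega> x * (f x)\<^sup>2) + 2 * M * (f y)\<^sup>2 * indicator \<Omega> x) \<partial>lborel)"
        unfolding I_def
        by (intro integral_mono inner G_le integrable_mult_right Bochner_Integration.integrable_add f2 \<Omega>i)
      also have "\<dots> = indicator \<Omega> y * (\<integral>x. 2 * M * (indicator \<Omega> x * (f x)\<^sup>2) + 2 * M * (f y)\<^sup>2 * indicator \<Omega> x \<partial>lborel)"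
        by (rule integral_mult_right_zero)
      also have "(\<integral>x. 2 * M * (indicator \<Omega> x * (f x)\<^sup>2) + 2 * M * (f y)\<^sup>2 * indicator \<Omega> x \<partial>lborel) =
          (\<integral>x. 2 * M * (indicator \<Omega> x * (f x)\<^sup>2) \<partial>lborel) + (\<integral>x. 2 * M * (f y)\<^sup>2 * indicator \<Omega> x \<partial>lborel)"
        by (intro Bochner_Integration.integral_add integrable_mult_right f2 \<Omega>i)
      also have "\<dots> = 2 * M * a + 2 * M * (f y)\<^sup>2 * measure lborel \<Omega>"
        unfolding integral_mult_right_zero by (simp add: a_def)
      also have "indicator \<Omega> y * \<dots> = ?B y" by (simp add: algebra_simps)
      finally show ?thesis .
    qed
    then show "AE y in lborel. norm (I y) \<le> norm (?B y)"
      using I0 by (intro AE_I2) (smt (verit) real_norm_def)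
  qed measurable
  have conv: "(\<integral>y. (\<integral>x. ?k x y * \<bar>f x - f y\<bar>\<^sup>2 \<partial>lebesgue_on \<Omega>) \<partial>lebesgue_on \<Omega>) = (\<integral>y. I y \<partial>lborel)"
  proof -
    have "(\<integral>x. ?k x y * \<bar>f x - f y\<bar>\<^sup>2 \<partial>lebesgue_on \<Omega>) = (\<integral>x. indicator \<Omega> x * (?k x y * \<bar>f x - f y\<bar>\<^sup>2) \<partial>lborel)" for y
      by (intro integral_lebesgue_on_borel) measurable
    then have "(\<integral>y. (\<integral>x. ?k x y * \<bar>f x - f y\<bar>\<^sup>2 \<partial>lebesgue_on \<Omega>) \<partial>lebesgue_on \<Omega>) =
      (\<integral>y. (\<integral>x. indicator \<Omega> x * (?k x y * \<bar>f x - f y\<bar>\<^sup>2) \<partial>lborel) \<partial>lebesgue_on \<Omega>)" by simp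
    also have "\<dots> = (\<integral>y. indicator \<Omega> y * (\<integral>x. indicator \<Omega> x * (?k x y * \<bar>f x - f y\<bar>\<^sup>2) \<partial>lborel) \<partial>lborel)"
      by (intro integral_lebesgue_on_borel) measurable
    also have "\<dots> = (\<integral>y. I y \<partial>lborel)" by (simp add: I_def G_def)
    finally show ?thesis .
  qed
  have "increment_energy \<Omega> (\<eta> * \<delta>) f = (\<integral>\<^sup>+y. \<integral>\<^sup>+x. indicator \<Omega> y * indicator \<Omega> x * indicator {..\<eta> * \<delta>} (dist y x) *
      ennreal ((f y - f x)\<^sup>2) \<partial>lborel \<partial>lborel)"
    unfolding increment_energy_def ..
  also have "\<dots> \<le> (\<integral>\<^sup>+y. \<integral>\<^sup>+x. ennreal (?D * G y x) \<partial>lborel \<partial>lborel)"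
  proof (intro nn_integral_mono)
    fix y x :: 'a
    show "indicator \<Omega> y * indicator \<Omega> x * indicator {..\<eta> * \<delta>} (dist y x) * ennreal ((f y - f x)\<^sup>2) \<le> ennreal (?D * G y x)"
    proof (cases "y \<in> \<Omega> \<and> x \<in> \<Omega> \<and> dist y x \<le> \<eta> * \<delta>")
      case True
      have "norm (x - y) \<le> \<eta> * \<delta>" using True by (simp add: dist_norm norm_minus_commute)
      then have "(norm (x - y))\<^sup>2 \<le> (\<eta> * \<delta>)\<^sup>2" by (rule power_mono) simp
      then have "(norm (x - y))\<^sup>2 / \<delta>\<^sup>2 \<le> \<eta>\<^sup>2" using \<delta> by (simp add: field_simps power_mult_distrib)
      then have "\<kappa> \<le> R ((norm (x - y))\<^sup>2 / \<delta>\<^sup>2)" using lower(3) by simp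
      then have "1 \<le> ?D * ?k x y" using \<delta> lower by (simp add: scaled_kernel_def field_simps)
      then have "1 * (f y - f x)\<^sup>2 \<le> ?D * ?k x y * (f y - f x)\<^sup>2" by (rule mult_right_mono) simp
      then have "(f y - f x)\<^sup>2 \<le> ?D * G y x" using True by (simp add: G_def power2_commute mult.assoc)
      then show ?thesis using True by (simp add: ennreal_leI)
    next
      case False
      then show ?thesis by (auto simp: indicator_def)
    qed
  qed
  also have "\<dots> = (\<integral>\<^sup>+y. ennreal (?D * I y) \<partial>lborel)"
  proof (rule nn_integral_cong)
    fix y
    have "(\<integral>\<^sup>+x. ennreal (?D * G y x) \<partial>lborel) = ennreal (\<integral>x. ?D * G y x \<partial>lborel)"
      using inner[of y] G0 \<delta> lower by (intro nn_integral_eq_integral) auto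
    then show "(\<integral>\<^sup>+x. ennreal (?D * G y x) \<partial>lborel) = ennreal (?D * I y)" by (simp add: I_def)
  qed
  also have "\<dots> = ennreal (\<integral>y. ?D * I y \<partial>lborel)"
    using I_int I0 \<delta> lower by (intro nn_integral_eq_integral) auto
  finally show ?thesis unfolding conv by simp
qed

text \<open>
  The diagonal term \<open>u y\<close> is constant in the inner integral, so null sets of \<open>y\<close> are discarded
  only in the outer integral, where measurability needs the product measure.
\<close>

lemma nonlocal_integral_cong:
  fixes u f :: "'a::euclidean_space \<Rightarrow> real"
  assumes \<Omega>: "open \<Omega>" "bounded \<Omega>" and K: "admissible_kernel K" "0 < \<delta>"
    and u [measurable]: "u \<in> borel_measurable (lebesgue_on \<Omega>)"
    and f [measurable]: "f \<in> borel_measurable (lebesgue_on \<Omega>)"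
    and AE: "AE x in lebesgue_on \<Omega>. u x = f x"
  shows "kernel_form d \<Omega> K \<delta> u =
    kernel_form d \<Omega> K \<delta> f"
proof -
  interpret finite_measure "lebesgue_on \<Omega>" by (rule finite_measure_lebesgue_on_bounded[OF \<Omega>])
  note [measurable] = scaled_kernel_measurable[OF K]
  have ident [measurable]: "(\<lambda>x. x) \<in> borel_measurable (lebesgue_on \<Omega>)"
    by (intro measurable_restrict_space1 measurable_completion) simp
  have diff [measurable]: "(\<lambda>p. snd p - fst p :: 'a) \<in> borel_measurable (lebesgue_on \<Omega> \<Otimes>\<^sub>M lebesgue_on \<Omega>)"
    by (intro borel_measurable_diff measurable_compose[OF measurable_snd ident] measurable_compose[OF measurable_fst ident])
  have meas: "(\<lambda>y. \<integral>x. scaled_kernel d K \<delta> (norm (x - y)) * \<bar>v x - v y\<bar>\<^sup>2 \<partial>lebesgue_on \<Omega>) \<in> borel_measurable (lebesgue_on \<Omega>)"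
    if [measurable]: "v \<in> borel_measurable (lebesgue_on \<Omega>)" for v :: "'a \<Rightarrow> real"
  proof (rule borel_measurable_lebesgue_integral)
    have "(\<lambda>p. scaled_kernel d K \<delta> (norm (snd p - fst p)) * \<bar>v (snd p) - v (fst p)\<bar>\<^sup>2)
        \<in> borel_measurable (lebesgue_on \<Omega> \<Otimes>\<^sub>M lebesgue_on \<Omega>)"
      by (intro borel_measurable_times borel_measurable_power borel_measurable_abs borel_measurable_diff
          scaled_kernel_measurable[OF K] measurable_compose[OF diff borel_measurable_norm]
          measurable_compose[OF measurable_snd that] measurable_compose[OF measurable_fst that])
    then show "(\<lambda>(y, x). scaled_kernel d K \<delta> (norm (x - y)) * \<bar>v x - v y\<bar>\<^sup>2)
        \<in> borel_measurable (lebesgue_on \<Omega> \<Otimes>\<^sub>M lebesgue_on \<Omega>)" by (simp add: split_def)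
  qed
  show ?thesis
  proof (rule integral_cong_AE[OF meas[OF u] meas[OF f]])
    show "AE y in lebesgue_on \<Omega>.
        (\<integral>x. scaled_kernel d K \<delta> (norm (x - y)) * \<bar>u x - u y\<bar>\<^sup>2 \<partial>lebesgue_on \<Omega>) =
        (\<integral>x. scaled_kernel d K \<delta> (norm (x - y)) * \<bar>f x - f y\<bar>\<^sup>2 \<partial>lebesgue_on \<Omega>)"
      using AE
    proof eventually_elim
      case (elim y)
      have k: "(\<lambda>x. scaled_kernel d K \<delta> (norm (x - y))) \<in> borel_measurable (lebesgue_on \<Omega>)"
        by (intro scaled_kernel_measurable[OF K] measurable_compose[OF _ borel_measurable_norm] borel_measurable_diff ident) simp
      show ?case
        using AE elim
        by (intro integral_cong_AE borel_measurable_times k borel_measurable_power borel_measurable_abs borel_measurable_diff u f)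
          (auto elim: eventually_mono)
    qed
  qed
qed

lemma continuous_kernel_integral:
  fixes h :: "'a::euclidean_space \<Rightarrow> real"
  assumes K: "admissible_kernel K" and \<delta>: "0 < \<delta>" and h: "integrable lborel h"
  shows "continuous_on UNIV (\<lambda>x. \<integral>y. scaled_kernel d K \<delta> (norm (x - y)) * h y \<partial>lborel)"
  unfolding continuous_on_sequentially
proof (intro allI ballI impI)
  fix xs :: "nat \<Rightarrow> 'a" and x assume "(\<forall>n. xs n \<in> UNIV) \<and> xs \<longlonglongrightarrow> x"
  then have xs: "xs \<longlonglongrightarrow> x" by simp
  note [measurable] = scaled_kernel_measurable[OF K \<delta>]
  have hm [measurable]: "h \<in> borel_measurable borel" using borel_measurable_integrable[OF h] by simp
  have "(\<lambda>n. \<integral>y. scaled_kernel d K \<delta> (norm (xs n - y)) * h y \<partial>lborel) \<longlonglongrightarrow>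
      (\<integral>y. scaled_kernel d K \<delta> (norm (x - y)) * h y \<partial>lborel)"
  proof (rule integral_dominated_convergence[where w = "\<lambda>y. K 0 / \<delta> ^ d * \<bar>h y\<bar>"])
    show "integrable lborel (\<lambda>y. K 0 / \<delta> ^ d * \<bar>h y\<bar>)" using h by (intro integrable_mult_right integrable_abs)
    show "AE y in lborel. (\<lambda>n. scaled_kernel d K \<delta> (norm (xs n - y)) * h y) \<longlonglongrightarrow> scaled_kernel d K \<delta> (norm (x - y)) * h y"
    proof (intro AE_I2 tendsto_mult tendsto_const)
      fix y
      have "isCont (scaled_kernel d K \<delta>) (norm (x - y))"
        using continuous_scaled_kernel[OF K \<delta>, of d] by (simp add: continuous_on_eq_continuous_at)
      then show "(\<lambda>n. scaled_kernel d K \<delta> (norm (xs n - y))) \<longlonglongrightarrow> scaled_kernel d K \<delta> (norm (x - y))"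
        by (rule isCont_tendsto_compose) (intro tendsto_intros xs)
    qed
    show "AE y in lborel. norm (scaled_kernel d K \<delta> (norm (xs n - y)) * h y) \<le> K 0 / \<delta> ^ d * \<bar>h y\<bar>" for n
    proof (intro AE_I2)
      fix y
      have "\<bar>scaled_kernel d K \<delta> (norm (xs n - y))\<bar> * \<bar>h y\<bar> \<le> K 0 / \<delta> ^ d * \<bar>h y\<bar>"
        using scaled_kernel_bounds[OF K \<delta>, of d] by (intro mult_right_mono) auto
      then show "norm (scaled_kernel d K \<delta> (norm (xs n - y)) * h y) \<le> K 0 / \<delta> ^ d * \<bar>h y\<bar>"
        by (simp only: real_norm_def abs_mult)
    qed
  qed measurable
  then show "((\<lambda>x. \<integral>y. scaled_kernel d K \<delta> (norm (x - y)) * h y \<partial>lborel) \<circ> xs) \<longlonglongrightarrow>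
      (\<integral>y. scaled_kernel d K \<delta> (norm (x - y)) * h y \<partial>lborel)" by (simp add: o_def)
qed

text \<open>
  Finitely many charts cover the boundary, and in each the upper bound for graphs applies.
\<close>

lemma hausdorff_frontier_finite:
  fixes \<Omega> :: "'a::euclidean_space set"
  assumes \<Omega>: "bounded_lipschitz_domain \<Omega>"
  shows "emeasure (hausdorff_measure (DIM('a) - 1)) (frontier \<Omega>) < \<infinity>"
proof -
  let ?H = "hausdorff_measure (DIM('a) - 1) :: 'a measure"
  have o: "open \<Omega>" and lip: "lipschitz_boundary \<Omega>" and bdd: "bounded \<Omega>"
    using \<Omega> by (auto simp: bounded_lipschitz_domain_def)
  have "\<forall>x. \<exists>r. x \<in> frontier \<Omega> \<longrightarrow> 0 < r \<and> emeasure ?H (frontier \<Omega> \<inter> ball x r) < \<infinity>"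
  proof (intro allI)
    fix x
    show "\<exists>r. x \<in> frontier \<Omega> \<longrightarrow> 0 < r \<and> emeasure ?H (frontier \<Omega> \<inter> ball x r) < \<infinity>"
    proof (cases "x \<in> frontier \<Omega>")
      case True
      obtain \<phi> \<nu> \<Lambda> r where "boundary_chart \<phi> \<nu> \<Lambda> \<Omega> x r"
        using lipschitz_boundary_chart[OF o lip True] by blast
      then interpret boundary_chart \<phi> \<nu> \<Lambda> \<Omega> x r .
      have "emeasure ?H (frontier \<Omega> \<inter> ball x r) \<le>
          ennreal (unit_ball_vol (real (DIM('a) - 1)) * ((8 * \<Lambda>) ^ DIM('a) * r ^ (DIM('a) - 1)))"
        using closed_graph r_pos unfolding frontier_eq_graph
        by (intro emeasure_hausdorff_graph_le[where y = x]) (auto intro!: sets.Int)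
      then have "emeasure ?H (frontier \<Omega> \<inter> ball x r) < \<infinity>" by (rule le_less_trans) simp
      then show ?thesis using r_pos by blast
    qed simp
  qed
  from choice[OF this] obtain \<rho> where \<rho>: "\<forall>x. x \<in> frontier \<Omega> \<longrightarrow> 0 < \<rho> x \<and> emeasure ?H (frontier \<Omega> \<inter> ball x (\<rho> x)) < \<infinity>" ..
  obtain I where I: "I \<subseteq> frontier \<Omega>" "finite I" "frontier \<Omega> \<subseteq> (\<Union>x\<in>I. ball x (\<rho> x))"
    using compact_ball_cover[OF compact_frontier_bounded[OF bdd], of \<rho>] \<rho> by blast
  have meas: "frontier \<Omega> \<inter> ball x (\<rho> x) \<in> sets ?H" for x
    unfolding sets_hausdorff_measure by (intro sets.Int borel_closed borel_open) auto
  have "emeasure ?H (frontier \<Omega>) \<le> emeasure ?H (\<Union>x\<in>I. frontier \<Omega> \<inter> ball x (\<rho> x))"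
    by (rule emeasure_mono) (use I(3) sets.finite_UN[OF I(2) meas] in auto)
  also have "\<dots> \<le> (\<Sum>x\<in>I. emeasure ?H (frontier \<Omega> \<inter> ball x (\<rho> x)))"
    by (rule emeasure_subadditive_finite[OF I(2)]) (use meas in blast)
  also have "\<dots> < \<infinity>" using I \<rho> by (auto simp: less_top[symmetric])
  finally show ?thesis .
qed

text \<open>
  The Bochner integral of a function that is not integrable is \<open>0\<close>, so the coercivity inequality
  says something about \<open>w\<close> only because \<open>w\<close> is bounded on the compact boundary and the surface
  measure is finite.
\<close>

lemma surface_square_integral:
  fixes \<Omega> :: "'a::euclidean_space set" and w :: "'a \<Rightarrow> real"
  assumes \<Omega>: "bounded_lipschitz_domain \<Omega>" and w: "w \<in> borel_measurable borel" "continuous_on (frontier \<Omega>) w"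
  shows "(\<integral>\<^sup>+x. indicator (frontier \<Omega>) x * ennreal ((w x)\<^sup>2) \<partial>hausdorff_measure (DIM('a) - 1)) =
    ennreal (\<integral>x. (w x)\<^sup>2 \<partial>surface_measure \<Omega>)"
proof -
  let ?H = "hausdorff_measure (DIM('a) - 1) :: 'a measure"
  let ?M = "restrict_space ?H (frontier \<Omega>)"
  have wH: "(\<lambda>x. (w x)\<^sup>2) \<in> borel_measurable ?H" using w(1) by simp
  then have wM: "(\<lambda>x. (w x)\<^sup>2) \<in> borel_measurable ?M" by (rule measurable_restrict_space1)
  have fr: "frontier \<Omega> \<in> sets ?H" by (simp add: borel_closed)
  interpret finite_measure ?M
    using hausdorff_frontier_finite[OF \<Omega>] fr
    by (intro finite_measureI) (simp add: emeasure_restrict_space space_restrict_space less_top[symmetric])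
  have "bounded \<Omega>" using \<Omega> by (simp add: bounded_lipschitz_domain_def)
  then have "compact (w ` frontier \<Omega>)"
    by (intro compact_continuous_image w(2) compact_frontier_bounded)
  then obtain B where B: "\<And>x. x \<in> frontier \<Omega> \<Longrightarrow> \<bar>w x\<bar> \<le> B"
    using compact_imp_bounded[of "w ` frontier \<Omega>"] unfolding bounded_iff by auto
  have int: "integrable ?M (\<lambda>x. (w x)\<^sup>2)"
  proof (rule integrable_const_bound[where B = "B\<^sup>2", OF AE_I2 wM])
    fix x assume "x \<in> space ?M"
    then have "\<bar>w x\<bar> \<le> B" using B by (simp add: space_restrict_space)
    then show "norm ((w x)\<^sup>2) \<le> B\<^sup>2" by (simp add: abs_le_square_iff[symmetric])
  qed
  have "(\<integral>\<^sup>+x. indicator (frontier \<Omega>) x * ennreal ((w x)\<^sup>2) \<partial>?H) = (\<integral>\<^sup>+x. ennreal ((w x)\<^sup>2) \<partial>?M)"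
    using fr by (subst nn_integral_restrict_space) (auto simp: mult.commute)
  also have "\<dots> = ennreal (\<integral>x. (w x)\<^sup>2 \<partial>?M)" by (rule nn_integral_eq_integral[OF int]) simp
  also have "(\<integral>x. (w x)\<^sup>2 \<partial>?M) = (\<integral>x. (w x)\<^sup>2 \<partial>surface_measure \<Omega>)"
    unfolding surface_measure_def by (rule integral_completion[OF wM, symmetric])
  finally show ?thesis .
qed

lemma kernel_mass_lborel:
  fixes \<Omega> :: "'a::euclidean_space set"
  assumes "open \<Omega>" "admissible_kernel K" "0 < \<delta>"
  shows "kernel_mass \<Omega> K \<delta> x = (\<integral>y. scaled_kernel DIM('a) K \<delta> (norm (x - y)) * indicator \<Omega> y \<partial>lborel)"
proof -
  note [measurable] = scaled_kernel_measurable[OF assms(2,3)]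
  show ?thesis unfolding kernel_mass_def
    by (subst integral_lebesgue_on_borel) (use assms(1) in \<open>auto simp: mult.commute\<close>)
qed

lemma kernel_average_lborel:
  fixes \<Omega> :: "'a::euclidean_space set" and f u :: "'a \<Rightarrow> real"
  assumes \<Omega>: "open \<Omega>" and K: "admissible_kernel K" "0 < \<delta>" and f [measurable]: "f \<in> borel_measurable borel"
    and u: "u \<in> borel_measurable (lebesgue_on \<Omega>)" and AE: "AE x in lebesgue_on \<Omega>. u x = f x"
  shows "kernel_average \<Omega> K \<delta> u x =
    (\<integral>y. scaled_kernel DIM('a) K \<delta> (norm (x - y)) * (indicator \<Omega> y * f y) \<partial>lborel) / kernel_mass \<Omega> K \<delta> x"
proof -
  note [measurable] = scaled_kernel_measurable[OF K]
  have [measurable]: "\<Omega> \<in> sets borel" using \<Omega> by simp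
  have lift: "g \<in> borel_measurable (lebesgue_on \<Omega>)" if "g \<in> borel_measurable borel" for g :: "'a \<Rightarrow> real"
    by (intro measurable_restrict_space1 measurable_completion) (use that in simp)
  have "(\<integral>y. scaled_kernel DIM('a) K \<delta> (norm (x - y)) * u y \<partial>lebesgue_on \<Omega>) =
      (\<integral>y. scaled_kernel DIM('a) K \<delta> (norm (x - y)) * f y \<partial>lebesgue_on \<Omega>)"
    using AE by (intro integral_cong_AE borel_measurable_times lift u) (measurable, auto elim: eventually_mono)
  also have "\<dots> = (\<integral>y. indicator \<Omega> y * (scaled_kernel DIM('a) K \<delta> (norm (x - y)) * f y) \<partial>lborel)"
    by (intro integral_lebesgue_on_borel) measurable
  also have "\<dots> = (\<integral>y. scaled_kernel DIM('a) K \<delta> (norm (x - y)) * (indicator \<Omega> y * f y) \<partial>lborel)"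
    by (simp add: mult_ac)
  finally show ?thesis by (simp add: kernel_average_def)
qed

lemma kernel_times_integrable:
  fixes h :: "'a::euclidean_space \<Rightarrow> real"
  assumes K: "admissible_kernel K" "0 < \<delta>" and h: "integrable lborel h"
  shows "integrable lborel (\<lambda>y. scaled_kernel d K \<delta> (norm (x - y)) * h y)"
proof (rule Bochner_Integration.integrable_bound)
  note [measurable] = scaled_kernel_measurable[OF K]
  show "integrable lborel (\<lambda>y. K 0 / \<delta> ^ d * h y)" using h by (rule integrable_mult_right)
  show "(\<lambda>y. scaled_kernel d K \<delta> (norm (x - y)) * h y) \<in> borel_measurable lborel"
    using borel_measurable_integrable[OF h] by measurable
  show "AE y in lborel. norm (scaled_kernel d K \<delta> (norm (x - y)) * h y) \<le> norm (K 0 / \<delta> ^ d * h y)"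
  proof (rule AE_I2)
    fix y
    have "\<bar>scaled_kernel d K \<delta> (norm (x - y))\<bar> \<le> \<bar>K 0 / \<delta> ^ d\<bar>"
      using scaled_kernel_bounds[OF K, of d "norm (x - y)"] by linarith
    then have "\<bar>scaled_kernel d K \<delta> (norm (x - y))\<bar> * \<bar>h y\<bar> \<le> \<bar>K 0 / \<delta> ^ d\<bar> * \<bar>h y\<bar>"
      by (rule mult_right_mono) simp
    then show "norm (scaled_kernel d K \<delta> (norm (x - y)) * h y) \<le> norm (K 0 / \<delta> ^ d * h y)"
      by (simp only: real_norm_def abs_mult)
  qed
qed

lemma kernel_mass_lower:
  fixes \<Omega> :: "'a::euclidean_space set"
  assumes \<Omega>: "open \<Omega>" "bounded \<Omega>" and K: "admissible_kernel K" "0 < \<delta>"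
    and lower: "0 < \<kappa>" "\<And>s. 0 \<le> s \<Longrightarrow> s \<le> \<eta>\<^sup>2 \<Longrightarrow> \<kappa> \<le> K s"
    and b: "0 \<le> b" "ball z b \<subseteq> \<Omega>" "ball z b \<subseteq> cball x (\<eta> * \<delta>)"
  shows "\<kappa> / \<delta> ^ DIM('a) * (unit_ball_vol (real DIM('a)) * b ^ DIM('a)) \<le> kernel_mass \<Omega> K \<delta> x"
proof -
  have fin: "emeasure lborel \<Omega> < \<infinity>" by (rule emeasure_bounded_finite[OF \<Omega>(2)])
  have "\<kappa> / \<delta> ^ DIM('a) * (unit_ball_vol (real DIM('a)) * b ^ DIM('a)) =
      (\<integral>y. \<kappa> / \<delta> ^ DIM('a) * indicator (ball z b) y \<partial>lborel)"
    using b(1) by (simp add: content_ball)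
  also have "\<dots> \<le> (\<integral>y. scaled_kernel DIM('a) K \<delta> (norm (x - y)) * indicator \<Omega> y \<partial>lborel)"
  proof (rule integral_mono)
    show "integrable lborel (\<lambda>y. \<kappa> / \<delta> ^ DIM('a) * indicator (ball z b) y)"
      by (intro integrable_mult_right integrable_real_indicator emeasure_bounded_finite) auto
    show "integrable lborel (\<lambda>y. scaled_kernel DIM('a) K \<delta> (norm (x - y)) * indicator \<Omega> y)"
      using \<Omega> fin by (intro kernel_times_integrable K integrable_real_indicator) auto
    fix y
    show "\<kappa> / \<delta> ^ DIM('a) * indicator (ball z b) y \<le> scaled_kernel DIM('a) K \<delta> (norm (x - y)) * indicator \<Omega> y"
    proof (cases "y \<in> ball z b")
      case True
      then have "norm (x - y) \<le> \<eta> * \<delta>" using b(3) by (auto simp: dist_norm)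
      then have "(norm (x - y))\<^sup>2 \<le> (\<eta> * \<delta>)\<^sup>2" by (rule power_mono) simp
      then have "(norm (x - y))\<^sup>2 / \<delta>\<^sup>2 \<le> \<eta>\<^sup>2" using K(2) by (simp add: field_simps power_mult_distrib)
      then have "\<kappa> \<le> K ((norm (x - y))\<^sup>2 / \<delta>\<^sup>2)" using lower(2) by simp
      then have "\<kappa> / \<delta> ^ DIM('a) \<le> scaled_kernel DIM('a) K \<delta> (norm (x - y))"
        using K(2) by (simp add: scaled_kernel_def divide_right_mono)
      then show ?thesis using True b(2) by auto
    next
      case False
      then show ?thesis using scaled_kernel_bounds(1)[OF K] by simp
    qed
  qed
  also have "\<dots> = kernel_mass \<Omega> K \<delta> x" by (rule kernel_mass_lborel[OF \<Omega>(1) K, symmetric])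
  finally show ?thesis .
qed

text \<open>
  The kernel mass is positive at boundary points since \<open>\<Omega>\<close> meets every ball around them.
\<close>

lemma kernel_average_regular:
  fixes \<Omega> :: "'a::euclidean_space set" and f u :: "'a \<Rightarrow> real"
  assumes \<Omega>: "open \<Omega>" "bounded \<Omega>" and K: "admissible_kernel K" "\<exists>s\<ge>0. K s \<noteq> 0" "0 < \<delta>"
    and f: "f \<in> borel_measurable borel" "integrable lborel (\<lambda>y. indicator \<Omega> y * f y)"
    and u: "u \<in> borel_measurable (lebesgue_on \<Omega>)" "AE x in lebesgue_on \<Omega>. u x = f x"
  shows "kernel_average \<Omega> K \<delta> u \<in> borel_measurable borel" "continuous_on (frontier \<Omega>) (kernel_average \<Omega> K \<delta> u)"
proof -
  define N where "N x = (\<integral>y. scaled_kernel DIM('a) K \<delta> (norm (x - y)) * (indicator \<Omega> y * f y) \<partial>lborel)" for x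
  have eq: "kernel_average \<Omega> K \<delta> u = (\<lambda>x. N x / kernel_mass \<Omega> K \<delta> x)"
    unfolding N_def by (rule ext) (rule kernel_average_lborel[OF \<Omega>(1) K(1,3) f(1) u])
  have cN: "continuous_on UNIV N"
    unfolding N_def by (rule continuous_kernel_integral[OF K(1,3) f(2)])
  have cM: "continuous_on UNIV (kernel_mass \<Omega> K \<delta>)"
    unfolding kernel_mass_lborel[OF \<Omega>(1) K(1,3), abs_def]
    using \<Omega> by (intro continuous_kernel_integral K(1,3) integrable_real_indicator emeasure_bounded_finite) auto
  show "kernel_average \<Omega> K \<delta> u \<in> borel_measurable borel"
    unfolding eq using cN cM by (intro borel_measurable_divide borel_measurable_continuous_onI)
  obtain \<kappa> \<eta> where lower: "0 < \<kappa>" "0 < \<eta>" "\<forall>s. 0 \<le> s \<longrightarrow> s \<le> \<eta>\<^sup>2 \<longrightarrow> \<kappa> \<le> K s"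
    using admissible_kernel_lower_bound[OF K(1,2)] by blast
  have "kernel_mass \<Omega> K \<delta> x \<noteq> 0" if x: "x \<in> frontier \<Omega>" for x
  proof -
    have "x \<in> closure \<Omega>" using x by (simp add: frontier_def)
    moreover have "0 < \<eta> * \<delta>" using lower K by simp
    ultimately obtain y where y: "y \<in> \<Omega>" "dist y x < \<eta> * \<delta>" by (auto simp: closure_approachable)
    then have "y \<in> \<Omega> \<inter> ball x (\<eta> * \<delta>)" by (simp add: dist_commute)
    moreover have "open (\<Omega> \<inter> ball x (\<eta> * \<delta>))" using \<Omega> by auto
    ultimately obtain b where b: "0 < b" "ball y b \<subseteq> \<Omega> \<inter> ball x (\<eta> * \<delta>)"
      using open_contains_ball by blast
    have "0 < \<kappa> / \<delta> ^ DIM('a) * (unit_ball_vol (real DIM('a)) * b ^ DIM('a))" using lower K b by simp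
    also have "\<dots> \<le> kernel_mass \<Omega> K \<delta> x"
      using lower b by (intro kernel_mass_lower[OF \<Omega> K(1,3)]) (auto simp: subset_iff)
    finally show ?thesis by simp
  qed
  then show "continuous_on (frontier \<Omega>) (kernel_average \<Omega> K \<delta> u)"
    unfolding eq using cN cM by (intro continuous_on_divide) (auto intro: continuous_on_subset)
qed

text \<open>
  The weights of the kernel average integrate to \<open>1\<close>, so \<open>m - w\<close> is the average of \<open>m - f\<close>.
\<close>

lemma constant_le_kernel_average:
  fixes \<Omega> :: "'a::euclidean_space set" and f u :: "'a \<Rightarrow> real"
  assumes \<Omega>: "open \<Omega>" "bounded \<Omega>" and K: "admissible_kernel K" "0 < \<delta>"
    and supp: "\<And>s. 0 \<le> s \<Longrightarrow> K s \<noteq> 0 \<Longrightarrow> s \<le> r\<^sup>2" "0 < r"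
    and mass: "0 < \<omega>" "\<omega> \<le> kernel_mass \<Omega> K \<delta> x"
    and f: "f \<in> borel_measurable borel" "integrable lborel (\<lambda>y. indicator \<Omega> y * f y)"
    and u: "u \<in> borel_measurable (lebesgue_on \<Omega>)" "AE x in lebesgue_on \<Omega>. u x = f x"
  shows "ennreal \<bar>m\<bar> \<le> ennreal \<bar>kernel_average \<Omega> K \<delta> u x\<bar> + ennreal (K 0 / (\<delta> ^ DIM('a) * \<omega>)) *
    near_oscillation \<Omega> (r * \<delta>) f m x"
proof -
  let ?k = "\<lambda>y. scaled_kernel DIM('a) K \<delta> (norm (x - y))"
  note [measurable] = scaled_kernel_measurable[OF K] f(1)
  have [measurable]: "\<Omega> \<in> sets borel" using \<Omega> by simp
  define \<mu> where "\<mu> = kernel_mass \<Omega> K \<delta> x"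
  have \<mu>: "0 < \<mu>" "\<omega> \<le> \<mu>" using mass by (auto simp: \<mu>_def)
  have \<Omega>i: "integrable lborel (indicator \<Omega> :: 'a \<Rightarrow> real)"
    using \<Omega> by (intro integrable_real_indicator emeasure_bounded_finite) auto
  have i1: "integrable lborel (\<lambda>y. ?k y * indicator \<Omega> y)" by (rule kernel_times_integrable[OF K \<Omega>i])
  have i2: "integrable lborel (\<lambda>y. ?k y * (indicator \<Omega> y * f y))" by (rule kernel_times_integrable[OF K f(2)])
  define w where "w = kernel_average \<Omega> K \<delta> u x"
  define J where "J = (\<integral>y. m * (?k y * indicator \<Omega> y) - ?k y * (indicator \<Omega> y * f y) \<partial>lborel)"
  have "J = m * \<mu> - w * \<mu>"
  proof -
    have "J = m * (\<integral>y. ?k y * indicator \<Omega> y \<partial>lborel) - (\<integral>y. ?k y * (indicator \<Omega> y * f y) \<partial>lborel)"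
      unfolding J_def using i1 i2 by (subst Bochner_Integration.integral_diff) auto
    moreover have "(\<integral>y. ?k y * indicator \<Omega> y \<partial>lborel) = \<mu>"
      unfolding \<mu>_def by (rule kernel_mass_lborel[OF \<Omega>(1) K, symmetric])
    moreover have "w = (\<integral>y. ?k y * (indicator \<Omega> y * f y) \<partial>lborel) / \<mu>"
      unfolding w_def \<mu>_def by (rule kernel_average_lborel[OF \<Omega>(1) K f(1) u])
    then have "w * \<mu> = (\<integral>y. ?k y * (indicator \<Omega> y * f y) \<partial>lborel)" using \<mu>(1) by simp
    ultimately show ?thesis by (simp only:)
  qed
  then have "m = w + J / \<mu>" using \<mu> by (simp add: field_simps)
  then have "\<bar>m\<bar> \<le> \<bar>w\<bar> + \<bar>J\<bar> / \<mu>" using \<mu> by (metis abs_divide abs_of_pos abs_triangle_ineq)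
  also have "\<dots> \<le> \<bar>w\<bar> + 1 / \<omega> * \<bar>J\<bar>"
    using mass \<mu> by (simp add: divide_left_mono)
  finally have "ennreal \<bar>m\<bar> \<le> ennreal (\<bar>w\<bar> + 1 / \<omega> * \<bar>J\<bar>)" by (rule ennreal_leI)
  also have "\<dots> = ennreal \<bar>w\<bar> + ennreal (1 / \<omega>) * ennreal \<bar>J\<bar>"
    using mass by (simp add: ennreal_plus ennreal_mult[symmetric])
  also have "ennreal \<bar>J\<bar> \<le> (\<integral>\<^sup>+y. ennreal \<bar>m * (?k y * indicator \<Omega> y) - ?k y * (indicator \<Omega> y * f y)\<bar> \<partial>lborel)"
    using integral_norm_bound_ennreal[of lborel "\<lambda>y. m * (?k y * indicator \<Omega> y) - ?k y * (indicator \<Omega> y * f y)"] i1 i2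
    unfolding J_def by simp
  also have "\<dots> \<le> (\<integral>\<^sup>+y. ennreal (K 0 / \<delta> ^ DIM('a)) *
      (indicator \<Omega> y * indicator {..r * \<delta>} (dist x y) * ennreal \<bar>f y - m\<bar>) \<partial>lborel)"
  proof (rule nn_integral_mono)
    fix y
    show "ennreal \<bar>m * (?k y * indicator \<Omega> y) - ?k y * (indicator \<Omega> y * f y)\<bar> \<le> ennreal (K 0 / \<delta> ^ DIM('a)) *
      (indicator \<Omega> y * indicator {..r * \<delta>} (dist x y) * ennreal \<bar>f y - m\<bar>)"
    proof (cases "y \<in> \<Omega> \<and> ?k y \<noteq> 0")
      case True
      then have "K ((norm (x - y))\<^sup>2 / \<delta>\<^sup>2) \<noteq> 0" by (auto simp: scaled_kernel_def)
      then have "(norm (x - y))\<^sup>2 / \<delta>\<^sup>2 \<le> r\<^sup>2" by (intro supp) auto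
      then have "(norm (x - y))\<^sup>2 \<le> (r * \<delta>)\<^sup>2" using K(2) by (simp add: field_simps power_mult_distrib)
      then have d: "dist x y \<le> r * \<delta>" unfolding dist_norm by (rule power2_le_imp_le) (use supp(2) K(2) in simp)
      have "\<bar>m * ?k y - ?k y * f y\<bar> = ?k y * \<bar>f y - m\<bar>"
      proof -
        have "m * ?k y - ?k y * f y = - (?k y * (f y - m))" by (simp add: algebra_simps)
        then have "\<bar>m * ?k y - ?k y * f y\<bar> = \<bar>?k y * (f y - m)\<bar>" by (simp only: abs_minus_cancel)
        then show ?thesis by (simp only: abs_mult abs_of_nonneg[OF scaled_kernel_bounds(1)[OF K]])
      qed
      also have "\<dots> \<le> K 0 / \<delta> ^ DIM('a) * \<bar>f y - m\<bar>"
        by (intro mult_right_mono scaled_kernel_bounds(2)[OF K]) simp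
      finally have "ennreal \<bar>m * ?k y - ?k y * f y\<bar> \<le> ennreal (K 0 / \<delta> ^ DIM('a) * \<bar>f y - m\<bar>)" by (rule ennreal_leI)
      also have "\<dots> = ennreal (K 0 / \<delta> ^ DIM('a)) * ennreal \<bar>f y - m\<bar>"
        using admissible_kernelD(1)[OF K(1), of 0] K(2) by (intro ennreal_mult) auto
      finally show ?thesis using True d by simp
    next
      case False
      then have "\<bar>m * (?k y * indicator \<Omega> y) - ?k y * (indicator \<Omega> y * f y)\<bar> = 0" by (auto simp: indicator_def)
      then show ?thesis by (simp only:) simp
    qed
  qed
  also have "\<dots> = ennreal (K 0 / \<delta> ^ DIM('a)) *
      near_oscillation \<Omega> (r * \<delta>) f m x"
    by (rule nn_integral_cmult) measurable
  finally have "ennreal \<bar>m\<bar> \<le> ennreal \<bar>w\<bar> + ennreal (1 / \<omega>) * (ennreal (K 0 / \<delta> ^ DIM('a)) *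
      near_oscillation \<Omega> (r * \<delta>) f m x)"
    by (simp add: add_left_mono mult_left_mono)
  also have "\<dots> = ennreal \<bar>w\<bar> + ennreal (K 0 / (\<delta> ^ DIM('a) * \<omega>)) *
      near_oscillation \<Omega> (r * \<delta>) f m x"
  proof -
    have "ennreal (1 / \<omega>) * ennreal (K 0 / \<delta> ^ DIM('a)) = ennreal (K 0 / (\<delta> ^ DIM('a) * \<omega>))"
      using mass admissible_kernelD(1)[OF K(1), of 0] K(2) by (simp add: ennreal_mult[symmetric] mult.commute)
    then show ?thesis by (simp only: mult.assoc[symmetric])
  qed
  finally show ?thesis by (simp add: w_def)
qed

section \<open>The compactness theorem\<close>

text \<open>
  Translation arguments need functions on the whole space and the product of Borel measures; a
  Borel representative on \<open>\<Omega>\<close> provides this without changing any of the integrals.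
\<close>

lemma L2_borel_representative:
  fixes u :: "'a::euclidean_space \<Rightarrow> real"
  assumes \<Omega>: "open \<Omega>" "bounded \<Omega>" and u: "u \<in> L2 \<Omega>"
  shows "\<exists>f. f \<in> borel_measurable borel \<and> (AE x in lebesgue_on \<Omega>. u x = f x) \<and>
    integrable lborel (\<lambda>x. indicator \<Omega> x * (f x)\<^sup>2) \<and> integrable lborel (\<lambda>x. indicator \<Omega> x * f x) \<and>
    square_mass \<Omega> f = ennreal ((L2_norm \<Omega> u)\<^sup>2)"
proof -
  have \<Omega>b [measurable]: "\<Omega> \<in> sets borel" using \<Omega> by simp
  have um: "u \<in> borel_measurable (lebesgue_on \<Omega>)" and ui: "integrable (lebesgue_on \<Omega>) (\<lambda>x. (u x)\<^sup>2)"
    using u by (auto simp: L2_def)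
  obtain f where f [measurable]: "f \<in> borel_measurable borel" and AE: "AE x in lebesgue_on \<Omega>. u x = f x"
    using ex_borel_representative[OF \<Omega>b um] by blast
  have f2m: "(\<lambda>x. (f x)\<^sup>2) \<in> borel_measurable (lebesgue_on \<Omega>)"
    by (intro measurable_restrict_space1 measurable_completion) measurable
  have AE2: "AE x in lebesgue_on \<Omega>. (u x)\<^sup>2 = (f x)\<^sup>2" using AE by eventually_elim simp
  have "integrable (lebesgue_on \<Omega>) (\<lambda>x. (f x)\<^sup>2)"
    by (rule integrable_cong_AE_imp[OF ui f2m]) (use AE2 in \<open>auto elim: eventually_mono\<close>)
  then have "integrable lebesgue (\<lambda>x. indicator \<Omega> x * (f x)\<^sup>2)" by (simp add: integrable_restrict_space)
  then have f2: "integrable lborel (\<lambda>x. indicator \<Omega> x * (f x)\<^sup>2)" by (subst (asm) integrable_completion) auto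
  have f1: "integrable lborel (\<lambda>x. indicator \<Omega> x * f x)"
  proof (rule Bochner_Integration.integrable_bound)
    show "integrable lborel (\<lambda>x. indicator \<Omega> x + indicator \<Omega> x * (f x)\<^sup>2)"
      using \<Omega> by (intro Bochner_Integration.integrable_add f2 integrable_real_indicator emeasure_bounded_finite) auto
    have "\<bar>f x\<bar> \<le> 1 + (f x)\<^sup>2" for x
    proof -
      have "0 \<le> (\<bar>f x\<bar> - 1)\<^sup>2" by simp
      then have "2 * \<bar>f x\<bar> \<le> 1 + (f x)\<^sup>2" by (simp add: power2_eq_square algebra_simps)
      then show ?thesis by linarith
    qed
    then show "AE x in lborel. norm (indicator \<Omega> x * f x) \<le> norm (indicator \<Omega> x + indicator \<Omega> x * (f x)\<^sup>2)"
      by (intro AE_I2) (simp add: indicator_def)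
  qed measurable
  have "square_mass \<Omega> f = (\<integral>\<^sup>+x. ennreal (indicator \<Omega> x * (f x)\<^sup>2) \<partial>lborel)"
    by (intro nn_integral_cong) (simp add: indicator_def)
  also have "\<dots> = ennreal (\<integral>x. indicator \<Omega> x * (f x)\<^sup>2 \<partial>lborel)"
    by (rule nn_integral_eq_integral[OF f2]) (simp add: indicator_def)
  also have "(\<integral>x. indicator \<Omega> x * (f x)\<^sup>2 \<partial>lborel) = (\<integral>x. (f x)\<^sup>2 \<partial>lebesgue_on \<Omega>)"
    by (rule integral_lebesgue_on_borel[symmetric]) measurable
  also have "\<dots> = (\<integral>x. (u x)\<^sup>2 \<partial>lebesgue_on \<Omega>)"
    by (rule integral_cong_AE[OF f2m borel_measurable_integrable[OF ui]])
      (use AE2 in \<open>auto elim: eventually_mono\<close>)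
  also have "\<dots> = (L2_norm \<Omega> u)\<^sup>2" by (simp add: L2_norm_def)
  finally show ?thesis using f AE f1 f2 by blast
qed

text \<open>
  The nonlocal Poincare inequality with boundary term, in qualitative form.
\<close>

lemma L2_norm_tendsto_0:
  fixes u :: "nat \<Rightarrow> 'a::euclidean_space \<Rightarrow> real"
  assumes \<Omega>: "bounded_lipschitz_domain \<Omega>"
    and R: "admissible_kernel R" "\<exists>s\<ge>0. R s \<noteq> 0" and K: "admissible_kernel K" "\<exists>s\<ge>0. K s \<noteq> 0"
    and \<delta>: "\<And>n. 0 < \<delta> n" "\<delta> \<longlonglongrightarrow> 0" and u: "\<And>n. u n \<in> L2 \<Omega>"
    and D: "(\<lambda>n. 1 / (\<delta> n)\<^sup>2 * kernel_form DIM('a) \<Omega> R (\<delta> n) (u n)) \<longlonglongrightarrow> 0" (is "?D \<longlonglongrightarrow> 0")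
    and B: "(\<lambda>n. \<integral>x. (kernel_average \<Omega> K (\<delta> n) (u n) x)\<^sup>2 \<partial>surface_measure \<Omega>) \<longlonglongrightarrow> 0"
  shows "(\<lambda>n. L2_norm \<Omega> (u n)) \<longlonglongrightarrow> 0"
proof -
  have o: "open \<Omega>" and bdd: "bounded \<Omega>" and lip: "lipschitz_boundary \<Omega>" and ne: "\<Omega> \<noteq> {}"
    using \<Omega> by (auto simp: bounded_lipschitz_domain_def)
  have um: "u n \<in> borel_measurable (lebesgue_on \<Omega>)" for n using u[of n] by (simp add: L2_def)
  have "\<forall>n. \<exists>f. f \<in> borel_measurable borel \<and> (AE x in lebesgue_on \<Omega>. u n x = f x) \<and>
    integrable lborel (\<lambda>x. indicator \<Omega> x * (f x)\<^sup>2) \<and> integrable lborel (\<lambda>x. indicator \<Omega> x * f x) \<and>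
    square_mass \<Omega> f = ennreal ((L2_norm \<Omega> (u n))\<^sup>2)"
    using L2_borel_representative[OF o bdd u] by blast
  from choice[OF this] obtain f where f': "\<forall>n. f n \<in> borel_measurable borel \<and> (AE x in lebesgue_on \<Omega>. u n x = f n x) \<and>
    integrable lborel (\<lambda>x. indicator \<Omega> x * (f n x)\<^sup>2) \<and> integrable lborel (\<lambda>x. indicator \<Omega> x * f n x) \<and>
    square_mass \<Omega> (f n) = ennreal ((L2_norm \<Omega> (u n))\<^sup>2)" ..
  have rep: "f n \<in> borel_measurable borel" "AE x in lebesgue_on \<Omega>. u n x = f n x"
    "integrable lborel (\<lambda>x. indicator \<Omega> x * (f n x)\<^sup>2)" "integrable lborel (\<lambda>x. indicator \<Omega> x * f n x)"
    "square_mass \<Omega> (f n) = ennreal ((L2_norm \<Omega> (u n))\<^sup>2)" for n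
    using f' by simp_all
  have fm: "f n \<in> borel_measurable (lebesgue_on \<Omega>)" for n
    by (intro measurable_restrict_space1 measurable_completion) (use rep in simp)
  obtain \<kappa> \<eta> where R_lower: "0 < \<kappa>" "0 < \<eta>" "\<forall>s. 0 \<le> s \<longrightarrow> s \<le> \<eta>\<^sup>2 \<longrightarrow> \<kappa> \<le> R s"
    using admissible_kernel_lower_bound[OF R] by blast
  obtain \<kappa>' \<eta>' where K_lower: "0 < \<kappa>'" "0 < \<eta>'" "\<forall>s. 0 \<le> s \<longrightarrow> s \<le> \<eta>'\<^sup>2 \<longrightarrow> \<kappa>' \<le> K s"
    using admissible_kernel_lower_bound[OF K] by blast
  obtain rK where rK: "0 < rK" "\<forall>s\<ge>0. K s \<noteq> 0 \<longrightarrow> s \<le> rK\<^sup>2"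
    using admissible_kernelD(4)[OF K(1)] by blast
  define \<epsilon> where "\<epsilon> n = \<eta> * \<delta> n" for n
  \<comment> \<open>The summand \<open>1 / (n + 1)\<close> only keeps \<open>g\<close> positive.\<close>
  define g where "g n = ?D n / (\<kappa> * \<eta> ^ (DIM('a) + 2)) + 1 / real (Suc n)" for n
  have D0: "0 \<le> ?D n" for n
    using scaled_kernel_bounds(1)[OF R(1) \<delta>(1)[of n]]
    by (intro mult_nonneg_nonneg Bochner_Integration.integral_nonneg) auto
  have c0: "0 < \<kappa> * \<eta> ^ (DIM('a) + 2)" using R_lower by simp
  have van: "vanishing_increments \<Omega> f \<epsilon> g"
  proof
    show "open \<Omega>" by (rule o)
    show "f n \<in> borel_measurable borel" for n by (rule rep(1))
    show "0 < \<epsilon> n" for n using R_lower \<delta>(1)[of n] by (simp add: \<epsilon>_def)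
    have "(\<lambda>n. \<eta> * \<delta> n) \<longlonglongrightarrow> \<eta> * 0" by (intro tendsto_intros \<delta>(2))
    then show "\<epsilon> \<longlonglongrightarrow> 0" by (simp add: \<epsilon>_def[abs_def])
    show "0 < g n" for n
      unfolding g_def using D0[of n] c0 by (intro add_nonneg_pos divide_nonneg_pos) auto
    have "(\<lambda>n. ?D n / (\<kappa> * \<eta> ^ (DIM('a) + 2)) + 1 / real (Suc n)) \<longlonglongrightarrow> 0 / (\<kappa> * \<eta> ^ (DIM('a) + 2)) + 0"
      using c0 by (intro tendsto_add tendsto_divide D tendsto_const LIMSEQ_Suc lim_1_over_n) auto
    then show "g \<longlonglongrightarrow> 0" by (simp add: g_def[abs_def])
    fix n
    let ?I = "kernel_form DIM('a) \<Omega> R (\<delta> n) (u n)"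
    have dn: "0 < \<delta> n" by (rule \<delta>(1))
    have "increment_energy \<Omega> (\<epsilon> n) (f n) \<le> ennreal (\<delta> n ^ DIM('a) / \<kappa> * ?I)"
      unfolding \<epsilon>_def nonlocal_integral_cong[OF o bdd R(1) dn um fm rep(2)]
      using R_lower by (intro increment_energy_le_nonlocal[OF o bdd R(1) dn _ _ _ rep(1) rep(3)]) auto
    also have "\<dots> \<le> ennreal (g n * \<epsilon> n ^ (DIM('a) + 2))"
    proof (rule ennreal_leI)
      have eta: "0 < \<eta>" "0 < \<kappa>" using R_lower by auto
      have "\<delta> n ^ DIM('a) / \<kappa> * ?I = ?D n / (\<kappa> * \<eta> ^ (DIM('a) + 2)) * \<epsilon> n ^ (DIM('a) + 2)"
        using eta dn by (simp add: \<epsilon>_def power_mult_distrib power_add power2_eq_square)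
      also have "\<dots> \<le> g n * \<epsilon> n ^ (DIM('a) + 2)"
        unfolding g_def using eta dn by (intro mult_right_mono) (auto simp: \<epsilon>_def)
      finally show "\<delta> n ^ DIM('a) / \<kappa> * ?I \<le> g n * \<epsilon> n ^ (DIM('a) + 2)" .
    qed
    finally show "increments_le \<Omega> (\<epsilon> n) (g n) (f n)" .
  qed
  interpret vanishing_increments \<Omega> f \<epsilon> g by (rule van)
  have "frontier \<Omega> \<noteq> {}"
    using ne bdd frontier_eq_empty not_bounded_UNIV by metis
  then obtain p where p: "p \<in> frontier \<Omega>" by blast
  obtain \<phi> \<nu> \<Lambda> r where "boundary_chart \<phi> \<nu> \<Lambda> \<Omega> p r"
    using lipschitz_boundary_chart[OF o lip p] by blast
  then interpret chart_sequence \<phi> \<nu> \<Lambda> \<Omega> p r f \<epsilon> g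
    using van by (simp add: chart_sequence_def)
  define w where "w n = kernel_average \<Omega> K (\<delta> n) (u n)" for n
  have w_regular: "w n \<in> borel_measurable borel" "continuous_on (frontier \<Omega>) (w n)" for n
    unfolding w_def by (rule kernel_average_regular[OF o bdd K \<delta>(1) rep(1) rep(4) um rep(2)])+
  let ?H = "hausdorff_measure (DIM('a) - 1) :: 'a measure"
  let ?P = "graph \<inter> ball p (r / (128 * \<Lambda>))"
  have P_sub: "?P \<subseteq> frontier \<Omega> \<inter> ball p r"
  proof -
    have "r / (128 * \<Lambda>) \<le> r / 1" using r_pos \<Lambda>_ge_1 by (intro divide_left_mono) auto
    then have "ball p (r / (128 * \<Lambda>)) \<subseteq> ball p r" by (intro subset_ball) simp
    then show ?thesis unfolding frontier_eq_graph by blast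
  qed
  \<comment> \<open>A lower bound for the kernel mass at boundary points of the chart: above each of them
    \<open>\<Omega>\<close> contains a ball of radius \<open>\<eta>' * \<delta> n / (4 * \<Lambda>)\<close> on which the kernel is at least \<open>\<kappa>'\<close>.\<close>
  define \<omega> where "\<omega> = \<kappa>' * unit_ball_vol (real DIM('a)) * (\<eta>' / (4 * \<Lambda>)) ^ DIM('a)"
  have \<omega>: "0 < \<omega>" using K_lower \<Lambda>_ge_1 by (simp add: \<omega>_def)
  have K0: "0 \<le> K 0" by (rule admissible_kernelD(1)[OF K(1)]) simp
  have start: "\<exists>q \<rho>. 0 < \<rho> \<and> ball q \<rho> \<subseteq> \<Omega> \<and> vanishes_on (ball q \<rho>)"
  proof (rule vanishes_on_ball_of_trace[where w = w and \<alpha> = "rK / \<eta>" and c = "K 0 * \<eta> ^ DIM('a) / \<omega>"])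
    show "0 < rK / \<eta>" using rK R_lower by simp
    show "0 \<le> K 0 * \<eta> ^ DIM('a) / \<omega>" using K0 R_lower \<omega> by simp
    show "w n \<in> borel_measurable borel" for n by (rule w_regular(1))
    show "(\<lambda>n. \<integral>\<^sup>+x. indicator ?P x * ennreal ((w n x)\<^sup>2) \<partial>?H) \<longlonglongrightarrow> 0"
    proof (rule tendsto_sandwich[OF _ _ tendsto_const])
      show "\<forall>\<^sub>F n in sequentially. (\<integral>\<^sup>+x. indicator ?P x * ennreal ((w n x)\<^sup>2) \<partial>?H) \<le>
          ennreal (\<integral>x. (w n x)\<^sup>2 \<partial>surface_measure \<Omega>)"
        unfolding surface_square_integral[OF \<Omega> w_regular, symmetric]
        using P_sub by (intro always_eventually allI nn_integral_mono mult_right_mono) (auto simp: indicator_def)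
      have "(\<lambda>n. ennreal (\<integral>x. (w n x)\<^sup>2 \<partial>surface_measure \<Omega>)) \<longlonglongrightarrow> ennreal 0"
        unfolding w_def by (intro tendsto_ennrealI B)
      then show "(\<lambda>n. ennreal (\<integral>x. (w n x)\<^sup>2 \<partial>surface_measure \<Omega>)) \<longlonglongrightarrow> 0" by simp
    qed simp
    have "\<forall>\<^sub>F n in sequentially. \<delta> n < r / (2 * \<eta>')"
      using r_pos K_lower by (intro order_tendstoD(2)[OF \<delta>(2)]) simp
    then show "\<forall>\<^sub>F n in sequentially. \<forall>m. \<forall>x\<in>?P. ennreal \<bar>m\<bar> \<le> ennreal \<bar>w n x\<bar> +
      ennreal (K 0 * \<eta> ^ DIM('a) / \<omega> / \<epsilon> n ^ DIM('a)) *
        near_oscillation \<Omega> (rK / \<eta> * \<epsilon> n) (f n) m x"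
    proof eventually_elim
      case (elim n)
      have dn: "0 < \<delta> n" by (rule \<delta>(1))
      have \<eta>: "0 < \<eta>" using R_lower by simp
      show ?case
      proof (intro allI ballI)
        fix m x assume x: "x \<in> ?P"
        define b where "b = \<eta>' * \<delta> n / (4 * \<Lambda>)"
        have e': "0 < \<eta>' * \<delta> n" "\<eta>' * \<delta> n < r / 2" using K_lower dn elim by (auto simp: field_simps)
        have b: "0 < b" "b \<le> \<eta>' * \<delta> n / 4" "\<Lambda> * b = \<eta>' * \<delta> n / 4"
        proof -
          show "0 < b" "\<Lambda> * b = \<eta>' * \<delta> n / 4" using e' \<Lambda>_ge_1 by (auto simp: b_def)
          show "b \<le> \<eta>' * \<delta> n / 4" unfolding b_def using e' \<Lambda>_ge_1 by (intro divide_left_mono) auto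
        qed
        have nx: "norm (x - p) < r / 128"
        proof -
          have "norm (x - p) < r / (128 * \<Lambda>)" using x by (simp add: dist_norm norm_minus_commute)
          also have "\<dots> \<le> r / 128" using r_pos \<Lambda>_ge_1 by (intro divide_left_mono) auto
          finally show ?thesis .
        qed
        have "\<kappa>' / \<delta> n ^ DIM('a) * (unit_ball_vol (real DIM('a)) * b ^ DIM('a)) \<le> kernel_mass \<Omega> K (\<delta> n) x"
        proof (rule kernel_mass_lower[where \<eta> = \<eta>', OF o bdd K(1) dn K_lower(1)])
          show "ball (x + (\<eta>' * \<delta> n / 2) *\<^sub>R \<nu>) b \<subseteq> \<Omega>"
            using x nx b e' r_pos by (intro above_in_domain) auto
          show "ball (x + (\<eta>' * \<delta> n / 2) *\<^sub>R \<nu>) b \<subseteq> cball x (\<eta>' * \<delta> n)"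
          proof
            fix z assume z: "z \<in> ball (x + (\<eta>' * \<delta> n / 2) *\<^sub>R \<nu>) b"
            have "dist x z \<le> dist x (x + (\<eta>' * \<delta> n / 2) *\<^sub>R \<nu>) + dist (x + (\<eta>' * \<delta> n / 2) *\<^sub>R \<nu>) z" by (rule dist_triangle)
            also have "dist x (x + (\<eta>' * \<delta> n / 2) *\<^sub>R \<nu>) = \<eta>' * \<delta> n / 2" using e' by (simp add: dist_norm)
            finally show "z \<in> cball x (\<eta>' * \<delta> n)" using z b e' by simp
          qed
        qed (use K_lower b in auto)
        moreover have "\<kappa>' / \<delta> n ^ DIM('a) * (unit_ball_vol (real DIM('a)) * b ^ DIM('a)) = \<omega>"
          using dn by (simp add: \<omega>_def b_def power_divide power_mult_distrib)
        ultimately have mass: "\<omega> \<le> kernel_mass \<Omega> K (\<delta> n) x" by simp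
        have "ennreal \<bar>m\<bar> \<le> ennreal \<bar>w n x\<bar> + ennreal (K 0 / (\<delta> n ^ DIM('a) * \<omega>)) *
            near_oscillation \<Omega> (rK * \<delta> n) (f n) m x"
          unfolding w_def
          by (rule constant_le_kernel_average[OF o bdd K(1) dn _ rK(1) \<omega> mass rep(1) rep(4) um rep(2)]) (use rK(2) in blast)
        moreover have "K 0 * \<eta> ^ DIM('a) / \<omega> / \<epsilon> n ^ DIM('a) = K 0 / (\<delta> n ^ DIM('a) * \<omega>)"
          using \<eta> by (simp add: \<epsilon>_def power_mult_distrib)
        moreover have "rK / \<eta> * \<epsilon> n = rK * \<delta> n" using \<eta> by (simp add: \<epsilon>_def)
        ultimately show "ennreal \<bar>m\<bar> \<le> ennreal \<bar>w n x\<bar> +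
            ennreal (K 0 * \<eta> ^ DIM('a) / \<omega> / \<epsilon> n ^ DIM('a)) *
            near_oscillation \<Omega> (rK / \<eta> * \<epsilon> n) (f n) m x"
          by (simp only:)
      qed
    qed
  qed
  then obtain q \<rho> where "0 < \<rho>" "ball q \<rho> \<subseteq> \<Omega>" "vanishes_on (ball q \<rho>)" by blast
  then have "vanishes_on \<Omega>" by (rule vanishes_on_domain[OF \<Omega>])
  then have "(\<lambda>n. ennreal ((L2_norm \<Omega> (u n))\<^sup>2)) \<longlonglongrightarrow> 0" by (simp add: vanishes_on_def rep(5))
  then have "(\<lambda>n. (L2_norm \<Omega> (u n))\<^sup>2) \<longlonglongrightarrow> 0" by (subst (asm) ennreal_tendsto_0_iff) auto
  then have "(\<lambda>n. sqrt ((L2_norm \<Omega> (u n))\<^sup>2)) \<longlonglongrightarrow> sqrt 0" by (rule tendsto_real_sqrt)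
  then show ?thesis by (simp add: L2_norm_nonneg)
qed

theorem theorem2p8:
  fixes \<Omega> :: "'a::euclidean_space set"
    and R Khat :: "real \<Rightarrow> real"
    and \<delta> c C :: "nat \<Rightarrow> real"
    and \<rho> :: "nat \<Rightarrow> 'a \<Rightarrow> 'a \<Rightarrow> 'a \<Rightarrow> real"
    and e1 :: 'a
    and u :: "nat \<Rightarrow> 'a \<Rightarrow> real"
  assumes "bounded_lipschitz_domain \<Omega>"
    and "e1 \<in> Basis"
    and "admissible_kernel R" and "\<exists>s\<ge>0. R s \<noteq> 0"
    and "\<And>n. 0 < \<delta> n" and "\<delta> \<longlonglongrightarrow> 0"
    and "\<And>n. 0 < c n" and "c \<longlonglongrightarrow> 0"
    and "\<And>n. 0 < C n" and "C \<longlonglongrightarrow> 0"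
    and symmetric: "\<And>n x y z. x \<in> frontier \<Omega> \<Longrightarrow> y \<in> \<Omega> \<Longrightarrow> z \<in> \<Omega> \<Longrightarrow> \<rho> n x y z = \<rho> n x z y"
    and compact_support: "\<And>n x y z. x \<in> frontier \<Omega> \<Longrightarrow> y \<in> \<Omega> \<Longrightarrow> z \<in> \<Omega> \<Longrightarrow>
      \<rho> n x y z \<noteq> 0 \<Longrightarrow> norm (x - y) \<le> c n \<and> norm (x - z) \<le> c n"
    and "admissible_kernel Khat" and "\<exists>s\<ge>0. Khat s \<noteq> 0"
    and coercivity: "\<And>n v. v \<in> L2 \<Omega> \<Longrightarrow>
      C n * boundary_energy \<Omega> (\<rho> n) v (\<lambda>_. 0) \<ge>
      (\<integral>x. (kernel_average \<Omega> Khat (\<delta> n) v x)\<^sup>2 \<partial>surface_measure \<Omega>)"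
    and "\<And>n. u n \<in> L2 \<Omega>"
    and almost_minimizing: "(\<lambda>n. nonlocal_energy \<Omega> R (\<rho> n) (\<delta> n) (u n) -
      (INF v\<in>L2 \<Omega>. nonlocal_energy \<Omega> R (\<rho> n) (\<delta> n) v)) \<longlonglongrightarrow> 0"
  shows "relatively_compact_in (L2_topology \<Omega>) (range u) \<and>
    (\<exists>w. is_minimizer_on (L2 \<Omega>) (\<lambda>v. ereal (sigma_const R e1) * dirichlet_energy \<Omega> v) w \<and>
      (\<lambda>n. ereal (nonlocal_energy \<Omega> R (\<rho> n) (\<delta> n) (u n)))
        \<longlonglongrightarrow> ereal (sigma_const R e1) * dirichlet_energy \<Omega> w) \<and>
    (\<forall>w. cluster_point_in (L2_topology \<Omega>) u w \<longrightarrow> is_minimizer_on (L2 \<Omega>) (dirichlet_energy \<Omega>) w)"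
proof -
  have \<Omega>: "open \<Omega>" "bounded \<Omega>" using assms(1) by (auto simp: bounded_lipschitz_domain_def)
  note R = \<open>admissible_kernel R\<close> and \<delta> = \<open>\<And>n. 0 < \<delta> n\<close> and C = \<open>\<And>n. 0 < C n\<close> and u = \<open>\<And>n. u n \<in> L2 \<Omega>\<close>
  define D where "D n v = 1 / (\<delta> n)\<^sup>2 * kernel_form DIM('a) \<Omega> R (\<delta> n) v" for n and v :: "'a \<Rightarrow> real"
  define E where "E n v = boundary_energy \<Omega> (\<rho> n) v (\<lambda>_. 0)" for n v
  define F where "F n v = nonlocal_energy \<Omega> R (\<rho> n) (\<delta> n) v" for n v
  have FDE: "F n v = D n v + E n v" for n v by (simp add: F_def D_def E_def nonlocal_energy_def)
  have D0: "0 \<le> D n v" for n v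
    unfolding D_def using scaled_kernel_bounds(1)[OF R \<delta>[of n]]
    by (intro mult_nonneg_nonneg Bochner_Integration.integral_nonneg) auto
  have E_ge: "(\<integral>x. (kernel_average \<Omega> Khat (\<delta> n) v x)\<^sup>2 \<partial>surface_measure \<Omega>) \<le> C n * E n v" if "v \<in> L2 \<Omega>" for n v
    using coercivity[OF that, of n] by (simp add: E_def)
  have E0: "0 \<le> E n v" if "v \<in> L2 \<Omega>" for n v
  proof -
    have "0 \<le> C n * E n v"
      using E_ge[OF that, of n] by (rule order_trans[rotated]) (intro Bochner_Integration.integral_nonneg, simp)
    then show ?thesis using C[of n] by (simp add: zero_le_mult_iff)
  qed
  have F_zero: "F n (\<lambda>x. 0) = 0" for n
    by (simp add: F_def nonlocal_energy_def boundary_energy_def)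
  \<comment> \<open>The infimum is attained at \<open>0\<close>, so the energies themselves tend to \<open>0\<close>.\<close>
  have "(INF v\<in>L2 \<Omega>. F n v) = 0" for n
  proof (rule cInf_eq_minimum)
    show "0 \<in> F n ` L2 \<Omega>" using F_zero[of n] zero_in_L2 by (metis image_eqI)
    show "\<And>x. x \<in> F n ` L2 \<Omega> \<Longrightarrow> 0 \<le> x" using D0 E0 by (auto simp: FDE)
  qed
  then have F_lim: "(\<lambda>n. F n (u n)) \<longlonglongrightarrow> 0" using almost_minimizing by (simp add: F_def[symmetric])
  have D_lim: "(\<lambda>n. D n (u n)) \<longlonglongrightarrow> 0"
    by (rule tendsto_sandwich[OF _ _ tendsto_const F_lim])
      (use D0 E0[OF u] in \<open>auto simp: FDE intro!: always_eventually\<close>)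
  have CF_lim: "(\<lambda>n. C n * F n (u n)) \<longlonglongrightarrow> 0"
    using tendsto_mult[OF \<open>C \<longlonglongrightarrow> 0\<close> F_lim] by simp
  have B_lim: "(\<lambda>n. \<integral>x. (kernel_average \<Omega> Khat (\<delta> n) (u n) x)\<^sup>2 \<partial>surface_measure \<Omega>) \<longlonglongrightarrow> 0"
  proof (rule tendsto_sandwich[OF _ _ tendsto_const CF_lim])
    have "C n * E n (u n) \<le> C n * F n (u n)" for n
      using C[of n] D0[of n "u n"] by (intro mult_left_mono) (auto simp: FDE)
    then show "\<forall>\<^sub>F n in sequentially.
        (\<integral>x. (kernel_average \<Omega> Khat (\<delta> n) (u n) x)\<^sup>2 \<partial>surface_measure \<Omega>) \<le> C n * F n (u n)"
      using E_ge[OF u] by (intro always_eventually allI) (rule order_trans)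
  qed simp
  have null: "(\<lambda>n. L2_norm \<Omega> (u n)) \<longlonglongrightarrow> 0"
    using D_lim B_lim unfolding D_def by (intro L2_norm_tendsto_0[OF assms(1) R _ _ _ \<delta> _ u]) (use assms in auto)
  have energy_null: "is_minimizer_on (L2 \<Omega>) (dirichlet_energy \<Omega>) w" "dirichlet_energy \<Omega> w = 0"
    if "w \<in> L2 \<Omega>" "AE x in lebesgue_on \<Omega>. w x = 0" for w
  proof -
    show "dirichlet_energy \<Omega> w = 0" by (rule dirichlet_energy_null[OF \<Omega> that])
    then show "is_minimizer_on (L2 \<Omega>) (dirichlet_energy \<Omega>) w"
      using that dirichlet_energy_nonneg[of \<Omega>] by (auto simp: is_minimizer_on_def is_arg_min_def not_less)
  qed
  have \<sigma>: "0 \<le> sigma_const R e1"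
    unfolding sigma_const_def using admissible_kernelD(1)[OF R]
    by (intro Bochner_Integration.integral_nonneg mult_nonneg_nonneg) auto
  have zero: "dirichlet_energy \<Omega> (\<lambda>x. 0) = 0" by (rule energy_null(2)[OF zero_in_L2]) simp
  have "is_minimizer_on (L2 \<Omega>) (\<lambda>v. ereal (sigma_const R e1) * dirichlet_energy \<Omega> v) (\<lambda>x. 0)"
    using \<sigma> dirichlet_energy_nonneg[of \<Omega>] zero zero_in_L2[of \<Omega>]
    by (auto simp: is_minimizer_on_def is_arg_min_def not_less intro!: ereal_0_le_mult)
  moreover have "(\<lambda>n. ereal (F n (u n))) \<longlonglongrightarrow> ereal (sigma_const R e1) * dirichlet_energy \<Omega> (\<lambda>x. 0)"
    using F_lim by (simp add: zero zero_ereal_def)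
  ultimately show ?thesis
    using relatively_compact_of_null[OF u null] energy_null(1)[OF cluster_point_of_null[OF u null]]
    unfolding F_def by blast
qed

end
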